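(* Let $A$ be a finite alphabet, let $T$ be the rooted tree of words $A^*$, and let $\Gamma$ be a group acting spherically transitively on $T$ by rooted automorphisms, with finite symmetric generating set $S$. Let $w\in A^{\omega}$ be an infinite path and, for $k\ge 0$, let $w_k$ be the prefix of $w$ of length $k$. Let $P=\mathrm{St}_\Gamma(w)$ and $P_k=\mathrm{St}_\Gamma(w_k)$ be the stabilizers, and let $X=\mathrm{Sch}(\Gamma,P,S)$ and $X_k=\mathrm{Sch}(\Gamma,P_k,S)$ be the corresponding Schreier graphs. Then the following are equivalent: (1) the Kesten--von Neumann--Serre (KNS) spectral measure of $X$ with respect to the approximating sequence $\{X_k\}$ coincides with the Kesten spectral measure for the simple random walk on the Cayley graph of $\Gamma$ (with respect to $S$); (2) the action of $\Gamma$ is free in the sense of ergodic theory.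
   Context: $T$ is the rooted tree whose vertices are the words in $A^*$, with $u$ joined to $ua$ for $a\in A$; its boundary $\partial T$ is $A^\omega$, the space of right-infinite words. Rooted automorphisms are length-preserving, prefix-preserving bijections of $A^*$; they act on $A^\omega$. The action is spherically transitive if $\Gamma$ is transitive on $A^k$ for each $k\geq 0$. $\nu$ is the uniform product (Bernoulli) probability measure on $A^\omega$: $\nu(uA^\omega)=|A|^{-|u|}$ for $u \in A^*$. The action is free in the sense of ergodic theory if for every $1\neq\gamma\in\Gamma$ the set $\mathrm{Fix}(\gamma)=\{v\in A^\omega\mid \gamma v=v\}$ has $\nu$-measure zero. For a subgroup $Q\le\Gamma$, the Schreier graph $\mathrm{Sch}(\Gamma,Q,S)$ has vertex set the left cosets $\Gamma/Q$ and, for each $s\in S$ and each coset $gQ$, an edge from $gQ$ to $sgQ$. Its Markov operator on $\ell^2(\Gamma/Q)$ is $Mf(gQ)=\frac1{|S|}\sum_{s\in S}f(sgQ)$. The Cayley graph is the case $Q=1$. The Kesten spectral measure for the simple random walk on the Cayley graph of $\Gamma$ is the probability measure $\mu^\Gamma(B)=\langle E(B)\delta_1,\delta_1\rangle$ on Borel subsets $B$ of $[-1,1]$, where $E$ is the projection-valued spectral measure of the self-adjoint Markov operator $M$ on $\ell^2(\Gamma)$ and $\delta_1$ is the characteristic function of the identity. For the finite graphs $X_k$ with vertex sets $V_k=\Gamma/P_k$ and Markov operators $M_k$, set $\mu_k=\sum_{\lambda\in\mathrm{Sp}(M_k)}\frac{\#_k(\lambda)}{|V_k|}\delta_\lambda$,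 where $\#_k(\lambda)$ is the multiplicity of the eigenvalue $\lambda$ of $M_k$ and $\delta_\lambda$ is the Dirac measure at $\lambda$. The KNS spectral measure of $X$ with respect to $\{X_k\}$ is the weak limit of the probability measures $\mu_k$ as $k\to\infty$ (this limit is known to exist). *)

theory Defs
  imports
    "HOL-Algebra.Group_Action"
    "HOL-Algebra.Generated_Groups"
    "HOL-Algebra.Left_Coset"
    "HOL-Analysis.Infinite_Sum"
    "HOL-Probability.Probability"
    "HOL-Library.Function_Algebras"
    "HOL-Library.Sublist"
    "Graph_Theory.Digraph"
begin

section \<open>Rooted actions on the tree of words and on its boundary\<close>

text \<open>
  The alphabet is a finite type \<open>'a\<close>, the vertices of the tree are the lists over \<open>'a\<close>, and the
  boundary consists of the functions \<open>nat \<Rightarrow> 'a\<close>.  The action need not be faithful.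
\<close>

locale rooted_action = group_action G "UNIV :: 'a::finite list set" \<phi> for G (structure) and \<phi> +
  assumes length_preserving: "g \<in> carrier G \<Longrightarrow> length (\<phi> g u) = length u"
    and prefix_preserving: "g \<in> carrier G \<Longrightarrow> prefix u v \<Longrightarrow> prefix (\<phi> g u) (\<phi> g v)"

definition spherically_transitive :: "('g, 'm) monoid_scheme \<Rightarrow> ('g \<Rightarrow> 'a list \<Rightarrow> 'a list) \<Rightarrow> bool" where
  "spherically_transitive G \<phi> \<longleftrightarrow>
     (\<forall>k u v. length u = k \<and> length v = k \<longrightarrow> (\<exists>g\<in>carrier G. \<phi> g u = v))"

definition word_prefix :: "nat \<Rightarrow> (nat \<Rightarrow> 'a) \<Rightarrow> 'a list" where
  "word_prefix k w = map w [0..<k]"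

definition boundary_action :: "('g \<Rightarrow> 'a list \<Rightarrow> 'a list) \<Rightarrow> 'g \<Rightarrow> (nat \<Rightarrow> 'a) \<Rightarrow> (nat \<Rightarrow> 'a)" where
  "boundary_action \<phi> g w = (\<lambda>n. \<phi> g (word_prefix (Suc n) w) ! n)"

lemma (in rooted_action) word_prefix_boundary_action:
  assumes g: "g \<in> carrier G"
  shows "word_prefix k (boundary_action \<phi> g w) = \<phi> g (word_prefix k w)"
proof (rule nth_equalityI)
  show "length (word_prefix k (boundary_action \<phi> g w)) = length (\<phi> g (word_prefix k w))"
    by (simp only: length_preserving[OF g] word_prefix_def length_map)
  fix i assume "i < length (word_prefix k (boundary_action \<phi> g w))"
  then have i: "i < k" by (simp add: word_prefix_def)
  have "k = Suc i + (k - Suc i)" using i by simp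
  then have "[0..<k] = [0..<Suc i] @ [Suc i..<k]"
    by (metis upt_add_eq_append zero_le)
  then have "word_prefix k w = word_prefix (Suc i) w @ map w [Suc i..<k]"
    by (simp only: word_prefix_def map_append)
  then have "prefix (\<phi> g (word_prefix (Suc i) w)) (\<phi> g (word_prefix k w))"
    by (intro prefix_preserving[OF g]) simp
  then obtain zs where *: "\<phi> g (word_prefix k w) = \<phi> g (word_prefix (Suc i) w) @ zs"
    by (auto simp: prefix_def)
  have "length (\<phi> g (word_prefix (Suc i) w)) = Suc i"
    by (simp only: length_preserving[OF g] word_prefix_def length_map length_upt diff_zero)
  then have "\<phi> g (word_prefix k w) ! i = \<phi> g (word_prefix (Suc i) w) ! i"
    unfolding * by (simp only: nth_append lessI if_True)
  moreover have "word_prefix k (boundary_action \<phi> g w) ! i = boundary_action \<phi> g w i"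
    using i by (simp add: word_prefix_def)
  ultimately show "word_prefix k (boundary_action \<phi> g w) ! i = \<phi> g (word_prefix k w) ! i"
    by (simp only: boundary_action_def)
qed

definition bernoulli_measure :: "(nat \<Rightarrow> 'a::finite) measure" where
  "bernoulli_measure = PiM UNIV (\<lambda>_. uniform_count_measure UNIV)"

lemma emeasure_bernoulli_cylinder:
  "emeasure bernoulli_measure {w. word_prefix (length u) w = (u :: 'a::finite list)}
     = ennreal (1 / real CARD('a) ^ length u)"
proof -
  interpret product_prob_space "\<lambda>_::nat. uniform_count_measure (UNIV :: 'a set)" UNIV
    by (rule product_prob_spaceI) (rule prob_space_uniform_count_measure, simp_all)
  have "word_prefix (length u) w = u \<longleftrightarrow> (\<forall>i<length u. w i = u ! i)" for w
    unfolding word_prefix_def list_eq_iff_nth_eq[of _ u] by simp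
  moreover have "w \<in> space (PiM UNIV (\<lambda>_::nat. uniform_count_measure (UNIV :: 'a set)))" for w
    by (simp add: space_PiM space_uniform_count_measure)
  ultimately have "{w. word_prefix (length u) w = u}
      = {w \<in> space (PiM UNIV (\<lambda>_::nat. uniform_count_measure (UNIV :: 'a set))).
           \<forall>i\<in>{..<length u}. w i \<in> {u ! i}}"
    by auto
  then have "emeasure bernoulli_measure {w. word_prefix (length u) w = u}
      = emeasure (PiM UNIV (\<lambda>_::nat. uniform_count_measure (UNIV :: 'a set)))
          {w \<in> space (PiM UNIV (\<lambda>_::nat. uniform_count_measure (UNIV :: 'a set))).
             \<forall>i\<in>{..<length u}. w i \<in> {u ! i}}"
    by (simp only: bernoulli_measure_def)
  also have "\<dots> = (\<Prod>i\<in>{..<length u}. emeasure (uniform_count_measure (UNIV :: 'a set)) {u ! i})"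
    by (rule emeasure_PiM_Collect) (simp_all add: sets_uniform_count_measure)
  also have "\<dots> = ennreal (1 / real CARD('a) ^ length u)"
    by (simp add: emeasure_uniform_count_measure ennreal_power power_divide)
  finally show ?thesis .
qed

definition ergodically_free ::
    "('g, 'm) monoid_scheme \<Rightarrow> ('g \<Rightarrow> 'a::finite list \<Rightarrow> 'a list) \<Rightarrow> bool" where
  "ergodically_free G \<phi> \<longleftrightarrow>
     (\<forall>g\<in>carrier G. g \<noteq> \<one>\<^bsub>G\<^esub> \<longrightarrow> {v. boundary_action \<phi> g v = v} \<in> null_sets bernoulli_measure)"


section \<open>Schreier graphs and their Markov operators\<close>

text \<open>
  An arc is a pair of a coset \<open>gQ\<close> and a generator \<open>s\<close>, so that multiple arcs and loops
  are retained; its head is the coset \<open>sgQ\<close>.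
\<close>

definition schreier_graph ::
    "('g, 'm) monoid_scheme \<Rightarrow> 'g set \<Rightarrow> 'g set \<Rightarrow> ('g set, 'g set \<times> 'g) pre_digraph" where
  "schreier_graph G Q S =
     \<lparr>verts = lcosets\<^bsub>G\<^esub> Q, arcs = (lcosets\<^bsub>G\<^esub> Q) \<times> S, tail = fst, head = (\<lambda>(v, s). s <#\<^bsub>G\<^esub> v)\<rparr>"

text \<open>The vertices of the Cayley graph are the singletons \<open>{g}\<close>.\<close>

definition cayley_graph :: "('g, 'm) monoid_scheme \<Rightarrow> 'g set \<Rightarrow> ('g set, 'g set \<times> 'g) pre_digraph" where
  "cayley_graph G S = schreier_graph G {\<one>\<^bsub>G\<^esub>} S"

definition markov_operator :: "('v, 'e) pre_digraph \<Rightarrow> ('v \<Rightarrow> complex) \<Rightarrow> 'v \<Rightarrow> complex" where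
  "markov_operator X f v =
     (if v \<in> verts X then (\<Sum>e\<in>out_arcs X v. f (head X e)) / of_nat (card (out_arcs X v)) else 0)"

lemma markov_operator_schreier_graph:
  assumes "group G" and Q: "Q \<subseteq> carrier G" and S: "S \<subseteq> carrier G" and g: "g \<in> carrier G"
  shows "markov_operator (schreier_graph G Q S) f (g <#\<^bsub>G\<^esub> Q)
           = 1 / of_nat (card S) * (\<Sum>s\<in>S. f ((s \<otimes>\<^bsub>G\<^esub> g) <#\<^bsub>G\<^esub> Q))"
proof -
  interpret group G by fact
  let ?X = "schreier_graph G Q S" and ?v = "g <#\<^bsub>G\<^esub> Q"
  have v: "?v \<in> verts ?X"
    using g by (auto simp: schreier_graph_def LCOSETS_def)
  then have out: "out_arcs ?X ?v = Pair ?v ` S"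
    by (auto simp: schreier_graph_def out_arcs_def)
  have inj: "inj_on (Pair ?v) S" by (simp add: inj_on_def)
  have head: "head ?X (?v, s) = (s \<otimes>\<^bsub>G\<^esub> g) <#\<^bsub>G\<^esub> Q" if "s \<in> S" for s
    using that lcos_m_assoc[OF Q, of s g] S g by (auto simp: schreier_graph_def)
  show ?thesis
    using v inj by (simp add: markov_operator_def out sum.reindex card_image head)
qed


section \<open>The Hilbert space of square-summable functions and spectral measures\<close>

text \<open>Elements of \<open>\<ell>\<^sup>2(V)\<close> are extended by zero outside \<open>V\<close>.\<close>

definition ell2 :: "'v set \<Rightarrow> ('v \<Rightarrow> complex) set" where
  "ell2 V = {f. (\<forall>x. x \<notin> V \<longrightarrow> f x = 0) \<and> (\<lambda>x. (cmod (f x))\<^sup>2) summable_on V}"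

definition ell2_inner :: "'v set \<Rightarrow> ('v \<Rightarrow> complex) \<Rightarrow> ('v \<Rightarrow> complex) \<Rightarrow> complex" where
  "ell2_inner V f g = (\<Sum>\<^sub>\<infinity>x\<in>V. f x * cnj (g x))"

definition dirac_function :: "'v \<Rightarrow> 'v \<Rightarrow> complex" where
  "dirac_function x = (\<lambda>y. if y = x then 1 else 0)"

text \<open>Linear, self-adjoint and idempotent; boundedness is automatic.\<close>

definition orthogonal_projection_on ::
    "'v set \<Rightarrow> (('v \<Rightarrow> complex) \<Rightarrow> ('v \<Rightarrow> complex)) \<Rightarrow> bool" where
  "orthogonal_projection_on V p \<longleftrightarrow>
     (\<forall>f\<in>ell2 V. p f \<in> ell2 V) \<and>
     (\<forall>f\<in>ell2 V. \<forall>g\<in>ell2 V. \<forall>a b. p (\<lambda>x. a * f x + b * g x) = (\<lambda>x. a * p f x + b * p g x)) \<and>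
     (\<forall>f\<in>ell2 V. \<forall>g\<in>ell2 V. ell2_inner V (p f) g = ell2_inner V f (p g)) \<and>
     (\<forall>f\<in>ell2 V. p (p f) = p f)"

text \<open>
  Boundedly supported projection-valued measures on the Borel sets of the real line;
  countable additivity is required in the weak operator topology (for projections this is
  equivalent to additivity in the strong operator topology).
\<close>

definition projection_valued_measure ::
    "'v set \<Rightarrow> (real set \<Rightarrow> ('v \<Rightarrow> complex) \<Rightarrow> ('v \<Rightarrow> complex)) \<Rightarrow> bool" where
  "projection_valued_measure V E \<longleftrightarrow>
     (\<forall>B\<in>sets borel. orthogonal_projection_on V (E B)) \<and>
     (\<exists>r. \<forall>f\<in>ell2 V. E {-r..r} f = f) \<and>
     (\<forall>f\<in>ell2 V. E UNIV f = f \<and> E {} f = (\<lambda>_. 0)) \<and>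
     (\<forall>B\<in>sets borel. \<forall>C\<in>sets borel. \<forall>f\<in>ell2 V. E (B \<inter> C) f = E B (E C f)) \<and>
     (\<forall>B :: nat \<Rightarrow> real set. range B \<subseteq> sets borel \<longrightarrow> disjoint_family B \<longrightarrow>
        (\<forall>f\<in>ell2 V. \<forall>g\<in>ell2 V.
           (\<lambda>n. ell2_inner V (E (B n) f) g) sums ell2_inner V (E (\<Union>n. B n) f) g))"

definition scalar_spectral_measure ::
    "'v set \<Rightarrow> (real set \<Rightarrow> ('v \<Rightarrow> complex) \<Rightarrow> ('v \<Rightarrow> complex)) \<Rightarrow> ('v \<Rightarrow> complex) \<Rightarrow> real measure" where
  "scalar_spectral_measure V E f =
     measure_of UNIV (sets borel) (\<lambda>B. ennreal (Re (ell2_inner V (E B f) f)))"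

text \<open>
  \<open>E\<close> is the spectral measure of the bounded self-adjoint operator \<open>T\<close>: \<open>T = \<integral> t dE(t)\<close>, read as an
  identity of quadratic forms.
\<close>

definition is_spectral_measure ::
    "'v set \<Rightarrow> (('v \<Rightarrow> complex) \<Rightarrow> ('v \<Rightarrow> complex)) \<Rightarrow>
     (real set \<Rightarrow> ('v \<Rightarrow> complex) \<Rightarrow> ('v \<Rightarrow> complex)) \<Rightarrow> bool" where
  "is_spectral_measure V T E \<longleftrightarrow>
     projection_valued_measure V E \<and>
     (\<forall>f\<in>ell2 V. ell2_inner V (T f) f
        = complex_of_real (integral\<^sup>L (scalar_spectral_measure V E f) (\<lambda>t. t)))"

text \<open>
  By the spectral theorem such an \<open>E\<close> exists, and it is unique up to its irrelevant values
  on sets that are not Borel and functions outside \<open>\<ell>\<^sup>2\<close>.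
\<close>

definition spectral_measure_of ::
    "'v set \<Rightarrow> (('v \<Rightarrow> complex) \<Rightarrow> ('v \<Rightarrow> complex)) \<Rightarrow>
     (real set \<Rightarrow> ('v \<Rightarrow> complex) \<Rightarrow> ('v \<Rightarrow> complex))" where
  "spectral_measure_of V T = (SOME E. is_spectral_measure V T E)"

text \<open>Regarded as a measure on the real line; it is concentrated on \<open>[-1,1]\<close>.\<close>

definition kesten_spectral_measure :: "('g, 'm) monoid_scheme \<Rightarrow> 'g set \<Rightarrow> real measure" where
  "kesten_spectral_measure G S =
     (let X = cayley_graph G S in
      scalar_spectral_measure (verts X) (spectral_measure_of (verts X) (markov_operator X))
        (dirac_function {\<one>\<^bsub>G\<^esub>}))"


section \<open>The Kesten--von Neumann--Serre spectral measure\<close>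

definition eigenspace ::
    "'v set \<Rightarrow> (('v \<Rightarrow> complex) \<Rightarrow> ('v \<Rightarrow> complex)) \<Rightarrow> real \<Rightarrow> ('v \<Rightarrow> complex) set" where
  "eigenspace V T l = {f \<in> ell2 V. T f = (\<lambda>x. complex_of_real l * f x)}"

text \<open>
  Only used for self-adjoint operators on finite-dimensional spaces: the spectrum is then the set
  of real eigenvalues, and geometric and algebraic multiplicities agree.
\<close>

definition eigenvalues :: "'v set \<Rightarrow> (('v \<Rightarrow> complex) \<Rightarrow> ('v \<Rightarrow> complex)) \<Rightarrow> real set" where
  "eigenvalues V T = {l. \<exists>f\<in>eigenspace V T l. f \<noteq> (\<lambda>_. 0)}"

definition fun_scale :: "complex \<Rightarrow> ('v \<Rightarrow> complex) \<Rightarrow> ('v \<Rightarrow> complex)" where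
  "fun_scale c f = (\<lambda>x. c * f x)"

lemma vector_space_fun_scale: "vector_space (fun_scale :: complex \<Rightarrow> ('v \<Rightarrow> complex) \<Rightarrow> _)"
proof
  show "fun_scale a (f + g) = fun_scale a f + fun_scale a g" for a and f g :: "'v \<Rightarrow> complex"
    unfolding fun_scale_def plus_fun_def by (simp only: distrib_left)
  show "fun_scale (a + b) f = fun_scale a f + fun_scale b f" for a b and f :: "'v \<Rightarrow> complex"
    unfolding fun_scale_def plus_fun_def by (simp only: distrib_right)
  show "fun_scale a (fun_scale b f) = fun_scale (a * b) f" for a b and f :: "'v \<Rightarrow> complex"
    unfolding fun_scale_def by (simp only: mult.assoc)
  show "fun_scale 1 f = f" for f :: "'v \<Rightarrow> complex"
    unfolding fun_scale_def by (simp only: mult_1_left)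
qed

definition eigenvalue_multiplicity ::
    "'v set \<Rightarrow> (('v \<Rightarrow> complex) \<Rightarrow> ('v \<Rightarrow> complex)) \<Rightarrow> real \<Rightarrow> nat" where
  "eigenvalue_multiplicity V T l = vector_space.dim fun_scale (eigenspace V T l)"

definition eigenvalue_counting_measure :: "('v, 'e) pre_digraph \<Rightarrow> real measure" where
  "eigenvalue_counting_measure X =
     (let V = verts X; M = markov_operator X in
      measure_of UNIV (sets borel)
        (\<lambda>B. \<Sum>l\<in>eigenvalues V M.
           ennreal (real (eigenvalue_multiplicity V M l) / real (card V)) * emeasure (return borel l) B))"

text \<open>
  The graph \<open>X\<close> enters only by name: the measure depends on the approximating finite
  graphs alone.  Weak limits of probability measures on the line are unique.
\<close>

definition KNS_spectral_measure ::
    "('v, 'e) pre_digraph \<Rightarrow> (nat \<Rightarrow> ('v, 'e) pre_digraph) \<Rightarrow> real measure" where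
  "KNS_spectral_measure X Xs =
     (THE \<mu>. real_distribution \<mu> \<and> weak_conv_m (\<lambda>k. eigenvalue_counting_measure (Xs k)) \<mu>)"

end

theory Submission
  imports Defs "HOL-Computational_Algebra.Fundamental_Theorem_Algebra"
begin

text \<open>
  The \<open>n\<close>-th moment of the counting measure of \<open>X\<^sub>k\<close> is a normalised trace, hence the average, over the
  words of length \<open>n\<close> in \<open>S\<close>, of the proportion of vertices of level \<open>k\<close> fixed by the value of the word.
  As \<open>k\<close> grows this proportion decreases to the measure of the set of boundary points fixed by that
  group element, so by the method of moments the limit measure exists.  The \<open>n\<close>-th moment of
  the Kesten measure is the proportion of words with value \<open>1\<close>.  Compactly supported measures are
  determined by their moments, and the comparison of moments is termwise an inequality; hence
  the two measures agree iff \<open>Fix(g)\<close> is null for every \<open>g \<noteq> 1\<close>.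

  A spectral measure is only known through Hilbert's epsilon, so the spectral theorem is needed: a self-adjoint
  contraction \<open>T\<close> satisfies \<open>\<langle>((1+T)/2)\<^sup>j ((1-T)/2)\<^sup>k f, f\<rangle> \<ge> 0\<close>, so Hausdorff's solution of the moment problem gives a
  measure with moments \<open>\<langle>T\<^sup>n f, f\<rangle>\<close>, and polarization and the uniqueness of
  measures with given moments turn these into a projection-valued measure.
\<close>

section \<open>Functionals on bounded Borel functions\<close>

text \<open>The defining property of a spectral measure \<open>E\<close> mentions \<open>T\<close>
  only through the first moments of its diagonal measures, so the higher moments of the chosen
  \<open>E\<close> have to be derived: polarization turns the identity for quadratic forms into one
  for pairs of vectors, and multiplicativity of \<open>E\<close> then allows one factor
  \<open>t\<close> at a time to be split off. Off the diagonal this calls for complex measures; they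
  are represented by functionals on bounded Borel functions, compared on indicators or on moments,
  and the same functionals serve the construction of one spectral measure and the analysis of an
  arbitrary one. In the construction, positivity of the mixed moments is reached without square
  roots of operators: pairs of equal factors are shared between the two sides of the inner product,
  which leaves exponents 0 and 1, where \<open>||T f|| \<le> ||f||\<close> decides. In the final
  comparison, generation by \<open>S\<close> makes every group element the value of some word, so no
  \<open>g \<noteq> 1\<close> escapes the moments.\<close>

definition bounded_borel :: "(real \<Rightarrow> real) set" where
  "bounded_borel = {h. h \<in> borel_measurable borel \<and> (\<exists>C. \<forall>t. \<bar>h t\<bar> \<le> C)}"

lemma bounded_borelI: "h \<in> borel_measurable borel \<Longrightarrow> (\<And>t. \<bar>h t\<bar> \<le> C) \<Longrightarrow> h \<in> bounded_borel"
  by (auto simp: bounded_borel_def)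

lemma bounded_borel_indicator: "B \<in> sets borel \<Longrightarrow> (indicator B :: real \<Rightarrow> real) \<in> bounded_borel"
  by (rule bounded_borelI[where C = 1]) (auto simp: indicator_def)

lemma bounded_borel_const: "(\<lambda>t. c) \<in> bounded_borel"
  by (rule bounded_borelI[where C = "\<bar>c\<bar>"]) auto

lemma bounded_borel_mult:
  assumes "h \<in> bounded_borel" "k \<in> bounded_borel"
  shows "(\<lambda>t. h t * k t) \<in> bounded_borel"
proof -
  obtain C D where "\<And>t. \<bar>h t\<bar> \<le> C" "\<And>t. \<bar>k t\<bar> \<le> D"
    using assms by (auto simp: bounded_borel_def)
  then have "\<bar>h t * k t\<bar> \<le> C * D" for t
    unfolding abs_mult by (meson abs_ge_zero mult_mono order_trans)
  then show ?thesis
    using assms by (intro bounded_borelI) (auto simp: bounded_borel_def)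
qed

lemma bounded_borel_lincomb:
  assumes "h \<in> bounded_borel" "k \<in> bounded_borel"
  shows "(\<lambda>t. a * h t + b * k t) \<in> bounded_borel"
proof -
  obtain C D where *: "\<And>t. \<bar>h t\<bar> \<le> C" "\<And>t. \<bar>k t\<bar> \<le> D"
    using assms by (auto simp: bounded_borel_def)
  have "\<bar>a * h t + b * k t\<bar> \<le> \<bar>a\<bar> * C + \<bar>b\<bar> * D" for t
    by (rule order_trans[OF abs_triangle_ineq])
       (auto simp: abs_mult intro!: add_mono mult_left_mono *)
  then show ?thesis
    using assms by (intro bounded_borelI) (auto simp: bounded_borel_def)
qed

text \<open>Powers of \<open>t\<close> are unbounded on the line. Composed with the retraction onto
  \<open>[-r, r]\<close> they become members of \<open>bounded_borel\<close>, and a functional that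
  lives on \<open>[-r, r]\<close> does not see the difference.\<close>

definition clamp_to :: "real \<Rightarrow> real \<Rightarrow> real" where
  "clamp_to r t = max (- r) (min r t)"

lemma clamp_to_id: "\<bar>t\<bar> \<le> r \<Longrightarrow> clamp_to r t = t"
  by (auto simp: clamp_to_def)

lemma abs_clamp_to: "0 \<le> r \<Longrightarrow> \<bar>clamp_to r t\<bar> \<le> r"
  by (auto simp: clamp_to_def)

lemma continuous_clamp_to: "continuous_on A (clamp_to r)"
  unfolding clamp_to_def[abs_def] by (intro continuous_intros)

lemma measurable_clamp_to [measurable]: "clamp_to r \<in> borel_measurable borel"
  by (intro borel_measurable_continuous_onI continuous_clamp_to)

lemma bounded_borel_clamp_comp:
  assumes "0 \<le> r" "continuous_on {-r..r} h"
  shows "(\<lambda>t. h (clamp_to r t)) \<in> bounded_borel"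
proof -
  have "compact (h ` {-r..r})"
    using assms(2) by (intro compact_continuous_image) auto
  then have "\<exists>C. \<forall>t\<in>{-r..r}. \<bar>h t\<bar> \<le> C"
    by (auto dest!: compact_imp_bounded simp: bounded_iff)
  then obtain C where C: "\<And>t. t \<in> {-r..r} \<Longrightarrow> \<bar>h t\<bar> \<le> C"
    by blast
  have in_r: "clamp_to r t \<in> {-r..r}" for t
    using abs_clamp_to[OF assms(1), of t] by auto
  have "continuous_on UNIV (\<lambda>t. h (clamp_to r t))"
    using in_r by (intro continuous_on_compose2[OF assms(2)] continuous_clamp_to) auto
  then show ?thesis
    by (intro bounded_borelI[where C = C] borel_measurable_continuous_onI C in_r)
qed

lemma bounded_borel_clamp_power: "0 \<le> r \<Longrightarrow> (\<lambda>t. clamp_to r t ^ n) \<in> bounded_borel"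
  by (rule bounded_borel_clamp_comp) (auto intro!: continuous_intros)

lemma bounded_borel_clamp: "0 \<le> r \<Longrightarrow> clamp_to r \<in> bounded_borel"
  using bounded_borel_clamp_power[of r 1] by simp

text \<open>
  These functionals play the role of complex measures on \<open>[-r, r]\<close>.
\<close>

definition borel_functional :: "real \<Rightarrow> ((real \<Rightarrow> real) \<Rightarrow> complex) \<Rightarrow> bool" where
  "borel_functional r \<Phi> \<longleftrightarrow>
     (\<forall>h\<in>bounded_borel. \<forall>k\<in>bounded_borel. \<forall>a b.
        \<Phi> (\<lambda>t. a * h t + b * k t) = of_real a * \<Phi> h + of_real b * \<Phi> k) \<and>
     (\<forall>H h C. (\<forall>n. H n \<in> borel_measurable borel) \<longrightarrow> (\<forall>n t. \<bar>H n t\<bar> \<le> C) \<longrightarrow>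
        (\<forall>t. (\<lambda>n. H n t) \<longlonglongrightarrow> h t) \<longrightarrow> (\<lambda>n. \<Phi> (H n)) \<longlonglongrightarrow> \<Phi> h) \<and>
     (\<forall>h\<in>bounded_borel. \<forall>k\<in>bounded_borel. (\<forall>t. \<bar>t\<bar> \<le> r \<longrightarrow> h t = k t) \<longrightarrow> \<Phi> h = \<Phi> k)"

lemma borel_functional_lin:
  assumes "borel_functional r \<Phi>" "h \<in> bounded_borel" "k \<in> bounded_borel"
  shows "\<Phi> (\<lambda>t. a * h t + b * k t) = of_real a * \<Phi> h + of_real b * \<Phi> k"
  using assms unfolding borel_functional_def by blast

lemma borel_functional_conv:
  assumes "borel_functional r \<Phi>" "\<And>n. H n \<in> borel_measurable borel"
    and "\<And>n t. \<bar>H n t\<bar> \<le> C" "\<And>t. (\<lambda>n. H n t) \<longlonglongrightarrow> h t"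
  shows "(\<lambda>n. \<Phi> (H n)) \<longlonglongrightarrow> \<Phi> h"
proof -
  have "\<forall>H h C. (\<forall>n. H n \<in> borel_measurable borel) \<longrightarrow> (\<forall>n t. \<bar>H n t\<bar> \<le> C) \<longrightarrow>
        (\<forall>t. (\<lambda>n. H n t) \<longlonglongrightarrow> h t) \<longrightarrow> (\<lambda>n. \<Phi> (H n)) \<longlonglongrightarrow> \<Phi> h"
    using assms(1) unfolding borel_functional_def by blast
  from this[rule_format, of H C h] show ?thesis
    using assms(2-) by blast
qed

lemma borel_functional_cong:
  assumes "borel_functional r \<Phi>" "h \<in> bounded_borel" "k \<in> bounded_borel"
    and "\<And>t. \<bar>t\<bar> \<le> r \<Longrightarrow> h t = k t"
  shows "\<Phi> h = \<Phi> k"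
  using assms unfolding borel_functional_def by blast

lemma borel_functional_scale:
  assumes "borel_functional r \<Phi>" "h \<in> bounded_borel"
  shows "\<Phi> (\<lambda>t. a * h t) = of_real a * \<Phi> h"
  using borel_functional_lin[OF assms(1) assms(2) assms(2), of a 0] by simp

lemma borel_functional_add:
  assumes "borel_functional r \<Phi>" "h \<in> bounded_borel" "k \<in> bounded_borel"
  shows "\<Phi> (\<lambda>t. h t + k t) = \<Phi> h + \<Phi> k"
  using borel_functional_lin[OF assms, of 1 1] by simp

lemma borel_functional_zero:
  assumes "borel_functional r \<Phi>"
  shows "\<Phi> (\<lambda>t. 0) = 0"
  using borel_functional_scale[OF assms bounded_borel_const, of 0 0] by simp

lemma borel_functional_sum:
  assumes \<Phi>: "borel_functional r \<Phi>" and "finite I" and h: "\<And>i. i \<in> I \<Longrightarrow> h i \<in> bounded_borel"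
  shows "(\<lambda>t. \<Sum>i\<in>I. h i t) \<in> bounded_borel \<and> \<Phi> (\<lambda>t. \<Sum>i\<in>I. h i t) = (\<Sum>i\<in>I. \<Phi> (h i))"
  using assms(2) h
proof (induction I rule: finite_induct)
  case empty
  then show ?case using borel_functional_zero[OF \<Phi>] by (simp add: bounded_borel_const)
next
  case (insert i I)
  then show ?case
    using borel_functional_add[OF \<Phi>, of "h i" "\<lambda>t. \<Sum>i\<in>I. h i t"]
      bounded_borel_lincomb[of "h i" "\<lambda>t. \<Sum>i\<in>I. h i t" 1 1] by simp
qed

lemma borel_functional_lincomb:
  assumes "borel_functional r \<Phi>" "borel_functional r \<Psi>"
  shows "borel_functional r (\<lambda>h. a * \<Phi> h + b * \<Psi> h)"
  unfolding borel_functional_def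
proof (intro conjI ballI allI impI)
  fix h k c d assume "h \<in> bounded_borel" "k \<in> bounded_borel"
  then show "a * \<Phi> (\<lambda>t. c * h t + d * k t) + b * \<Psi> (\<lambda>t. c * h t + d * k t)
    = of_real c * (a * \<Phi> h + b * \<Psi> h) + of_real d * (a * \<Phi> k + b * \<Psi> k)"
    by (simp add: borel_functional_lin[OF assms(1)] borel_functional_lin[OF assms(2)] algebra_simps)
next
  fix H :: "nat \<Rightarrow> real \<Rightarrow> real" and h C
  assume *: "\<forall>n. H n \<in> borel_measurable borel" "\<forall>n t. \<bar>H n t\<bar> \<le> C" "\<forall>t. (\<lambda>n. H n t) \<longlonglongrightarrow> h t"
  show "(\<lambda>n. a * \<Phi> (H n) + b * \<Psi> (H n)) \<longlonglongrightarrow> a * \<Phi> h + b * \<Psi> h"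
    using * by (intro tendsto_intros borel_functional_conv[OF assms(1), of H C]
        borel_functional_conv[OF assms(2), of H C]) auto
next
  fix h k assume *: "h \<in> bounded_borel" "k \<in> bounded_borel" "\<forall>t. \<bar>t\<bar> \<le> r \<longrightarrow> h t = k t"
  show "a * \<Phi> h + b * \<Psi> h = a * \<Phi> k + b * \<Psi> k"
    using borel_functional_cong[OF assms(1) *(1,2)] borel_functional_cong[OF assms(2) *(1,2)] *(3)
    by simp
qed

lemma borel_functional_cnj:
  assumes "borel_functional r \<Phi>"
  shows "borel_functional r (\<lambda>h. cnj (\<Phi> h))"
  unfolding borel_functional_def
proof (intro conjI ballI allI impI)
  fix h k c d assume "h \<in> bounded_borel" "k \<in> bounded_borel"
  then show "cnj (\<Phi> (\<lambda>t. c * h t + d * k t)) = of_real c * cnj (\<Phi> h) + of_real d * cnj (\<Phi> k)"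
    by (simp add: borel_functional_lin[OF assms(1)])
next
  fix H :: "nat \<Rightarrow> real \<Rightarrow> real" and h C
  assume *: "\<forall>n. H n \<in> borel_measurable borel" "\<forall>n t. \<bar>H n t\<bar> \<le> C" "\<forall>t. (\<lambda>n. H n t) \<longlonglongrightarrow> h t"
  show "(\<lambda>n. cnj (\<Phi> (H n))) \<longlonglongrightarrow> cnj (\<Phi> h)"
    using * by (intro tendsto_intros borel_functional_conv[OF assms(1), of H C]) auto
next
  fix h k assume *: "h \<in> bounded_borel" "k \<in> bounded_borel" "\<forall>t. \<bar>t\<bar> \<le> r \<longrightarrow> h t = k t"
  show "cnj (\<Phi> h) = cnj (\<Phi> k)"
    using borel_functional_cong[OF assms(1) *(1,2)] *(3) by simp
qed

lemma borel_functional_mult: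
  assumes "borel_functional r \<Phi>" and k: "k \<in> bounded_borel"
  shows "borel_functional r (\<lambda>h. \<Phi> (\<lambda>t. k t * h t))"
  unfolding borel_functional_def
proof (intro conjI ballI allI impI)
  fix h l c d assume *: "h \<in> bounded_borel" "l \<in> bounded_borel"
  have "(\<lambda>t. k t * (c * h t + d * l t)) = (\<lambda>t. c * (k t * h t) + d * (k t * l t))"
    by (simp add: algebra_simps)
  then show "\<Phi> (\<lambda>t. k t * (c * h t + d * l t)) =
      of_real c * \<Phi> (\<lambda>t. k t * h t) + of_real d * \<Phi> (\<lambda>t. k t * l t)"
    using borel_functional_lin[OF assms(1) bounded_borel_mult[OF k *(1)] bounded_borel_mult[OF k *(2)]]
    by simp
next
  fix H :: "nat \<Rightarrow> real \<Rightarrow> real" and h C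
  assume *: "\<forall>n. H n \<in> borel_measurable borel" "\<forall>n t. \<bar>H n t\<bar> \<le> C" "\<forall>t. (\<lambda>n. H n t) \<longlonglongrightarrow> h t"
  obtain D where D: "\<And>t. \<bar>k t\<bar> \<le> D" using k by (auto simp: bounded_borel_def)
  have "\<bar>k t * H n t\<bar> \<le> D * C" for n t
    unfolding abs_mult by (intro mult_mono D *(2)[rule_format] order_trans[OF abs_ge_zero D]) auto
  moreover have "(\<lambda>t. k t * H n t) \<in> borel_measurable borel" for n
    using * k by (intro borel_measurable_times) (auto simp: bounded_borel_def)
  ultimately show "(\<lambda>n. \<Phi> (\<lambda>t. k t * H n t)) \<longlonglongrightarrow> \<Phi> (\<lambda>t. k t * h t)"
    using * by (intro borel_functional_conv[OF assms(1), of _ "D * C"] tendsto_intros) auto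
next
  fix h l assume "h \<in> bounded_borel" "l \<in> bounded_borel" "\<forall>t. \<bar>t\<bar> \<le> r \<longrightarrow> h t = l t"
  then show "\<Phi> (\<lambda>t. k t * h t) = \<Phi> (\<lambda>t. k t * l t)"
    by (intro borel_functional_cong[OF assms(1)] bounded_borel_mult k) auto
qed

section \<open>Integrals as functionals, and countable additivity\<close>

lemma integrable_bounded_borel:
  assumes "finite_measure M" "sets M = sets borel" "h \<in> bounded_borel"
  shows "integrable M (h :: real \<Rightarrow> real)"
proof -
  interpret finite_measure M by fact
  obtain C where "\<And>t. \<bar>h t\<bar> \<le> C" using assms(3) by (auto simp: bounded_borel_def)
  then show ?thesis
    using assms(2,3) by (intro integrable_const_bound[where B = C])
      (auto simp: bounded_borel_def cong: measurable_cong_sets)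
qed

lemma borel_functional_integral:
  assumes M: "finite_measure M" and sets: "sets M = sets borel" and supp: "AE t in M. \<bar>t\<bar> \<le> r"
  shows "borel_functional r (\<lambda>h. complex_of_real (integral\<^sup>L M h))"
  unfolding borel_functional_def
proof (intro conjI ballI allI impI)
  interpret finite_measure M by fact
  note [measurable_cong] = sets
  {
    fix h k c d assume "h \<in> bounded_borel" "k \<in> bounded_borel"
    then show "complex_of_real (LINT t|M. c * h t + d * k t) =
        of_real c * of_real (integral\<^sup>L M h) + of_real d * of_real (integral\<^sup>L M k)"
      using integrable_bounded_borel[OF M sets] by simp
  next
    fix H :: "nat \<Rightarrow> real \<Rightarrow> real" and h C
    assume *: "\<forall>n. H n \<in> borel_measurable borel" "\<forall>n t. \<bar>H n t\<bar> \<le> C" "\<forall>t. (\<lambda>n. H n t) \<longlonglongrightarrow> h t"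
    then have [measurable]: "\<And>n. H n \<in> borel_measurable borel" by auto
    have [measurable]: "h \<in> borel_measurable borel"
      by (rule borel_measurable_LIMSEQ_real[where u = H]) (use * in auto)
    show "(\<lambda>n. complex_of_real (integral\<^sup>L M (H n))) \<longlonglongrightarrow> complex_of_real (integral\<^sup>L M h)"
      by (intro tendsto_of_real integral_dominated_convergence[where w = "\<lambda>_. C"])
         (use * in auto)
  next
    fix h k assume *: "h \<in> bounded_borel" "k \<in> bounded_borel" "\<forall>t. \<bar>t\<bar> \<le> r \<longrightarrow> h t = k t"
    then have [measurable]: "h \<in> borel_measurable borel" "k \<in> borel_measurable borel"
      by (auto simp: bounded_borel_def)
    have "integral\<^sup>L M h = integral\<^sup>L M k"
      using supp * by (intro integral_cong_AE) auto
    then show "complex_of_real (integral\<^sup>L M h) = complex_of_real (integral\<^sup>L M k)" by simp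
  }
qed

text \<open>Countable additivity is the convergence clause of \<open>borel_functional\<close> for
  the indicators of the finite unions, dominated by 1.\<close>

lemma borel_functional_sums:
  assumes \<Phi>: "borel_functional r \<Phi>" and B: "range B \<subseteq> sets borel" "disjoint_family B"
  shows "(\<lambda>n. \<Phi> (indicator (B n))) sums \<Phi> (indicator (\<Union>n. B n))"
proof -
  have Bn: "B n \<in> sets borel" for n using B(1) by auto
  have disj: "(\<Sum>i<n. indicator (B i) t :: real) = indicator (\<Union>i<n. B i) t" for n t
    by (rule indicator_UN_disjoint[symmetric])
       (use B(2) in \<open>auto simp: disjoint_family_on_def\<close>)
  have "(\<lambda>n. \<Phi> (\<lambda>t. \<Sum>i<n. indicator (B i) t)) \<longlonglongrightarrow> \<Phi> (indicator (\<Union>n. B n))"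
  proof (rule borel_functional_conv[OF \<Phi>, where C = 1])
    show "(\<lambda>t. \<Sum>i<n. indicator (B i) t :: real) \<in> borel_measurable borel" for n
      using Bn by measurable
    show "\<bar>\<Sum>i<n. indicator (B i) t\<bar> \<le> (1::real)" for n t
      unfolding disj by (auto simp: indicator_def)
    show "(\<lambda>n. \<Sum>i<n. indicator (B i) t) \<longlonglongrightarrow> (indicator (\<Union>n. B n) t :: real)" for t
      unfolding disj by (rule LIMSEQ_indicator_UN)
  qed
  moreover have "\<Phi> (\<lambda>t. \<Sum>i<n. indicator (B i) t) = (\<Sum>i<n. \<Phi> (indicator (B i)))" for n
    using borel_functional_sum[OF \<Phi>, of "{..<n}" "\<lambda>i. indicator (B i)"] Bn
    by (auto intro: bounded_borel_indicator)
  ultimately show ?thesis by (simp add: sums_def)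
qed

text \<open>The convergence clause takes the place of monotone convergence in the usual induction
  from indicators to nonnegative measurable functions; a signed function is split into its positive
  and negative parts.\<close>

lemma borel_functional_eq_0_indicators:
  assumes \<Phi>: "borel_functional r \<Phi>" and ind: "\<And>B. B \<in> sets borel \<Longrightarrow> \<Phi> (indicator B) = 0"
    and h: "h \<in> bounded_borel"
  shows "\<Phi> h = 0"
proof -
  have nonneg: "\<Phi> u = 0" if "u \<in> borel_measurable borel" "\<And>t. 0 \<le> u t" "\<And>t. u t \<le> C" for u C
  proof -
    \<comment> \<open>The bound is a premise inside the induction formula, because the induction
      rule ranges over unbounded functions too; each case has to hand it on to the pieces.\<close>
    from that(1,2) have "(\<exists>C. \<forall>t. u t \<le> C) \<longrightarrow> \<Phi> u = 0"
    proof (induction u rule: borel_measurable_induct_real)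
      case (set A) then show ?case using ind by simp
    next
      case (mult u c)
      show ?case
      proof
        assume "\<exists>C. \<forall>t. c * u t \<le> C"
        then obtain C where C: "\<And>t. c * u t \<le> C" by auto
        show "\<Phi> (\<lambda>t. c * u t) = 0"
        \<comment> \<open>For \<open>c = 0\<close> a bound on \<open>c * u\<close> gives none on
          \<open>u\<close>.\<close>
        proof (cases "c = 0")
          case True then show ?thesis using borel_functional_zero[OF \<Phi>] by simp
        next
          case False
          then have *: "u t \<le> C / c" for t
            using C[of t] mult.hyps(1) by (simp add: field_simps)
          then have "u \<in> bounded_borel"
            using mult.hyps by (intro bounded_borelI[where C = "C / c"]) auto
          moreover have "\<Phi> u = 0" using mult.IH * by blast
          ultimately show ?thesis using borel_functional_scale[OF \<Phi>, of u c] by simp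
        qed
      qed
    next
      case (add u v)
      show ?case
      proof
        assume "\<exists>C. \<forall>t. v t + u t \<le> C"
        then obtain C where C: "\<And>t. v t + u t \<le> C" by auto
        then have *: "u t \<le> C" "v t \<le> C" for t
          using add.hyps(2)[of t] add.hyps(4)[of t] C[of t] by linarith+
        then have "u \<in> bounded_borel" "v \<in> bounded_borel"
          using add.hyps by (auto intro!: bounded_borelI[where C = C])
        moreover have "\<Phi> u = 0" "\<Phi> v = 0" using add.IH * by blast+
        ultimately show "\<Phi> (\<lambda>t. v t + u t) = 0"
          using borel_functional_add[OF \<Phi>, of v u] by simp
      qed
    next
      case (seq U)
      show ?case
      proof
        assume "\<exists>C. \<forall>t. u t \<le> C"
        then obtain C where C: "\<And>t. u t \<le> C" by auto
        have le: "U i t \<le> C" for i t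
          using incseq_le[of "\<lambda>i. U i t" "u t" i] seq.hyps C[of t]
          by (force simp: incseq_def le_fun_def)
        then have "(\<lambda>i. \<Phi> (U i)) \<longlonglongrightarrow> \<Phi> u"
          using seq.hyps by (intro borel_functional_conv[OF \<Phi>, where C = C]) auto
        moreover have "\<Phi> (U i) = 0" for i using seq.IH le by auto
        ultimately show "\<Phi> u = 0" by (simp add: LIMSEQ_const_iff)
      qed
    qed
    with that show ?thesis by auto
  qed
  obtain C where C: "\<And>t. \<bar>h t\<bar> \<le> C" using h by (auto simp: bounded_borel_def)
  have "h \<in> borel_measurable borel" using h by (simp add: bounded_borel_def)
  moreover have "max 0 (h t) \<le> C" "max 0 (- h t) \<le> C" for t
    using C[of t] by linarith+
  ultimately have "\<Phi> (\<lambda>t. max 0 (h t)) = 0" "\<Phi> (\<lambda>t. max 0 (- h t)) = 0"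
    and "(\<lambda>t. max 0 (h t)) \<in> bounded_borel" "(\<lambda>t. max 0 (- h t)) \<in> bounded_borel"
    by (auto intro!: nonneg[where C = C] bounded_borelI[where C = C])
  moreover have "h = (\<lambda>t. 1 * max 0 (h t) + (-1) * max 0 (- h t))" by auto
  ultimately show ?thesis
    using borel_functional_lin[OF \<Phi>, of "\<lambda>t. max 0 (h t)" "\<lambda>t. max 0 (- h t)" 1 "-1"] by simp
qed

section \<open>Determination by moments\<close>

lemma abs_cts_step_le_1: "a < b \<Longrightarrow> \<bar>cts_step a b t\<bar> \<le> 1"
  by (auto simp: cts_step_def abs_le_iff divide_le_eq intro: order_trans[of _ 0])

text \<open>Weierstrass approximation on \<open>[-r, r]\<close> leads from polynomials to continuous
  functions, continuous ramps lead to indicators of half-lines, and a Dynkin-system argument leads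
  from these to all Borel sets.\<close>

lemma borel_functional_eq_0_moments:
  assumes \<Phi>: "borel_functional r \<Phi>" and r: "0 \<le> r"
    and mom: "\<And>n. \<Phi> (\<lambda>t. clamp_to r t ^ n) = 0"
    and h: "h \<in> bounded_borel"
  shows "\<Phi> h = 0"
proof (rule borel_functional_eq_0_indicators[OF \<Phi> _ h])
  have poly: "\<Phi> (\<lambda>t. p (clamp_to r t)) = 0" if pp: "real_polynomial_function p" for p
  proof -
    obtain a n where p: "p = (\<lambda>x. \<Sum>i\<le>n. a i * x ^ i)"
      using pp unfolding real_polynomial_function_iff_sum by (elim exE) (rule that)
    have "\<Phi> (\<lambda>t. a i * clamp_to r t ^ i) = 0" for i
      using borel_functional_scale[OF \<Phi> bounded_borel_clamp_power[OF r]] mom by simp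
    moreover have "(\<lambda>t. a i * clamp_to r t ^ i) \<in> bounded_borel" for i
      using bounded_borel_lincomb[OF bounded_borel_clamp_power[OF r] bounded_borel_const, of "a i" _ 0]
      by simp
    ultimately show ?thesis
      using borel_functional_sum[OF \<Phi>, of "{..n}" "\<lambda>i t. a i * clamp_to r t ^ i"] by (simp add: p)
  qed
  have cont: "\<Phi> k = 0" if k: "continuous_on UNIV k" "k \<in> bounded_borel" for k
  proof -
    have k': "continuous_on {-r..r} k" using k(1) continuous_on_subset by blast
    have "\<exists>p. real_polynomial_function p \<and> (\<forall>t\<in>{-r..r}. \<bar>k t - p t\<bar> < 1 / real (Suc n))" for n
      using Stone_Weierstrass_real_polynomial_function[OF compact_Icc k', of "1 / real (Suc n)"]
      by (metis of_nat_0_less_iff zero_less_Suc zero_less_divide_1_iff)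
    then obtain p where p: "\<And>n. real_polynomial_function (p n)"
      "\<And>n t. t \<in> {-r..r} \<Longrightarrow> \<bar>k t - p n t\<bar> < 1 / real (Suc n)" by metis
    have in_r: "clamp_to r t \<in> {-r..r}" for t
      using abs_clamp_to[OF r, of t] by auto
    note kc = bounded_borel_clamp_comp[OF r k']
    then obtain C where C: "\<And>t. \<bar>k (clamp_to r t)\<bar> \<le> C" by (auto simp: bounded_borel_def)
    have "(\<lambda>n. \<Phi> (\<lambda>t. p n (clamp_to r t))) \<longlonglongrightarrow> \<Phi> (\<lambda>t. k (clamp_to r t))"
    \<comment> \<open>The approximation errors are at most 1, hence the uniform bound
      \<open>C + 1\<close>.\<close>
    proof (rule borel_functional_conv[OF \<Phi>, where C = "C + 1"])
      have "continuous_on {-r..r} (p n)" for n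
        using continuous_on_polymonial_function[of "p n" "{-r..r}"] p(1)[of n]
        by (simp add: real_polynomial_function_eq)
      then show "(\<lambda>t. p n (clamp_to r t)) \<in> borel_measurable borel" for n
        using bounded_borel_clamp_comp[OF r] by (auto simp: bounded_borel_def)
      have le: "\<bar>k (clamp_to r t) - p n (clamp_to r t)\<bar> \<le> 1 / real (Suc n)" for n t
        using p(2)[OF in_r] less_imp_le by blast
      have "1 / real (Suc n) \<le> 1" for n by simp
      then show "\<bar>p n (clamp_to r t)\<bar> \<le> C + 1" for n t
        using le[of t n] C[of t] by (smt (verit))
      show "(\<lambda>n. p n (clamp_to r t)) \<longlonglongrightarrow> k (clamp_to r t)" for t
      proof (rule LIM_zero_cancel, rule tendsto_rabs_zero_cancel,
            rule tendsto_sandwich[where f = "\<lambda>_. 0"])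
        show "\<forall>\<^sub>F n in sequentially. \<bar>p n (clamp_to r t) - k (clamp_to r t)\<bar> \<le> 1 / real (Suc n)"
          using le by (simp add: abs_minus_commute)
        show "(\<lambda>n. 1 / real (Suc n)) \<longlonglongrightarrow> 0" by (rule LIMSEQ_Suc[OF lim_1_over_n])
      qed auto
    qed
    then have "\<Phi> (\<lambda>t. k (clamp_to r t)) = 0"
      using poly[OF p(1)] by (simp add: LIMSEQ_const_iff)
    moreover have "\<Phi> k = \<Phi> (\<lambda>t. k (clamp_to r t))"
      by (rule borel_functional_cong[OF \<Phi> k(2) kc]) (simp add: clamp_to_id)
    ultimately show ?thesis by simp
  qed
  have atMost: "\<Phi> (indicator {..x}) = 0" for x
  proof -
    \<comment> \<open>The ramp falls from 1 at \<open>x\<close> to 0 at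
      \<open>x + 1 / (n + 1)\<close>, so it decreases to the indicator of the closed
      half-line.\<close>
    let ?H = "\<lambda>n t. cts_step x (x + 1 / real (Suc n)) t"
    have cts: "continuous_on UNIV (?H n)" for n
      by (intro uniformly_continuous_imp_continuous cts_step_uniformly_continuous) simp
    have bound: "\<bar>?H n t\<bar> \<le> 1" for n t
      by (rule abs_cts_step_le_1) simp
    have "(\<lambda>n. \<Phi> (?H n)) \<longlonglongrightarrow> \<Phi> (indicator {..x})"
    proof (rule borel_functional_conv[OF \<Phi> _ bound])
      show "?H n \<in> borel_measurable borel" for n
        by (intro borel_measurable_continuous_onI cts)
      fix t
      show "(\<lambda>n. ?H n t) \<longlonglongrightarrow> indicator {..x} t"
      proof (cases "t \<le> x")
        case True then show ?thesis by (simp add: cts_step_def)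
      next
        case False
        have "(\<lambda>n. x + 1 / real (Suc n)) \<longlonglongrightarrow> x + 0"
          by (intro tendsto_intros LIMSEQ_Suc[OF lim_1_over_n])
        then have "\<forall>\<^sub>F n in sequentially. x + 1 / real (Suc n) < t"
          using False by (intro order_tendstoD(2)[of _ "x + 0"]) auto
        then have "\<forall>\<^sub>F n in sequentially. ?H n t = indicator {..x} t"
          by (rule eventually_mono) (use False in \<open>auto simp: cts_step_def\<close>)
        then show ?thesis by (rule tendsto_eventually)
      qed
    qed
    moreover have "\<Phi> (?H n) = 0" for n
      by (intro cont cts bounded_borelI[OF borel_measurable_continuous_onI[OF cts] bound])
    ultimately show ?thesis by (simp add: LIMSEQ_const_iff)
  qed
  have one: "\<Phi> (\<lambda>t. 1) = 0" using mom[of 0] by simp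
  have compl: "\<Phi> (indicator (UNIV - A)) = 0" if "A \<in> sets borel" "\<Phi> (indicator A) = 0" for A
  proof -
    have "indicator (UNIV - A) = (\<lambda>t. 1 * 1 + (-1) * indicator A t :: real)"
      by (auto simp: indicator_def)
    then show ?thesis
      using borel_functional_lin[OF \<Phi> bounded_borel_const[of 1] bounded_borel_indicator[OF that(1)], of 1 "-1"]
        that(2) one by simp
  qed
  fix B :: "real set" assume "B \<in> sets borel"
  have sets_eq: "sets (borel :: real measure) = sigma_sets UNIV (range (\<lambda>a. {..a}))"
    by (subst borel_eq_atMost, rule sets_measure_of) simp
  with \<open>B \<in> sets borel\<close> have "B \<in> sigma_sets UNIV (range (\<lambda>a. {..a}))" by simp
  have "Int_stable (range (\<lambda>a::real. {..a}))" by (auto simp: Int_stable_def)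
  moreover have "range (\<lambda>a::real. {..a}) \<subseteq> Pow UNIV" by simp
  ultimately show "\<Phi> (indicator B) = 0"
    using \<open>B \<in> sigma_sets UNIV _\<close>
  proof (induction B rule: sigma_sets_induct_disjoint)
    fix A assume "A \<in> range (\<lambda>a::real. {..a})" then show "\<Phi> (indicator A) = 0" using atMost by auto
  next
    have "(indicator {} :: real \<Rightarrow> real) = (\<lambda>t. 0)" by auto
    then show "\<Phi> (indicator {}) = 0" using borel_functional_zero[OF \<Phi>] by simp
  next
    fix A assume "A \<in> sigma_sets UNIV (range (\<lambda>a::real. {..a}))" "\<Phi> (indicator A) = 0"
    then show "\<Phi> (indicator (UNIV - A)) = 0"
      by (intro compl) (simp_all add: sets_eq)
  next
    fix A :: "nat \<Rightarrow> real set"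
    assume A: "disjoint_family A" "range A \<subseteq> sigma_sets UNIV (range (\<lambda>a::real. {..a}))"
      "\<And>i. \<Phi> (indicator (A i)) = 0"
    then have "(\<lambda>n. \<Phi> (indicator (A n))) sums \<Phi> (indicator (\<Union>n. A n))"
      by (intro borel_functional_sums[OF \<Phi>]) (simp_all add: sets_eq)
    then show "\<Phi> (indicator (\<Union>i. A i)) = 0"
      using A(3) by (simp add: sums_iff)
  qed
qed

lemma borel_functional_eq_indicators:
  assumes "borel_functional r \<Phi>" "borel_functional r \<Psi>"
    and "\<And>B. B \<in> sets borel \<Longrightarrow> \<Phi> (indicator B) = \<Psi> (indicator B)" "h \<in> bounded_borel"
  shows "\<Phi> h = \<Psi> h"
  using borel_functional_eq_0_indicators[OF borel_functional_lincomb[OF assms(1,2), of 1 "-1"] _ assms(4)]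
    assms(3) by simp

lemma borel_functional_eq_moments:
  assumes "borel_functional r \<Phi>" "borel_functional r \<Psi>" "0 \<le> r"
    and "\<And>n. \<Phi> (\<lambda>t. clamp_to r t ^ n) = \<Psi> (\<lambda>t. clamp_to r t ^ n)" "h \<in> bounded_borel"
  shows "\<Phi> h = \<Psi> h"
  using borel_functional_eq_0_moments[OF borel_functional_lincomb[OF assms(1,2), of 1 "-1"] assms(3) _ assms(5)]
    assms(4) by simp


text \<open>The moment of order 0 is the total mass, so the comparison covers finite measures of any
  mass.\<close>

lemma finite_measure_eqI_moments:
  fixes M N :: "real measure"
  assumes M: "finite_measure M" "sets M = sets borel" "AE t in M. \<bar>t\<bar> \<le> r"
    and N: "finite_measure N" "sets N = sets borel" "AE t in N. \<bar>t\<bar> \<le> r"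
    and r: "0 \<le> r" and mom: "\<And>n. (LINT t|M. t ^ n) = (LINT t|N. t ^ n)"
  shows "M = N"
proof (rule measure_eqI)
  show "sets M = sets N" using M(2) N(2) by simp
  fix A assume "A \<in> sets M"
  then have A: "A \<in> sets borel" using M(2) by simp
  have clamp: "(LINT t|K. clamp_to r t ^ n) = (LINT t|K. t ^ n)"
    if K: "sets K = sets borel" "AE t in K. \<bar>t\<bar> \<le> r" for K n
  proof (rule integral_cong_AE)
    note [measurable_cong] = K(1)
    show "(\<lambda>t. clamp_to r t ^ n) \<in> borel_measurable K" "(\<lambda>t. t ^ n) \<in> borel_measurable K"
      by measurable
    show "AE t in K. clamp_to r t ^ n = t ^ n"
      using K(2) by eventually_elim (simp add: clamp_to_id)
  qed
  have "complex_of_real (integral\<^sup>L M (indicator A)) = complex_of_real (integral\<^sup>L N (indicator A))"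
  proof (rule borel_functional_eq_moments[OF borel_functional_integral[OF M]
        borel_functional_integral[OF N] r _ bounded_borel_indicator[OF A]])
    show "complex_of_real (LINT t|M. clamp_to r t ^ n) = complex_of_real (LINT t|N. clamp_to r t ^ n)" for n
      using mom clamp[OF M(2,3)] clamp[OF N(2,3)] by simp
  qed
  moreover have "integral\<^sup>L M (indicator A) = measure M A" "integral\<^sup>L N (indicator A) = measure N A"
    using A M(2) N(2) by (simp_all add: sets_eq_imp_space_eq[OF M(2)] sets_eq_imp_space_eq[OF N(2)])
  ultimately show "emeasure M A = emeasure N A"
    using M(1) N(1) by (simp add: finite_measure.emeasure_eq_measure)
qed

section \<open>The method of moments on a compact interval\<close>

lemma real_distribution_moment_clamp:
  assumes "real_distribution M" "AE t in M. \<bar>t\<bar> \<le> (r::real)"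
  shows "(LINT t|M. clamp_to r t ^ n) = (LINT t|M. t ^ n)"
proof -
  interpret real_distribution M by fact
  show ?thesis
  proof (intro integral_cong_AE)
    show "AE t in M. clamp_to r t ^ n = t ^ n"
      using assms(2) by eventually_elim (simp add: clamp_to_id)
  qed measurable
qed

text \<open>Weak convergence controls integrals of bounded continuous functions. The distance to
  \<open>[a, b]\<close>, cut off at 1, is such a function and vanishes exactly on the
  interval.\<close>

lemma weak_conv_support_interval:
  assumes \<mu>: "\<And>n. real_distribution (\<mu> n)" "\<And>n. AE t in \<mu> n. t \<in> {a..b}"
    and M: "real_distribution M" and conv: "weak_conv_m \<mu> M"
  shows "AE t in M. t \<in> {a..b}"
proof -
  interpret \<mu>: real_distribution "\<mu> n" for n by fact
  interpret M: real_distribution M by fact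
  define h where "h t = min 1 (max 0 (max (a - t) (t - b)))" for t :: real
  have cts: "isCont h t" for t unfolding h_def by (intro continuous_intros)
  have [measurable]: "h \<in> borel_measurable borel" unfolding h_def by measurable
  have bd: "norm (h t) \<le> 1" for t by (auto simp: h_def)
  have "(\<lambda>n. integral\<^sup>L (\<mu> n) h) \<longlonglongrightarrow> integral\<^sup>L M h"
    by (rule weak_conv_imp_integral_bdd_continuous_conv[OF \<mu>(1) M conv cts bd])
  moreover have "integral\<^sup>L (\<mu> n) h = 0" for n
  proof (rule integral_eq_zero_AE)
    show "AE t in \<mu> n. h t = 0"
      using \<mu>(2)[of n] by eventually_elim (auto simp: h_def)
  qed
  ultimately have "integral\<^sup>L M h = 0" by (simp add: LIMSEQ_const_iff)
  moreover have "integrable M h"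
    by (rule M.integrable_const_bound[where B = 1]) (use bd in auto)
  ultimately have "AE t in M. h t = 0"
    by (subst (asm) integral_nonneg_eq_0_iff_AE) (auto simp: h_def)
  then show ?thesis by eventually_elim (auto simp: h_def min_def max_def split: if_splits)
qed

lemma weak_conv_compact_support:
  assumes \<mu>: "\<And>n. real_distribution (\<mu> n)" "\<And>n. AE t in \<mu> n. \<bar>t\<bar> \<le> r"
    and M: "real_distribution M" and conv: "weak_conv_m \<mu> M"
  shows "AE t in M. \<bar>t\<bar> \<le> r"
proof -
  have "\<bar>t\<bar> \<le> r \<longleftrightarrow> t \<in> {- r..r}" for t by auto
  then show ?thesis
    using weak_conv_support_interval[OF \<mu>(1) _ M conv, of "- r" r] \<mu>(2) by simp
qed

text \<open>On the supports \<open>t ^ m\<close> agrees with its clamped version, which is bounded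
  and continuous.\<close>

lemma weak_conv_moments:
  assumes r: "0 \<le> r" and \<mu>: "\<And>n. real_distribution (\<mu> n)" "\<And>n. AE t in \<mu> n. \<bar>t\<bar> \<le> r"
    and M: "real_distribution M" and conv: "weak_conv_m \<mu> M"
  shows "(\<lambda>n. LINT t|\<mu> n. t ^ m) \<longlonglongrightarrow> (LINT t|M. t ^ m)"
proof -
  have "(\<lambda>n. LINT t|\<mu> n. clamp_to r t ^ m) \<longlonglongrightarrow> (LINT t|M. clamp_to r t ^ m)"
  proof (rule weak_conv_imp_integral_bdd_continuous_conv[OF \<mu>(1) M conv])
    have "continuous_on UNIV (\<lambda>t. clamp_to r t ^ m)"
      by (intro continuous_intros continuous_clamp_to)
    then show "isCont (\<lambda>t. clamp_to r t ^ m) x" for x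
      by (simp add: continuous_on_eq_continuous_at)
    show "norm (clamp_to r x ^ m) \<le> r ^ m" for x
      using abs_clamp_to[OF r, of x] by (simp add: power_abs power_mono)
  qed
  then show ?thesis
    using real_distribution_moment_clamp[OF \<mu>] 
      real_distribution_moment_clamp[OF M weak_conv_compact_support[OF \<mu> M conv]] by simp
qed

lemma tight_compact_support:
  assumes r: "0 \<le> r" and \<mu>: "\<And>n. real_distribution (\<mu> n)" "\<And>n. AE t in \<mu> n. \<bar>t\<bar> \<le> r"
  shows "tight \<mu>"
  unfolding tight_def
proof (intro conjI allI impI)
  show "real_distribution (\<mu> n)" for n by (rule \<mu>(1))
  fix \<epsilon> :: real assume "0 < \<epsilon>"
  \<comment> \<open>The interval in \<open>tight\<close> is open on the left, hence the extra unit: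
    an atom may sit at \<open>- r\<close>.\<close>
  have "measure (\<mu> n) {- r - 1<..r} = 1" for n
  proof -
    interpret real_distribution "\<mu> n" by (rule \<mu>(1))
    have "AE t in \<mu> n. t \<in> {- r - 1<..r}"
      using \<mu>(2)[of n] by eventually_elim auto
    then show ?thesis by (subst prob_eq_1) auto
  qed
  then show "\<exists>a b. a < b \<and> (\<forall>n. 1 - \<epsilon> < measure (\<mu> n) {a<..b})"
    using r \<open>0 < \<epsilon>\<close> by (intro exI[of _ "- r - 1"] exI[of _ r]) auto
qed

text \<open>Tightness yields weakly convergent subsequences, and every weak limit of one has the
  moments \<open>c\<close> and lives on \<open>[-r, r]\<close>. These data determine the limit, so
  all subsequences share it and the whole sequence converges.\<close>

lemma method_of_moments:
  assumes r: "0 \<le> r" and \<mu>: "\<And>n. real_distribution (\<mu> n)" "\<And>n. AE t in \<mu> n. \<bar>t\<bar> \<le> r"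
    and mom: "\<And>m. (\<lambda>n. LINT t|\<mu> n. t ^ m) \<longlonglongrightarrow> c m"
  obtains M where "real_distribution M" "AE t in M. \<bar>t\<bar> \<le> r" "\<And>m. (LINT t|M. t ^ m) = c m"
    "weak_conv_m \<mu> M"
proof -
  note tight = tight_compact_support[OF r \<mu>]
  have sub: "(AE t in N. \<bar>t\<bar> \<le> r) \<and> (\<forall>m. (LINT t|N. t ^ m) = c m)"
    if s: "strict_mono s" and N: "real_distribution N" "weak_conv_m (\<mu> \<circ> s) N" for s N
  proof (intro conjI allI)
    have \<mu>s: "\<And>n. real_distribution ((\<mu> \<circ> s) n)" "\<And>n. AE t in (\<mu> \<circ> s) n. \<bar>t\<bar> \<le> r"
      unfolding o_def by (rule \<mu>)+
    show "AE t in N. \<bar>t\<bar> \<le> r" by (rule weak_conv_compact_support[OF \<mu>s N])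
    fix m
    have "(\<lambda>n. LINT t|(\<mu> \<circ> s) n. t ^ m) \<longlonglongrightarrow> (LINT t|N. t ^ m)"
      by (rule weak_conv_moments[OF r \<mu>s N])
    moreover have "(\<lambda>n. LINT t|(\<mu> \<circ> s) n. t ^ m) \<longlonglongrightarrow> c m"
      using LIMSEQ_subseq_LIMSEQ[OF mom s, of m] by (simp add: o_def)
    ultimately show "(LINT t|N. t ^ m) = c m" by (rule LIMSEQ_unique)
  qed
  obtain s M where s: "strict_mono s" and M: "real_distribution M" "weak_conv_m (\<mu> \<circ> id \<circ> s) M"
    using tight_imp_convergent_subsubsequence[of \<mu> id, OF tight strict_mono_id]
    by (elim exE conjE) (rule that)
  then have M': "(AE t in M. \<bar>t\<bar> \<le> r) \<and> (\<forall>m. (LINT t|M. t ^ m) = c m)"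
    using sub[OF s M(1)] by simp
  have "weak_conv_m \<mu> M"
  proof (rule tight_subseq_weak_converge[OF \<mu>(1) M(1) tight])
    fix s \<nu> assume s: "strict_mono s" and \<nu>: "real_distribution \<nu>" "weak_conv_m (\<mu> \<circ> s) \<nu>"
    interpret \<nu>: real_distribution \<nu> by fact
    interpret M: real_distribution M by fact
    have "\<nu> = M"
      using sub[OF s \<nu>] M' r
      by (intro finite_measure_eqI_moments[where r = r]) (auto intro: \<nu>.finite_measure_axioms M.finite_measure_axioms)
    with \<nu> show "weak_conv_m (\<mu> \<circ> s) M" by simp
  qed
  with M(1) M' show ?thesis by (intro that) auto
qed

section \<open>The Hausdorff moment problem\<close>

text \<open>With \<open>c j k\<close> standing for the integral of
  \<open>s ^ j * (1 - s) ^ k\<close>, this is the integrated form of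
  \<open>1 = (s + (1 - s)) ^ N\<close>.\<close>

lemma hausdorff_expand:
  fixes c :: "nat \<Rightarrow> nat \<Rightarrow> real"
  assumes rec: "\<And>j k. c j k = c (Suc j) k + c j (Suc k)"
  shows "c j k = (\<Sum>i\<le>N. real (N choose i) * c (j + i) (k + (N - i)))"
proof (induction N arbitrary: j k)
  case 0 then show ?case by simp
next
  case (Suc N)
  have "c j k = c (Suc j) k + c j (Suc k)" by (rule rec)
  also have "\<dots> = (\<Sum>i\<le>N. real (N choose i) * c (Suc j + i) (k + (N - i)))
    + (\<Sum>i\<le>N. real (N choose i) * c (j + i) (Suc k + (N - i)))"
    using Suc.IH[of "Suc j" k] Suc.IH[of j "Suc k"] by simp
  also have "(\<Sum>i\<le>N. real (N choose i) * c (j + i) (Suc k + (N - i)))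
    = (\<Sum>i\<le>Suc N. real (N choose i) * c (j + i) (k + (Suc N - i)))"
    by (simp add: Suc_diff_le)
  also have "\<dots> = c j (k + Suc N) + (\<Sum>i\<le>N. real (N choose Suc i) * c (Suc j + i) (k + (N - i)))"
    by (subst sum.atMost_Suc_shift) simp
  also have "(\<Sum>i\<le>N. real (N choose i) * c (Suc j + i) (k + (N - i))) +
      (c j (k + Suc N) + (\<Sum>i\<le>N. real (N choose Suc i) * c (Suc j + i) (k + (N - i))))
    = c j (k + Suc N) + (\<Sum>i\<le>N. real (Suc N choose Suc i) * c (Suc j + i) (k + (N - i)))"
    by (simp add: sum.distrib[symmetric] algebra_simps)
  also have "\<dots> = (\<Sum>i\<le>Suc N. real (Suc N choose i) * c (j + i) (k + (Suc N - i)))"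
    by (subst sum.atMost_Suc_shift) simp
  finally show ?case .
qed

text \<open>Sampling the index \<open>j \<le> n\<close> with or without replacement gives nearly the same moments.\<close>

lemma falling_ratio_bound:
  assumes "j \<le> n" "2 * m \<le> n" "0 < n"
  shows "\<bar>(real j / real n) ^ m - (\<Prod>i<m. real (j - i) / real (n - i))\<bar> \<le> real m * (2 * real m / real n)"
proof -
  have "norm ((\<Prod>i<m. real j / real n) - (\<Prod>i<m. real (j - i) / real (n - i)))
      \<le> (\<Sum>i<m. norm (real j / real n - real (j - i) / real (n - i)))"
  proof (rule norm_prod_diff)
    fix i assume "i \<in> {..<m}"
    show "norm (real j / real n) \<le> 1" using assms by simp
    show "norm (real (j - i) / real (n - i)) \<le> 1"
      using assms diff_le_mono[of j n i] by (simp add: divide_le_eq del: of_nat_diff)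
  qed
  also have "\<dots> \<le> (\<Sum>i<m. 2 * real m / real n)"
  proof (rule sum_mono)
    fix i assume i: "i \<in> {..<m}"
    show "norm (real j / real n - real (j - i) / real (n - i)) \<le> 2 * real m / real n"
    proof (cases "i \<le> j")
      case True
      have r: "real (j - i) = real j - real i" "real (n - i) = real n - real i"
        "0 \<le> real j" "real j \<le> real n" "real i \<le> real m" "2 * real i \<le> real n" "0 < real n"
        using assms i True by auto
      have "real j / real n - real (j - i) / real (n - i)
          = (real i * (real n - real j)) / (real n - real i) / real n"
        using r unfolding r(1,2) by (simp add: field_simps)
      \<comment> \<open>From \<open>2 * m \<le> n\<close> and \<open>i < m\<close> the denominator
        \<open>n - i\<close> is at least \<open>n / 2\<close>; this is the source of the factor
        2.\<close>
      moreover have "real i * (real n - real j) \<le> 2 * real m * (real n - real i)"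
      proof -
        have "real i * (real n - real j) \<le> real m * real n"
          using r by (intro mult_mono) auto
        moreover have "real m * real n \<le> real m * (2 * (real n - real i))"
          using r by (intro mult_left_mono) auto
        ultimately show ?thesis by (simp add: algebra_simps)
      qed
      then have "real i * (real n - real j) / (real n - real i) / real n \<le> 2 * real m / real n"
        using r by (intro divide_right_mono) (simp_all add: pos_divide_le_eq)
      moreover have "0 \<le> real i * (real n - real j) / (real n - real i) / real n"
        using r by (intro divide_nonneg_nonneg mult_nonneg_nonneg) auto
      ultimately show ?thesis by (metis abs_of_nonneg real_norm_def)
    next
      \<comment> \<open>Here \<open>j < i\<close>: truncated subtraction makes the second ratio 0,
        and the first is below \<open>m / n\<close>.\<close>
      case False
      then show ?thesis using i assms by (simp add: divide_right_mono)
    qed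
  qed
  also have "\<dots> = real m * (2 * real m / real n)" by simp
  finally show ?thesis by simp
qed

text \<open>The product is the chance that \<open>m\<close> draws without replacement from
  \<open>n\<close> items, \<open>j\<close> of them marked, are all marked. Equivalently it is the
  chance that a random \<open>j\<close>-set contains a given \<open>m\<close>-set, which is the
  quotient of the two binomial coefficients.\<close>

lemma binomial_ratio_prod:
  assumes "m \<le> n" "m \<le> j" "j \<le> n"
  shows "real ((n - m) choose (j - m)) = real (n choose j) * (\<Prod>i<m. real (j - i) / real (n - i))"
  using assms
proof (induction m)
  case 0 then show ?case by simp
next
  case (Suc m)
  have "Suc (j - Suc m) = j - m" "Suc (n - Suc m) = n - m" using Suc.prems by auto
  then have "real (n - m) * real (n - Suc m choose (j - Suc m)) = real (n - m choose (j - m)) * real (j - m)"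
    using Suc_times_binomial_eq[of "n - Suc m" "j - Suc m"] by (metis of_nat_mult)
  then show ?case using Suc by (simp add: field_simps)
qed

text \<open>The weights \<open>p n j\<close> at the points \<open>j / n\<close> are the integrals
  that the Bernstein polynomials would have against the measure sought; they are nonnegative with
  sum 1. Their normalised factorial moments reproduce \<open>c m 0\<close> exactly, their power
  moments up to an error of order \<open>1 / n\<close>, and a weak limit is taken.\<close>

lemma hausdorff_moments:
  fixes c :: "nat \<Rightarrow> nat \<Rightarrow> real"
  assumes rec: "\<And>j k. c j k = c (Suc j) k + c j (Suc k)" and nonneg: "\<And>j k. 0 \<le> c j k"
    and one: "c 0 0 = 1"
  obtains M where "real_distribution M" "AE t in M. t \<in> {0..1}" "\<And>m. (LINT t|M. t ^ m) = c m 0"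
proof -
  define p where "p n j = real (n choose j) * c j (n - j)" for n j
  have sum_p: "(\<Sum>j\<le>n. p n j) = 1" for n
    using hausdorff_expand[of c, OF rec, of 0 0 n] one by (simp add: p_def)
  \<comment> \<open>Degree \<open>Suc n\<close> keeps the nodes from dividing by 0.\<close>
  define \<mu> where "\<mu> n = distr (point_measure {..Suc n} (\<lambda>j. ennreal (p (Suc n) j))) borel
    (\<lambda>j. real j / real (Suc n))" for n
  have p_nonneg: "0 \<le> p n j" for n j by (simp add: p_def nonneg)
  have \<mu>: "real_distribution (\<mu> n)" for n
  proof -
    have "emeasure (point_measure {..Suc n} (\<lambda>j. ennreal (p (Suc n) j))) {..Suc n} = 1"
      using sum_p[of "Suc n"] p_nonneg by (simp add: emeasure_point_measure_finite sum_ennreal del: sum.atMost_Suc)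
    then have "prob_space (point_measure {..Suc n} (\<lambda>j. ennreal (p (Suc n) j)))"
      by (intro prob_spaceI) (simp add: space_point_measure)
    then have "prob_space (\<mu> n)"
      unfolding \<mu>_def by (rule prob_space.prob_space_distr) (simp add: measurable_point_measure_eq1)
    then show ?thesis by (simp add: real_distribution_def real_distribution_axioms_def \<mu>_def)
  qed
  have supp: "AE t in \<mu> n. t \<in> {0..1}" for n
    unfolding \<mu>_def by (subst AE_distr_iff) (auto simp: measurable_point_measure_eq1 AE_point_measure)
  have int: "(LINT t|\<mu> n. t ^ m) = (\<Sum>j\<le>Suc n. p (Suc n) j * (real j / real (Suc n)) ^ m)" for n m
    unfolding \<mu>_def
    by (subst integral_distr)
       (auto simp: measurable_point_measure_eq1 lebesgue_integral_point_measure_finite p_nonneg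
          simp del: sum.atMost_Suc)
  have exact: "c m 0 = (\<Sum>j\<le>n. p n j * (\<Prod>i<m. real (j - i) / real (n - i)))" if "m \<le> n" for n m
  proof -
    \<comment> \<open>The expansion goes to total degree \<open>n\<close>: the indices
      \<open>m + i\<close> and \<open>n - m - i\<close> add up to \<open>n\<close>.\<close>
    have "c m 0 = (\<Sum>i\<le>n - m. real (n - m choose i) * c (m + i) (n - m - i))"
      using hausdorff_expand[of c, OF rec, of m 0 "n - m"] by simp
    also have "\<dots> = (\<Sum>j\<in>{m..n}. real (n - m choose (j - m)) * c j (n - j))"
      by (rule sum.reindex_bij_witness[of _ "\<lambda>j. j - m" "\<lambda>i. m + i"]) (use that in auto)
    also have "\<dots> = (\<Sum>j\<in>{m..n}. p n j * (\<Prod>i<m. real (j - i) / real (n - i)))"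
      by (rule sum.cong) (use that in \<open>auto simp: p_def binomial_ratio_prod\<close>)
    also have "\<dots> = (\<Sum>j\<le>n. p n j * (\<Prod>i<m. real (j - i) / real (n - i)))"
    proof (rule sum.mono_neutral_left)
      show "\<forall>j\<in>{..n} - {m..n}. p n j * (\<Prod>i<m. real (j - i) / real (n - i)) = 0"
      proof
        fix j assume "j \<in> {..n} - {m..n}"
        then have "j < m" by auto
        then have "(\<Prod>i<m. real (j - i) / real (n - i)) = 0" by (intro prod_zero bexI[of _ j]) auto
        then show "p n j * (\<Prod>i<m. real (j - i) / real (n - i)) = 0" by simp
      qed
    qed auto
    finally show ?thesis .
  qed
  have lim: "(\<lambda>n. LINT t|\<mu> n. t ^ m) \<longlonglongrightarrow> c m 0" for m
  proof (rule LIM_zero_cancel, rule tendsto_rabs_zero_cancel,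
        rule tendsto_sandwich[where f = "\<lambda>_. 0"])
    show "\<forall>\<^sub>F n in sequentially. \<bar>(LINT t|\<mu> n. t ^ m) - c m 0\<bar> \<le> real m * (2 * real m / real (Suc n))"
      using eventually_ge_at_top[of "2 * m"]
    proof eventually_elim
      case (elim n)
      let ?n = "Suc n"
      have eq: "(LINT t|\<mu> n. t ^ m) - c m 0 =
        (\<Sum>j\<le>?n. p ?n j * ((real j / real ?n) ^ m - (\<Prod>i<m. real (j - i) / real (?n - i))))"
        using elim exact[of m ?n] unfolding int by (simp add: right_diff_distrib sum_subtractf del: sum.atMost_Suc)
      have "\<bar>(LINT t|\<mu> n. t ^ m) - c m 0\<bar> \<le> (\<Sum>j\<le>?n. \<bar>p ?n j * ((real j / real ?n) ^ m - (\<Prod>i<m. real (j - i) / real (?n - i)))\<bar>)"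
        unfolding eq by (rule sum_abs)
      also have "\<dots> \<le> (\<Sum>j\<le>?n. p ?n j * (real m * (2 * real m / real ?n)))"
        unfolding abs_mult abs_of_nonneg[OF p_nonneg]
        by (intro sum_mono mult_left_mono falling_ratio_bound p_nonneg) (use elim in auto)
      also have "\<dots> = real m * (2 * real m / real ?n)"
        unfolding sum_distrib_right[symmetric] sum_p by simp
      finally show ?case .
    qed
    have "(\<lambda>n. real m * (2 * real m) * (1 / real (Suc n))) \<longlonglongrightarrow> real m * (2 * real m) * 0"
      by (intro tendsto_intros LIMSEQ_Suc[OF lim_1_over_n])
    then show "(\<lambda>n. real m * (2 * real m / real (Suc n))) \<longlonglongrightarrow> 0" by simp
  qed auto
  have supp': "AE t in \<mu> n. \<bar>t\<bar> \<le> 1" for n using supp[of n] by eventually_elim auto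
  obtain M where M: "real_distribution M" "\<And>m. (LINT t|M. t ^ m) = c m 0" "weak_conv_m \<mu> M"
    using method_of_moments[of 1 \<mu>, OF _ \<mu> supp' lim] by auto
  then show ?thesis
    using weak_conv_support_interval[OF \<mu> supp] by (intro that) auto
qed

section \<open>The Hilbert space of square-summable functions\<close>

lemma ell2_abs_summable_mult:
  assumes "f \<in> ell2 V" "g \<in> ell2 V"
  shows "(\<lambda>x. norm (f x * cnj (g x))) summable_on V"
proof (rule summable_on_comparison_test)
  show "(\<lambda>x. (cmod (f x))\<^sup>2 + (cmod (g x))\<^sup>2) summable_on V"
    using assms by (intro summable_on_add) (auto simp: ell2_def)
  show "norm (f x * cnj (g x)) \<le> (cmod (f x))\<^sup>2 + (cmod (g x))\<^sup>2" for x
    using sum_squares_bound[of "cmod (f x)" "cmod (g x)"]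
      mult_nonneg_nonneg[OF norm_ge_zero norm_ge_zero, of "f x" "g x"]
    unfolding norm_mult complex_mod_cnj by linarith
qed auto

lemma ell2_summable_mult:
  assumes "f \<in> ell2 V" "g \<in> ell2 V"
  shows "(\<lambda>x. f x * cnj (g x)) summable_on V"
  by (rule abs_summable_summable[OF ell2_abs_summable_mult[OF assms]])

lemma ell2_lincomb:
  assumes "f \<in> ell2 V" "g \<in> ell2 V"
  shows "(\<lambda>x. a * f x + b * g x) \<in> ell2 V"
proof -
  have "(\<lambda>x. (cmod (a * f x + b * g x))\<^sup>2) summable_on V"
  proof (rule summable_on_comparison_test)
    show "(\<lambda>x. 2 * (cmod a)\<^sup>2 * (cmod (f x))\<^sup>2 + 2 * (cmod b)\<^sup>2 * (cmod (g x))\<^sup>2) summable_on V"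
      using assms by (intro summable_on_add summable_on_cmult_right) (auto simp: ell2_def)
    fix x
    have "(cmod (a * f x + b * g x))\<^sup>2 \<le> (cmod (a * f x) + cmod (b * g x))\<^sup>2"
      by (intro power_mono norm_triangle_ineq) auto
    also have "\<dots> \<le> 2 * (cmod (a * f x))\<^sup>2 + 2 * (cmod (b * g x))\<^sup>2"
      using sum_squares_bound[of "cmod (a * f x)" "cmod (b * g x)"] by (simp add: power2_sum)
    finally show "(cmod (a * f x + b * g x))\<^sup>2 \<le>
        2 * (cmod a)\<^sup>2 * (cmod (f x))\<^sup>2 + 2 * (cmod b)\<^sup>2 * (cmod (g x))\<^sup>2"
      by (simp add: norm_mult power_mult_distrib)
  qed auto
  then show ?thesis using assms by (auto simp: ell2_def)
qed

lemma ell2_zero: "(\<lambda>x. 0) \<in> ell2 V"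
  by (simp add: ell2_def)

lemma ell2_scale: "f \<in> ell2 V \<Longrightarrow> (\<lambda>x. a * f x) \<in> ell2 V"
  using ell2_lincomb[of f V f a 0] by simp

lemma ell2_inner_lincomb_left:
  assumes "f \<in> ell2 V" "g \<in> ell2 V" "h \<in> ell2 V"
  shows "ell2_inner V (\<lambda>x. a * f x + b * g x) h = a * ell2_inner V f h + b * ell2_inner V g h"
proof -
  have "ell2_inner V (\<lambda>x. a * f x + b * g x) h
      = (\<Sum>\<^sub>\<infinity>x\<in>V. a * (f x * cnj (h x)) + b * (g x * cnj (h x)))"
    unfolding ell2_inner_def by (intro infsum_cong) (simp add: algebra_simps)
  also have "\<dots> = (\<Sum>\<^sub>\<infinity>x\<in>V. a * (f x * cnj (h x))) + (\<Sum>\<^sub>\<infinity>x\<in>V. b * (g x * cnj (h x)))"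
    by (intro infsum_add summable_on_cmult_right ell2_summable_mult assms)
  finally show ?thesis
    using assms by (simp add: ell2_inner_def infsum_cmult_right ell2_summable_mult)
qed

lemma ell2_inner_commute: "ell2_inner V g f = cnj (ell2_inner V f g)"
  unfolding ell2_inner_def by (subst infsum_cnj[symmetric]) (simp add: mult.commute)

lemma ell2_inner_lincomb_right:
  assumes "f \<in> ell2 V" "g \<in> ell2 V" "h \<in> ell2 V"
  shows "ell2_inner V h (\<lambda>x. a * f x + b * g x) = cnj a * ell2_inner V h f + cnj b * ell2_inner V h g"
  using ell2_inner_lincomb_left[OF assms, of a b]
  by (subst (1 2 3) ell2_inner_commute) (simp add: ell2_inner_commute[of V _ h])

lemma ell2_inner_scale_left:
  "f \<in> ell2 V \<Longrightarrow> h \<in> ell2 V \<Longrightarrow> ell2_inner V (\<lambda>x. a * f x) h = a * ell2_inner V f h"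
  using ell2_inner_lincomb_left[of f V f h a 0] by simp

lemma ell2_inner_scale_right:
  "f \<in> ell2 V \<Longrightarrow> h \<in> ell2 V \<Longrightarrow> ell2_inner V h (\<lambda>x. a * f x) = cnj a * ell2_inner V h f"
  using ell2_inner_lincomb_right[of f V f h a 0] by simp

text \<open>Working with the square of the norm keeps every estimate quadratic, so that expanding
  inner products suffices.\<close>

definition ell2_norm2 :: "'v set \<Rightarrow> ('v \<Rightarrow> complex) \<Rightarrow> real" where
  "ell2_norm2 V f = (\<Sum>\<^sub>\<infinity>x\<in>V. (cmod (f x))\<^sup>2)"

text \<open>The equation holds for every function: where the squares are not summable, both infinite
  sums take the default value 0.\<close>

lemma ell2_inner_self: "ell2_inner V f f = of_real (ell2_norm2 V f)"
proof (cases "(\<lambda>x. (cmod (f x))\<^sup>2) summable_on V")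
  case True
  then show ?thesis
    unfolding ell2_inner_def ell2_norm2_def complex_norm_square[symmetric]
    by (intro infsumI has_sum_of_real has_sum_infsum)
next
  case False
  then have "\<not> (\<lambda>x. complex_of_real ((cmod (f x))\<^sup>2)) summable_on V"
    using summable_on_Re[of "\<lambda>x. complex_of_real ((cmod (f x))\<^sup>2)" V] by auto
  with False show ?thesis
    unfolding ell2_inner_def ell2_norm2_def complex_norm_square[symmetric]
    by (simp add: infsum_not_exists)
qed

lemma ell2_norm2_nonneg: "0 \<le> ell2_norm2 V f"
  unfolding ell2_norm2_def by (rule infsum_nonneg) simp

lemma ell2_norm2_eq_0:
  assumes "f \<in> ell2 V" "ell2_norm2 V f = 0"
  shows "f = (\<lambda>x. 0)"
proof
  fix x
  show "f x = 0"
  proof (cases "x \<in> V")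
    case True
    have "(cmod (f x))\<^sup>2 = 0"
      using assms True nonneg_infsum_le_0D[of "\<lambda>x. (cmod (f x))\<^sup>2" V x]
      by (auto simp: ell2_def ell2_norm2_def)
    then show ?thesis by simp
  qed (use assms in \<open>auto simp: ell2_def\<close>)
qed

lemma ell2_norm2_scale: "f \<in> ell2 V \<Longrightarrow> ell2_norm2 V (\<lambda>x. a * f x) = (cmod a)\<^sup>2 * ell2_norm2 V f"
  unfolding ell2_norm2_def norm_mult power_mult_distrib
  by (rule infsum_cmult_right) (auto simp: ell2_def)

lemma ell2_norm2_lincomb:
  assumes "f \<in> ell2 V" "g \<in> ell2 V"
  shows "ell2_norm2 V (\<lambda>x. a * f x + b * g x) = (cmod a)\<^sup>2 * ell2_norm2 V f + (cmod b)\<^sup>2 * ell2_norm2 V g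
    + 2 * Re (a * cnj b * ell2_inner V f g)"
proof -
  have "complex_of_real (ell2_norm2 V (\<lambda>x. a * f x + b * g x))
    = a * cnj a * of_real (ell2_norm2 V f) + b * cnj b * of_real (ell2_norm2 V g)
      + (a * cnj b * ell2_inner V f g + cnj (a * cnj b * ell2_inner V f g))"
    using assms unfolding ell2_inner_self[symmetric]
    by (simp add: ell2_inner_lincomb_left ell2_inner_lincomb_right ell2_lincomb
        ell2_inner_commute[of V g f] algebra_simps)
  also have "\<dots> = of_real ((cmod a)\<^sup>2 * ell2_norm2 V f + (cmod b)\<^sup>2 * ell2_norm2 V g
      + 2 * Re (a * cnj b * ell2_inner V f g))"
    unfolding complex_add_cnj complex_norm_square[symmetric] by simp
  finally show ?thesis by (simp only: of_real_eq_iff)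
qed

lemma ell2_dirac:
  assumes "x \<in> V"
  shows "dirac_function x \<in> ell2 V"
proof -
  have "(\<lambda>y. (cmod (dirac_function x y))\<^sup>2) summable_on V"
    by (rule summable_on_cong_neutral[THEN iffD1, OF _ _ _ summable_on_finite[of "{x}"]])
       (use assms in \<open>auto simp: dirac_function_def\<close>)
  then show ?thesis using assms by (auto simp: ell2_def dirac_function_def)
qed

lemma ell2_inner_dirac:
  assumes "x \<in> V"
  shows "ell2_inner V f (dirac_function x) = f x"
proof -
  have "ell2_inner V f (dirac_function x) = (\<Sum>\<^sub>\<infinity>y\<in>{x}. f y * cnj (dirac_function x y))"
    unfolding ell2_inner_def
    by (rule infsum_cong_neutral) (use assms in \<open>auto simp: dirac_function_def\<close>)
  then show ?thesis by (simp add: dirac_function_def)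
qed

lemma ell2_eqI:
  assumes "f \<in> ell2 V" "g \<in> ell2 V" "\<And>k. k \<in> ell2 V \<Longrightarrow> ell2_inner V f k = ell2_inner V g k"
  shows "f = g"
proof
  fix x
  show "f x = g x"
  proof (cases "x \<in> V")
    case True
    then show ?thesis using assms(3)[OF ell2_dirac[OF True]] by (simp add: ell2_inner_dirac)
  qed (use assms in \<open>auto simp: ell2_def\<close>)
qed

section \<open>Finite truncations and the Riesz representation\<close>

definition restrict_fun :: "'v set \<Rightarrow> ('v \<Rightarrow> complex) \<Rightarrow> 'v \<Rightarrow> complex" where
  "restrict_fun F g = (\<lambda>x. if x \<in> F then g x else 0)"

lemma restrict_fun_insert:
  "x \<notin> F \<Longrightarrow> restrict_fun (insert x F) g = (\<lambda>y. g x * dirac_function x y + 1 * restrict_fun F g y)"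
  by (auto simp: restrict_fun_def dirac_function_def)

lemma ell2_restrict_fun:
  assumes "finite F" "F \<subseteq> V"
  shows "restrict_fun F g \<in> ell2 V"
  using assms
proof (induction F rule: finite_induct)
  case empty then show ?case by (simp add: restrict_fun_def ell2_zero)
next
  case (insert x F)
  then show ?case
    unfolding restrict_fun_insert[OF insert.hyps(2)] by (intro ell2_lincomb ell2_dirac) auto
qed

lemma conj_linear_restrict_fun:
  assumes lin: "\<And>f g a b. f \<in> ell2 V \<Longrightarrow> g \<in> ell2 V \<Longrightarrow>
      L (\<lambda>x. a * f x + b * g x) = cnj a * L f + cnj b * L g"
    and "finite F" "F \<subseteq> V"
  shows "L (restrict_fun F g) = (\<Sum>x\<in>F. L (dirac_function x) * cnj (g x))"
  using assms(2,3)
proof (induction F rule: finite_induct)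
  case empty
  then show ?case using lin[OF ell2_zero ell2_zero, of 0 0] by (simp add: restrict_fun_def)
next
  case (insert x F)
  have "L (restrict_fun (insert x F) g) = cnj (g x) * L (dirac_function x) + cnj 1 * L (restrict_fun F g)"
    unfolding restrict_fun_insert[OF insert.hyps(2)]
    using insert by (intro lin ell2_dirac ell2_restrict_fun) auto
  then show ?case using insert by simp
qed

lemma ell2_norm2_restrict_fun:
  assumes "finite F" "F \<subseteq> V"
  shows "ell2_norm2 V (restrict_fun F g) = (\<Sum>x\<in>F. (cmod (g x))\<^sup>2)"
proof -
  have "ell2_norm2 V (restrict_fun F g) = (\<Sum>\<^sub>\<infinity>x\<in>F. (cmod (g x))\<^sup>2)"
    unfolding ell2_norm2_def
    by (rule infsum_cong_neutral) (use assms in \<open>auto simp: restrict_fun_def\<close>)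
  then show ?thesis using assms by simp
qed

text \<open>The remainder is orthogonal to the truncation, so its squared norm is the full sum minus
  the partial sum over \<open>F\<close>.\<close>

lemma ell2_restrict_fun_tendsto:
  assumes g: "g \<in> ell2 V"
  shows "((\<lambda>F. ell2_norm2 V (\<lambda>x. g x - restrict_fun F g x)) \<longlongrightarrow> 0) (finite_subsets_at_top V)"
proof -
  have eq: "ell2_norm2 V (\<lambda>x. g x - restrict_fun F g x) = ell2_norm2 V g - (\<Sum>x\<in>F. (cmod (g x))\<^sup>2)"
    if F: "finite F" "F \<subseteq> V" for F
  proof -
    have "ell2_inner V g (restrict_fun F g) = (\<Sum>x\<in>F. ell2_inner V g (dirac_function x) * cnj (g x))"
      using F by (intro conj_linear_restrict_fun ell2_inner_lincomb_right g)
    also have "\<dots> = (\<Sum>x\<in>F. complex_of_real ((cmod (g x))\<^sup>2))"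
      using F by (intro sum.cong refl) (auto simp: ell2_inner_dirac complex_norm_square[symmetric] subsetD simp del: of_real_power)
    finally have "ell2_inner V g (restrict_fun F g) = complex_of_real (\<Sum>x\<in>F. (cmod (g x))\<^sup>2)"
      by simp
    then show ?thesis
      using ell2_norm2_lincomb[OF g ell2_restrict_fun[OF F], of 1 "-1" g] ell2_norm2_restrict_fun[OF F, of g]
      by simp
  qed
  have "((\<lambda>F. \<Sum>x\<in>F. (cmod (g x))\<^sup>2) \<longlongrightarrow> ell2_norm2 V g) (finite_subsets_at_top V)"
    unfolding ell2_norm2_def using g by (intro infsum_tendsto) (auto simp: ell2_def)
  then have "((\<lambda>F. ell2_norm2 V g - (\<Sum>x\<in>F. (cmod (g x))\<^sup>2)) \<longlongrightarrow> ell2_norm2 V g - ell2_norm2 V g)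
      (finite_subsets_at_top V)"
    by (intro tendsto_intros)
  moreover have "\<forall>\<^sub>F F in finite_subsets_at_top V.
      ell2_norm2 V g - (\<Sum>x\<in>F. (cmod (g x))\<^sup>2) = ell2_norm2 V (\<lambda>x. g x - restrict_fun F g x)"
    by (rule eventually_finite_subsets_at_top_weakI) (simp add: eq)
  ultimately show ?thesis using Lim_transform_eventually by fastforce
qed

text \<open>Riesz representation, with the bound in the additive form in which
  \<open>spectral_form_bound\<close> delivers it. Replacing \<open>g\<close> by \<open>s * g\<close>
  and dividing by \<open>s\<close> gives \<open>K / s + s * ||g||^2\<close>, and the free parameter
  \<open>s\<close> does the work of a norm estimate. Evaluation at Dirac functions forces the
  coordinates of the representing vector.\<close>

lemma ell2_riesz:
  assumes lin: "\<And>f g a b. f \<in> ell2 V \<Longrightarrow> g \<in> ell2 V \<Longrightarrow>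
      L (\<lambda>x. a * f x + b * g x) = cnj a * L f + cnj b * L g"
    and bound: "\<And>g. g \<in> ell2 V \<Longrightarrow> cmod (L g) \<le> K + ell2_norm2 V g"
    and g: "g \<in> ell2 V"
  defines "u \<equiv> \<lambda>x. if x \<in> V then L (dirac_function x) else 0"
  shows "u \<in> ell2 V" "L g = ell2_inner V u g"
proof -
  have scaled: "cmod (L f) \<le> K / s + s * ell2_norm2 V f" if s: "s > 0" and f: "f \<in> ell2 V" for s :: real and f
  proof -
    have "L (\<lambda>x. of_real s * f x) = of_real s * L f"
      using lin[OF f f, of "of_real s" 0] by simp
    then have "s * cmod (L f) \<le> K + s\<^sup>2 * ell2_norm2 V f"
      using bound[OF ell2_scale[OF f, of "of_real s"]] s by (simp add: norm_mult ell2_norm2_scale[OF f])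
    then show ?thesis using s by (simp add: field_simps power2_eq_square)
  qed
  \<comment> \<open>With \<open>s = 1/2\<close> the scaled bound at the truncation of
    \<open>u\<close> reads \<open>N \<le> 2 * K + N / 2\<close>, which gives the constant 4.\<close>
  have partial: "(\<Sum>x\<in>F. (cmod (u x))\<^sup>2) \<le> 4 * K" if F: "finite F" "F \<subseteq> V" for F
  proof -
    let ?N = "\<Sum>x\<in>F. (cmod (u x))\<^sup>2"
    have "L (restrict_fun F u) = (\<Sum>x\<in>F. L (dirac_function x) * cnj (u x))"
      by (rule conj_linear_restrict_fun[OF lin F])
    also have "\<dots> = (\<Sum>x\<in>F. complex_of_real ((cmod (u x))\<^sup>2))"
      using F by (intro sum.cong refl) (auto simp: u_def complex_norm_square[symmetric] simp del: of_real_power)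
    also have "\<dots> = of_real ?N" by simp
    finally have "?N \<le> cmod (L (restrict_fun F u))"
      by (simp only: norm_of_real abs_ge_self)
    also have "\<dots> \<le> K / (1/2) + 1/2 * ell2_norm2 V (restrict_fun F u)"
      by (rule scaled[OF _ ell2_restrict_fun[OF F]]) simp
    also have "ell2_norm2 V (restrict_fun F u) = ?N" by (rule ell2_norm2_restrict_fun[OF F])
    finally show ?thesis by simp
  qed
  have "(\<lambda>x. (cmod (u x))\<^sup>2) summable_on V"
    by (rule nonneg_bdd_above_summable_on) (use partial in \<open>auto intro!: bdd_aboveI[where M = "4 * K"]\<close>)
  then show u: "u \<in> ell2 V" by (auto simp: ell2_def u_def)
  have "((\<lambda>F. L g - (\<Sum>x\<in>F. u x * cnj (g x))) \<longlongrightarrow> L g - ell2_inner V u g) (finite_subsets_at_top V)"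
    unfolding ell2_inner_def by (intro tendsto_intros infsum_tendsto ell2_summable_mult u g)
  then have lim1: "((\<lambda>F. cmod (L g - (\<Sum>x\<in>F. u x * cnj (g x)))) \<longlongrightarrow> cmod (L g - ell2_inner V u g))
      (finite_subsets_at_top V)"
    by (rule tendsto_norm)
  \<comment> \<open>For fixed \<open>s\<close> the truncations first exhaust \<open>V\<close>, which
    removes the term with the factor \<open>s\<close>; only then does \<open>s\<close> tend to
    infinity.\<close>
  have le: "cmod (L g - ell2_inner V u g) \<le> K / s" if s: "s > 0" for s
  proof -
    have "((\<lambda>F. K / s + s * ell2_norm2 V (\<lambda>x. g x - restrict_fun F g x)) \<longlongrightarrow> K / s + s * 0)
        (finite_subsets_at_top V)"
      by (intro tendsto_intros ell2_restrict_fun_tendsto g)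
    moreover have "\<forall>\<^sub>F F in finite_subsets_at_top V. cmod (L g - (\<Sum>x\<in>F. u x * cnj (g x)))
        \<le> K / s + s * ell2_norm2 V (\<lambda>x. g x - restrict_fun F g x)"
    proof (rule eventually_finite_subsets_at_top_weakI)
      fix F assume F: "finite F" "F \<subseteq> V"
      have "(\<Sum>x\<in>F. u x * cnj (g x)) = (\<Sum>x\<in>F. L (dirac_function x) * cnj (g x))"
        using F by (intro sum.cong) (auto simp: u_def)
      also have "\<dots> = L (restrict_fun F g)"
        by (rule conj_linear_restrict_fun[OF lin F, symmetric])
      finally have "(\<Sum>x\<in>F. u x * cnj (g x)) = L (restrict_fun F g)" .
      then have "L g - (\<Sum>x\<in>F. u x * cnj (g x)) = L (\<lambda>x. g x - restrict_fun F g x)"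
        using lin[OF g ell2_restrict_fun[OF F], of 1 "-1" g] by simp
      moreover have "(\<lambda>x. g x - restrict_fun F g x) \<in> ell2 V"
        using ell2_lincomb[OF g ell2_restrict_fun[OF F], of 1 "-1" g] by simp
      ultimately show "cmod (L g - (\<Sum>x\<in>F. u x * cnj (g x)))
        \<le> K / s + s * ell2_norm2 V (\<lambda>x. g x - restrict_fun F g x)"
        using scaled[OF s] by simp
    qed
    ultimately have "cmod (L g - ell2_inner V u g) \<le> K / s + s * 0"
      by (intro tendsto_le[OF finite_subsets_at_top_neq_bot _ lim1])
    then show ?thesis by simp
  qed
  have "cmod (L g - ell2_inner V u g) \<le> 0"
  proof (rule tendsto_lowerbound)
    show "((\<lambda>s. K / s) \<longlongrightarrow> 0) at_top" 
      by (intro tendsto_divide_0[OF tendsto_const] filterlim_at_top_imp_at_infinity filterlim_ident)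
    show "\<forall>\<^sub>F s in at_top. cmod (L g - ell2_inner V u g) \<le> K / s"
      using eventually_gt_at_top[of 0] by eventually_elim (rule le)
  qed auto
  then show "L g = ell2_inner V u g" by simp
qed


section \<open>Spectral measures of self-adjoint contractions\<close>

definition ell2_linear :: "'v set \<Rightarrow> (('v \<Rightarrow> complex) \<Rightarrow> ('v \<Rightarrow> complex)) \<Rightarrow> bool" where
  "ell2_linear V A \<longleftrightarrow> (\<forall>f\<in>ell2 V. A f \<in> ell2 V) \<and>
     (\<forall>f\<in>ell2 V. \<forall>g\<in>ell2 V. \<forall>a b. A (\<lambda>x. a * f x + b * g x) = (\<lambda>x. a * A f x + b * A g x))"

lemma ell2_linear_maps: "ell2_linear V A \<Longrightarrow> f \<in> ell2 V \<Longrightarrow> A f \<in> ell2 V"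
  by (simp add: ell2_linear_def)

lemma ell2_linear_lincomb:
  "ell2_linear V A \<Longrightarrow> f \<in> ell2 V \<Longrightarrow> g \<in> ell2 V \<Longrightarrow>
    A (\<lambda>x. a * f x + b * g x) = (\<lambda>x. a * A f x + b * A g x)"
  by (simp add: ell2_linear_def)

lemma ell2_linear_funpow:
  assumes "ell2_linear V A" shows "ell2_linear V (A ^^ n)"
  by (induction n) (use assms in \<open>auto simp: ell2_linear_def\<close>)

lemma ell2_symmetric_funpow:
  assumes A: "ell2_linear V A"
    and sym: "\<And>f g. f \<in> ell2 V \<Longrightarrow> g \<in> ell2 V \<Longrightarrow> ell2_inner V (A f) g = ell2_inner V f (A g)"
    and "f \<in> ell2 V" "g \<in> ell2 V"
  shows "ell2_inner V ((A ^^ n) f) g = ell2_inner V f ((A ^^ n) g)"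
  using assms(3,4)
proof (induction n arbitrary: g)
  case (Suc n)
  have "ell2_inner V ((A ^^ Suc n) f) g = ell2_inner V ((A ^^ n) f) (A g)"
    using Suc.prems by (simp add: sym ell2_linear_maps[OF ell2_linear_funpow[OF A]])
  also have "\<dots> = ell2_inner V f ((A ^^ n) (A g))"
    by (intro Suc.IH Suc.prems ell2_linear_maps[OF A])
  finally show ?case by (simp add: funpow_swap1)
qed simp

section \<open>Polarization\<close>

definition perturb :: "('v \<Rightarrow> complex) \<Rightarrow> complex \<Rightarrow> ('v \<Rightarrow> complex) \<Rightarrow> 'v \<Rightarrow> complex" where
  "perturb f a g = (\<lambda>x. f x + a * g x)"

lemma perturb_eq: "perturb f a g = (\<lambda>x. 1 * f x + a * g x)"
  by (simp add: perturb_def)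

lemma ell2_perturb: "f \<in> ell2 V \<Longrightarrow> g \<in> ell2 V \<Longrightarrow> perturb f a g \<in> ell2 V"
  unfolding perturb_eq by (rule ell2_lincomb)

text \<open>The polarization sum of a form that is linear in \<open>f\<close> and conjugate-linear
  in \<open>g\<close>. It is stated for an arbitrary \<open>q\<close> because it is applied to
  integrals against measures attached to single vectors, whose quadratic dependence on the vector is
  not yet known.\<close>

definition polarize :: "(('v \<Rightarrow> complex) \<Rightarrow> complex) \<Rightarrow> ('v \<Rightarrow> complex) \<Rightarrow> ('v \<Rightarrow> complex) \<Rightarrow> complex" where
  "polarize q f g = (q (perturb f 1 g) - q (perturb f (-1) g)
     + \<i> * q (perturb f \<i> g) - \<i> * q (perturb f (-\<i>) g)) / 4"

lemma polarize_cong: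
  assumes "\<And>f. f \<in> ell2 V \<Longrightarrow> q f = q' f" "f \<in> ell2 V" "g \<in> ell2 V"
  shows "polarize q f g = polarize q' f g"
  unfolding polarize_def using assms by (simp add: ell2_perturb)

lemma polarize_inner:
  assumes A: "ell2_linear V A" and f: "f \<in> ell2 V" and g: "g \<in> ell2 V"
  shows "polarize (\<lambda>f. ell2_inner V (A f) f) f g = ell2_inner V (A f) g"
proof -
  have "ell2_inner V (A (perturb f a g)) (perturb f a g) =
      ell2_inner V (A f) f + cnj a * ell2_inner V (A f) g
      + a * (ell2_inner V (A g) f + cnj a * ell2_inner V (A g) g)" for a
    unfolding perturb_eq ell2_linear_lincomb[OF A f g]
    by (simp only: ell2_inner_lincomb_left ell2_inner_lincomb_right ell2_linear_maps[OF A] ell2_lincomb f g)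
      (simp add: algebra_simps)
  then show ?thesis by (simp add: polarize_def algebra_simps)
qed

lemma borel_functional_polarize:
  assumes "\<And>f. f \<in> ell2 V \<Longrightarrow> borel_functional r (J f)" "f \<in> ell2 V" "g \<in> ell2 V"
  shows "borel_functional r (\<lambda>h. polarize (\<lambda>f. J f h) f g)"
proof -
  have J: "borel_functional r (J (perturb f a g))" for a
    by (intro assms ell2_perturb)
  have "borel_functional r (\<lambda>h. 1 * (1 / 4 * J (perturb f 1 g) h + (- 1 / 4) * J (perturb f (-1) g) h)
      + 1 * (\<i> / 4 * J (perturb f \<i> g) h + (- \<i> / 4) * J (perturb f (-\<i>) g) h))"
    by (intro borel_functional_lincomb J)
  then show ?thesis by (simp add: polarize_def diff_divide_distrib add_divide_distrib algebra_simps)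
qed

locale ell2_contraction =
  fixes V :: "'v set" and T :: "('v \<Rightarrow> complex) \<Rightarrow> ('v \<Rightarrow> complex)"
  assumes linear: "ell2_linear V T"
    and symmetric: "f \<in> ell2 V \<Longrightarrow> g \<in> ell2 V \<Longrightarrow> ell2_inner V (T f) g = ell2_inner V f (T g)"
    and contraction: "f \<in> ell2 V \<Longrightarrow> ell2_norm2 V (T f) \<le> ell2_norm2 V f"
begin

lemma maps: "f \<in> ell2 V \<Longrightarrow> T f \<in> ell2 V"
  by (rule ell2_linear_maps[OF linear])

lemma pow_maps: "f \<in> ell2 V \<Longrightarrow> (T ^^ n) f \<in> ell2 V"
  by (rule ell2_linear_maps[OF ell2_linear_funpow[OF linear]])

lemma pow_inner_real:
  assumes "f \<in> ell2 V"
  shows "ell2_inner V ((T ^^ n) f) f = of_real (Re (ell2_inner V ((T ^^ n) f) f))"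
proof -
  have "ell2_inner V ((T ^^ n) f) f = cnj (ell2_inner V ((T ^^ n) f) f)"
    using ell2_symmetric_funpow[OF linear symmetric assms assms, of n]
      ell2_inner_commute[of V f "(T ^^ n) f"] by simp
  then show ?thesis by (metis Reals_cnj_iff of_real_Re)
qed

text \<open>In the functional calculus \<open>upper\<close> is multiplication by
  \<open>s = (1 + t) / 2\<close> and \<open>lower\<close> by \<open>1 - s\<close>; the change of
  variable moves \<open>[-1, 1]\<close> to the interval \<open>[0, 1]\<close> of the Hausdorff
  problem.\<close>

definition upper :: "('v \<Rightarrow> complex) \<Rightarrow> 'v \<Rightarrow> complex" where
  "upper f = (\<lambda>x. 1/2 * f x + 1/2 * T f x)"

definition lower :: "('v \<Rightarrow> complex) \<Rightarrow> 'v \<Rightarrow> complex" where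
  "lower f = (\<lambda>x. 1/2 * f x + (-1/2) * T f x)"

lemma affine_linear: "ell2_linear V (\<lambda>f x. a * f x + b * T f x)"
  unfolding ell2_linear_def
  by (auto intro!: ell2_lincomb maps simp: ell2_linear_lincomb[OF linear] algebra_simps)

lemma upper_linear: "ell2_linear V upper" and lower_linear: "ell2_linear V lower"
  using affine_linear[of "1/2" "1/2"] affine_linear[of "1/2" "-1/2"]
  by (simp_all only: upper_def[abs_def] lower_def[abs_def])

lemma upper_maps: "f \<in> ell2 V \<Longrightarrow> upper f \<in> ell2 V" and lower_maps: "f \<in> ell2 V \<Longrightarrow> lower f \<in> ell2 V"
  by (rule ell2_linear_maps[OF upper_linear] ell2_linear_maps[OF lower_linear], assumption)+

lemma upper_symmetric:
  "f \<in> ell2 V \<Longrightarrow> g \<in> ell2 V \<Longrightarrow> ell2_inner V (upper f) g = ell2_inner V f (upper g)"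
  unfolding upper_def by (simp only: ell2_inner_lincomb_left ell2_inner_lincomb_right maps symmetric) simp

lemma lower_symmetric:
  "f \<in> ell2 V \<Longrightarrow> g \<in> ell2 V \<Longrightarrow> ell2_inner V (lower f) g = ell2_inner V f (lower g)"
  unfolding lower_def by (simp only: ell2_inner_lincomb_left ell2_inner_lincomb_right maps symmetric) simp

lemma upper_lower_commute: "f \<in> ell2 V \<Longrightarrow> upper (lower f) = lower (upper f)"
  unfolding upper_def lower_def by (simp only: ell2_linear_lincomb[OF linear] maps) (auto simp: algebra_simps)

lemma upper_lower_pow_commute: "f \<in> ell2 V \<Longrightarrow> upper ((lower ^^ k) f) = (lower ^^ k) (upper f)"
proof (induction k)
  case (Suc k)
  then show ?case
    using upper_lower_commute[OF ell2_linear_maps[OF ell2_linear_funpow[OF lower_linear]]] by simp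
qed simp

lemma pow_upper_lower_commute: "f \<in> ell2 V \<Longrightarrow> (upper ^^ j) ((lower ^^ k) f) = (lower ^^ k) ((upper ^^ j) f)"
proof (induction j)
  case (Suc j)
  then show ?case
    using upper_lower_pow_commute[OF ell2_linear_maps[OF ell2_linear_funpow[OF upper_linear]]] by simp
qed simp

text \<open>The numbers \<open>c j k\<close> of the Hausdorff problem, before division by the
  squared norm of \<open>f\<close>.\<close>

definition mixed_moment :: "('v \<Rightarrow> complex) \<Rightarrow> nat \<Rightarrow> nat \<Rightarrow> real" where
  "mixed_moment f j k = Re (ell2_inner V ((upper ^^ j) ((lower ^^ k) f)) f)"

lemma upper_pow_maps: "f \<in> ell2 V \<Longrightarrow> (upper ^^ j) f \<in> ell2 V"
  and lower_pow_maps: "f \<in> ell2 V \<Longrightarrow> (lower ^^ j) f \<in> ell2 V"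
  by (rule ell2_linear_maps[OF ell2_linear_funpow[OF upper_linear]]
      ell2_linear_maps[OF ell2_linear_funpow[OF lower_linear]], assumption)+

text \<open>Of two equal factors, one goes to each side of the inner product. Together with the
  analogue for \<open>lower\<close> this reduces positivity to exponents 0 and 1.\<close>

lemma mixed_moment_upper:
  assumes "f \<in> ell2 V"
  shows "mixed_moment f (Suc (Suc j)) k = mixed_moment (upper f) j k"
proof -
  have "(upper ^^ Suc (Suc j)) ((lower ^^ k) f) = upper ((upper ^^ j) ((lower ^^ k) (upper f)))"
    using upper_lower_pow_commute[OF assms, of k] by (simp add: funpow_swap1[of upper])
  then show ?thesis
    using assms by (simp add: mixed_moment_def upper_symmetric upper_maps upper_pow_maps lower_pow_maps)
qed

lemma mixed_moment_lower:
  assumes "f \<in> ell2 V"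
  shows "mixed_moment f j (Suc (Suc k)) = mixed_moment (lower f) j k"
proof -
  have "(upper ^^ j) ((lower ^^ Suc (Suc k)) f) = lower ((upper ^^ j) ((lower ^^ k) (lower f)))"
    using assms pow_upper_lower_commute[of "(lower ^^ k) (lower f)" j 1]
    by (simp add: lower_maps lower_pow_maps funpow_swap1[of lower])
  then show ?thesis
    using assms by (simp add: mixed_moment_def lower_symmetric lower_maps upper_pow_maps lower_pow_maps)
qed

lemma mixed_moment_rec:
  assumes "f \<in> ell2 V"
  shows "mixed_moment f j k = mixed_moment f (Suc j) k + mixed_moment f j (Suc k)"
proof -
  let ?g = "(lower ^^ k) f"
  have g: "?g \<in> ell2 V" by (rule lower_pow_maps[OF assms])
  have "(\<lambda>x. 1 * upper ?g x + 1 * lower ?g x) = ?g" by (simp add: upper_def lower_def)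
  then have "(upper ^^ j) ?g = (upper ^^ j) (\<lambda>x. 1 * upper ?g x + 1 * lower ?g x)"
    by (simp only:)
  also have "\<dots> = (\<lambda>x. 1 * (upper ^^ j) (upper ?g) x + 1 * (upper ^^ j) (lower ?g) x)"
    by (rule ell2_linear_lincomb[OF ell2_linear_funpow[OF upper_linear] upper_maps[OF g] lower_maps[OF g]])
  finally have "ell2_inner V ((upper ^^ j) ?g) f
      = 1 * ell2_inner V ((upper ^^ j) (upper ?g)) f + 1 * ell2_inner V ((upper ^^ j) (lower ?g)) f"
    by (simp only: ell2_inner_lincomb_left[OF upper_pow_maps[OF upper_maps[OF g]] upper_pow_maps[OF lower_maps[OF g]] assms])
  then show ?thesis by (simp add: mixed_moment_def funpow_swap1)
qed

text \<open>Four cases remain after the reduction: \<open>||f||^2\<close>, the forms of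
  \<open>lower\<close> and of \<open>upper\<close>, and the form of their product, which is
  \<open>(||f||^2 - ||T f||^2) / 4\<close>.\<close>

lemma mixed_moment_nonneg: "f \<in> ell2 V \<Longrightarrow> 0 \<le> mixed_moment f j k"
proof (induction j arbitrary: f rule: induct_nat_012)
  \<comment> \<open>\<open>||f + T f||^2\<close> and \<open>||f - T f||^2\<close> are nonnegative;
    they are expanded, and \<open>||T f||^2\<close> is replaced by the larger
    \<open>||f||^2\<close>.\<close>
  have abs: "0 \<le> ell2_norm2 V f + Re (ell2_inner V (T f) f)" "0 \<le> ell2_norm2 V f - Re (ell2_inner V (T f) f)"
    if f: "f \<in> ell2 V" for f
    using ell2_norm2_lincomb[OF f maps[OF f], of 1 1] ell2_norm2_lincomb[OF f maps[OF f], of 1 "-1"]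
      ell2_norm2_nonneg[of V "\<lambda>x. 1 * f x + 1 * T f x"] ell2_norm2_nonneg[of V "\<lambda>x. 1 * f x + (- 1) * T f x"]
      contraction[OF f] symmetric[OF f f] by auto
  {
    case 0 then show ?case
    proof (induction k arbitrary: f rule: induct_nat_012)
      case 0 then show ?case by (simp add: mixed_moment_def ell2_inner_self ell2_norm2_nonneg)
    next
      case 1
      then show ?case using abs(2)[OF 1]
        by (simp add: mixed_moment_def lower_def[abs_def] ell2_inner_lincomb_left[of _ _ _ _ "1/2" "-1/2", simplified] maps ell2_inner_self)
    next
      case (ge2 k) then show ?case by (simp add: mixed_moment_lower lower_maps)
    qed
  next
    case 1 then show ?case
    proof (induction k arbitrary: f rule: induct_nat_012)
      case 0
      then show ?case using abs(1)[OF 0]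
        by (simp add: mixed_moment_def upper_def[abs_def] ell2_inner_lincomb_left[of _ _ _ _ "1/2" "1/2", simplified] maps ell2_inner_self)
    next
      case 1
      have "mixed_moment f (Suc 0) (Suc 0) = Re (ell2_inner V (lower f) (upper f))"
        using 1 by (simp add: mixed_moment_def upper_symmetric lower_maps)
      also have "\<dots> = (ell2_norm2 V f - ell2_norm2 V (T f)) / 4"
        unfolding upper_def lower_def using 1
        by (simp only: ell2_inner_lincomb_left ell2_inner_lincomb_right maps ell2_lincomb symmetric)
           (simp add: ell2_inner_self[of V "T f"] ell2_inner_self[of V f] symmetric[symmetric] maps algebra_simps)
      finally show ?case using contraction[OF 1] by simp
    next
      case (ge2 k) then show ?case by (simp add: mixed_moment_lower lower_maps)
    qed
  next
    case (ge2 j) then show ?case by (simp add: mixed_moment_upper upper_maps)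
  }
qed

end

section \<open>Measures of single vectors and forms of pairs\<close>

context ell2_contraction
begin

lemma moment_measure_exists:
  assumes f: "f \<in> ell2 V"
  shows "\<exists>\<mu>. finite_measure \<mu> \<and> sets \<mu> = sets borel \<and> (AE t in \<mu>. \<bar>t\<bar> \<le> 1) \<and>
    (\<forall>n. (LINT t|\<mu>. t ^ n) = Re (ell2_inner V ((T ^^ n) f) f))"
proof -
  let ?N = "ell2_norm2 V f"
  obtain M where M: "real_distribution M" "AE s in M. s \<in> {0..1}"
    and mom: "\<And>i. ?N * (LINT s|M. s ^ i) = Re (ell2_inner V ((upper ^^ i) f) f)"
  \<comment> \<open>The Hausdorff theorem wants total mass 1, so the moments are divided by
    \<open>||f||^2\<close>. For \<open>f = 0\<close> any probability measure on
    \<open>[0, 1]\<close> will do, as it is multiplied by 0 below.\<close>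
  proof (cases "?N = 0")
    case True
    then have f0: "f = (\<lambda>x. 0)" by (rule ell2_norm2_eq_0[OF f])
    have "real_distribution (return borel (0::real))"
      by (simp add: real_distribution_def real_distribution_axioms_def prob_space_return)
    moreover have "AE s in return borel (0::real). s \<in> {0..1}"
      by (subst AE_return) auto
    moreover have "Re (ell2_inner V ((upper ^^ i) f) f) = 0" for i
      unfolding f0 by (simp add: ell2_inner_def)
    ultimately show ?thesis using True by (intro that) auto
  next
    case False
    then have N: "0 < ?N" using ell2_norm2_nonneg[of V f] by simp
    define c where "c j k = mixed_moment f j k / ?N" for j k
    have rec: "c j k = c (Suc j) k + c j (Suc k)" for j k
      unfolding c_def using mixed_moment_rec[OF f, of j k] by (simp add: add_divide_distrib)
    have "c 0 0 = 1" using N by (simp add: c_def mixed_moment_def ell2_inner_self)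
    moreover have "0 \<le> c j k" for j k
      unfolding c_def using mixed_moment_nonneg[OF f] N by simp
    ultimately obtain M where "real_distribution M" "AE t in M. t \<in> {0..1}" "\<And>m. (LINT t|M. t ^ m) = c m 0"
      using hausdorff_moments[of c, OF rec] by blast
    then show ?thesis using N by (intro that) (auto simp: c_def mixed_moment_def)
  qed
  interpret M: real_distribution M by fact
  have int: "integrable M (\<lambda>s. s ^ i * (2 * s - 1) ^ n)" for i n
  proof (rule M.integrable_const_bound[where B = 1])
    show "AE s in M. norm (s ^ i * (2 * s - 1) ^ n) \<le> 1"
      using M(2)
    proof eventually_elim
      case (elim s)
      then have "\<bar>s\<bar> \<le> 1" "\<bar>2 * s - 1\<bar> \<le> 1" by auto
      then show ?case by (simp add: abs_mult power_abs mult_le_one power_le_one)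
    qed
  qed simp
  \<comment> \<open>Since \<open>T = 2 * upper - 1\<close>, each \<open>T\<close> acts as
    \<open>2 * s - 1\<close>. The free power of \<open>s\<close> lets the induction trade one
    \<open>T\<close> for one more \<open>upper\<close>.\<close>
  have pow: "?N * (LINT s|M. s ^ i * (2 * s - 1) ^ n) = Re (ell2_inner V ((upper ^^ i) ((T ^^ n) f)) f)" for i n
  proof (induction n arbitrary: i)
    case 0 then show ?case using mom by simp
  next
    case (Suc n)
    let ?g = "(T ^^ n) f"
    have g: "?g \<in> ell2 V" by (rule pow_maps[OF f])
    have "(T ^^ Suc n) f = (\<lambda>x. 2 * upper ?g x + (-1) * ?g x)" by (simp add: upper_def)
    then have "(upper ^^ i) ((T ^^ Suc n) f) = (upper ^^ i) (\<lambda>x. 2 * upper ?g x + (-1) * ?g x)"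
      by (simp only:)
    also have "\<dots> = (\<lambda>x. 2 * (upper ^^ i) (upper ?g) x + (-1) * (upper ^^ i) ?g x)"
      by (rule ell2_linear_lincomb[OF ell2_linear_funpow[OF upper_linear] upper_maps[OF g] g])
    finally have "ell2_inner V ((upper ^^ i) ((T ^^ Suc n) f)) f =
        2 * ell2_inner V ((upper ^^ i) (upper ?g)) f + (-1) * ell2_inner V ((upper ^^ i) ?g) f"
      by (simp only: ell2_inner_lincomb_left[OF upper_pow_maps[OF upper_maps[OF g]] upper_pow_maps[OF g] f])
    moreover have "(LINT s|M. s ^ i * (2 * s - 1) ^ Suc n) =
        2 * (LINT s|M. s ^ Suc i * (2 * s - 1) ^ n) - (LINT s|M. s ^ i * (2 * s - 1) ^ n)"
    proof -
      have "(LINT s|M. s ^ i * (2 * s - 1) ^ Suc n) =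
          (LINT s|M. 2 * (s ^ Suc i * (2 * s - 1) ^ n) - s ^ i * (2 * s - 1) ^ n)"
        by (rule Bochner_Integration.integral_cong) (auto simp: algebra_simps)
      also have "\<dots> = (LINT s|M. 2 * (s ^ Suc i * (2 * s - 1) ^ n)) - (LINT s|M. s ^ i * (2 * s - 1) ^ n)"
        by (intro Bochner_Integration.integral_diff integrable_mult_right int)
      finally show ?thesis by simp
    qed
    moreover have "(upper ^^ i) (upper ?g) = (upper ^^ Suc i) ?g" by (simp add: funpow_swap1)
    ultimately show ?case
      using Suc.IH[of "Suc i"] Suc.IH[of i] by (simp add: right_diff_distrib del: funpow.simps)
  qed
  define D where "D = distr M borel (\<lambda>s. 2 * s - 1)"
  interpret D: real_distribution D
    unfolding D_def by (rule M.real_distribution_distr) simp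
  define \<mu> where "\<mu> = density D (\<lambda>_. ennreal ?N)"
  have "finite_measure \<mu>"
    by (rule finite_measureI) (simp add: \<mu>_def emeasure_density D.emeasure_eq_measure ennreal_mult_eq_top_iff)
  moreover have "sets \<mu> = sets borel" by (simp add: \<mu>_def)
  moreover have "AE t in \<mu>. \<bar>t\<bar> \<le> 1"
  proof -
    have "AE t in D. \<bar>t\<bar> \<le> 1"
      unfolding D_def
    proof (subst AE_distr_iff)
      show "AE s in M. \<bar>2 * s - 1\<bar> \<le> 1"
        using M(2) by eventually_elim auto
    qed auto
    then show ?thesis unfolding \<mu>_def by (subst AE_density) auto
  qed
  moreover have "(LINT t|\<mu>. t ^ n) = Re (ell2_inner V ((T ^^ n) f) f)" for n
  proof -
    have "(LINT t|\<mu>. t ^ n) = (LINT t|D. ?N *\<^sub>R t ^ n)"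
      unfolding \<mu>_def by (rule integral_density) (auto simp: ell2_norm2_nonneg)
    also have "\<dots> = ?N * (LINT s|M. (2 * s - 1) ^ n)"
      unfolding D_def by (subst integral_distr) auto
    finally show ?thesis using pow[of 0 n] by simp
  qed
  ultimately show ?thesis by blast
qed

definition moment_measure :: "('v \<Rightarrow> complex) \<Rightarrow> real measure" where
  "moment_measure f = (SOME \<mu>. finite_measure \<mu> \<and> sets \<mu> = sets borel \<and> (AE t in \<mu>. \<bar>t\<bar> \<le> 1) \<and>
    (\<forall>n. (LINT t|\<mu>. t ^ n) = Re (ell2_inner V ((T ^^ n) f) f)))"

lemma moment_measure:
  assumes "f \<in> ell2 V"
  shows "finite_measure (moment_measure f)" "sets (moment_measure f) = sets borel"
    "AE t in moment_measure f. \<bar>t\<bar> \<le> 1"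
    "(LINT t|moment_measure f. t ^ n) = Re (ell2_inner V ((T ^^ n) f) f)"
  using someI_ex[OF moment_measure_exists[OF assms]] unfolding moment_measure_def[symmetric] by blast+

lemma space_moment_measure: "f \<in> ell2 V \<Longrightarrow> space (moment_measure f) = UNIV"
  using sets_eq_imp_space_eq[OF moment_measure(2)] by simp

lemma borel_functional_moment_measure:
  "f \<in> ell2 V \<Longrightarrow> borel_functional 1 (\<lambda>h. complex_of_real (integral\<^sup>L (moment_measure f) h))"
  by (rule borel_functional_integral) (rule moment_measure, assumption)+

lemma moment_measure_clamp:
  assumes f: "f \<in> ell2 V"
  shows "complex_of_real (LINT t|moment_measure f. clamp_to 1 t ^ n) = ell2_inner V ((T ^^ n) f) f"
proof -
  note [measurable_cong] = moment_measure(2)[OF f]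
  have "(LINT t|moment_measure f. clamp_to 1 t ^ n) = (LINT t|moment_measure f. t ^ n)"
  proof (rule integral_cong_AE)
    show "AE t in moment_measure f. clamp_to 1 t ^ n = t ^ n"
      using moment_measure(3)[OF f] by eventually_elim (simp add: clamp_to_id)
  qed measurable
  then show ?thesis using moment_measure(4)[OF f, of n] pow_inner_real[OF f, of n] by simp
qed

text \<open>The complex measure of the pair \<open>f\<close>, \<open>g\<close>, which is to become
  \<open><E(.) f, g>\<close>.\<close>

definition spectral_form :: "('v \<Rightarrow> complex) \<Rightarrow> ('v \<Rightarrow> complex) \<Rightarrow> (real \<Rightarrow> real) \<Rightarrow> complex" where
  "spectral_form f g h = polarize (\<lambda>f. complex_of_real (integral\<^sup>L (moment_measure f) h)) f g"

lemma borel_functional_spectral_form: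
  assumes "f \<in> ell2 V" "g \<in> ell2 V"
  shows "borel_functional 1 (spectral_form f g)"
  unfolding spectral_form_def[abs_def]
  by (rule borel_functional_polarize[OF borel_functional_moment_measure assms])

lemma spectral_form_clamp:
  assumes "f \<in> ell2 V" "g \<in> ell2 V"
  shows "spectral_form f g (\<lambda>t. clamp_to 1 t ^ n) = ell2_inner V ((T ^^ n) f) g"
  unfolding spectral_form_def polarize_inner[OF ell2_linear_funpow[OF linear] assms, symmetric]
  by (rule polarize_cong[OF moment_measure_clamp assms])

text \<open>Moments determine a functional on \<open>[-1, 1]\<close>. The algebraic properties of
  the form are drawn from this, since the measures behind it are chosen vector by vector and show no
  linearity.\<close>

lemma spectral_form_eqI:
  assumes "f \<in> ell2 V" "g \<in> ell2 V" "borel_functional 1 \<Phi>"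
    and "\<And>n. \<Phi> (\<lambda>t. clamp_to 1 t ^ n) = ell2_inner V ((T ^^ n) f) g" "h \<in> bounded_borel"
  shows "spectral_form f g h = \<Phi> h"
  by (rule borel_functional_eq_moments[OF borel_functional_spectral_form[OF assms(1,2)] assms(3) _ _ assms(5)])
     (simp_all add: spectral_form_clamp assms)

lemma spectral_form_lincomb_left:
  assumes f: "f \<in> ell2 V" "k \<in> ell2 V" and g: "g \<in> ell2 V" and h: "h \<in> bounded_borel"
  shows "spectral_form (\<lambda>x. a * f x + b * k x) g h = a * spectral_form f g h + b * spectral_form k g h"
  using f g
  by (intro spectral_form_eqI[OF _ _ _ _ h] ell2_lincomb borel_functional_lincomb borel_functional_spectral_form)
     (simp_all add: spectral_form_clamp ell2_linear_lincomb[OF ell2_linear_funpow[OF linear]]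
        ell2_inner_lincomb_left pow_maps)

lemma spectral_form_commute:
  assumes "f \<in> ell2 V" "g \<in> ell2 V" "h \<in> bounded_borel"
  shows "spectral_form f g h = cnj (spectral_form g f h)"
proof (rule spectral_form_eqI[OF assms(1,2) _ _ assms(3)])
  show "borel_functional 1 (\<lambda>h. cnj (spectral_form g f h))"
    by (intro borel_functional_cnj borel_functional_spectral_form assms)
  show "cnj (spectral_form g f (\<lambda>t. clamp_to 1 t ^ n)) = ell2_inner V ((T ^^ n) f) g" for n
    using assms(1,2) ell2_symmetric_funpow[OF linear symmetric, of f g n]
    by (simp add: spectral_form_clamp ell2_inner_commute[of V f])
qed

lemma spectral_form_lincomb_right:
  assumes f: "f \<in> ell2 V" "k \<in> ell2 V" and g: "g \<in> ell2 V" and h: "h \<in> bounded_borel"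
  shows "spectral_form g (\<lambda>x. a * f x + b * k x) h = cnj a * spectral_form g f h + cnj b * spectral_form g k h"
  using spectral_form_lincomb_left[OF assms, of a b] assms
  by (subst (1 2 3) spectral_form_commute) (simp_all add: ell2_lincomb)

lemma spectral_form_self:
  assumes "f \<in> ell2 V" "h \<in> bounded_borel"
  shows "spectral_form f f h = of_real (integral\<^sup>L (moment_measure f) h)"
  by (rule spectral_form_eqI[OF assms(1,1) borel_functional_moment_measure _ assms(2)])
     (simp_all add: moment_measure_clamp assms)

lemma spectral_form_T:
  assumes f: "f \<in> ell2 V" "g \<in> ell2 V" and h: "h \<in> bounded_borel"
  shows "spectral_form ((T ^^ m) f) g h = spectral_form f g (\<lambda>t. clamp_to 1 t ^ m * h t)"
proof (rule spectral_form_eqI[OF pow_maps[OF f(1)] f(2) _ _ h])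
  show "borel_functional 1 (\<lambda>h. spectral_form f g (\<lambda>t. clamp_to 1 t ^ m * h t))"
    by (intro borel_functional_mult borel_functional_spectral_form f bounded_borel_clamp_power) simp
  show "spectral_form f g (\<lambda>t. clamp_to 1 t ^ m * clamp_to 1 t ^ n) = ell2_inner V ((T ^^ n) ((T ^^ m) f)) g" for n
    using spectral_form_clamp[OF f, of "n + m"] by (simp add: funpow_add power_add mult.commute)
qed

text \<open>The four measures in the polarization have masses \<open>||f + a g||^2\<close>; the
  cross terms cancel in the sum over the four values of \<open>a\<close>, which leaves 4 times the
  right-hand side.\<close>

lemma spectral_form_bound:
  assumes f: "f \<in> ell2 V" "g \<in> ell2 V" and B: "B \<in> sets borel"
  shows "cmod (spectral_form f g (indicator B)) \<le> ell2_norm2 V f + ell2_norm2 V g"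
proof -
  define q where "q f = complex_of_real (integral\<^sup>L (moment_measure f) (indicator B))" for f
  have q: "cmod (q f) \<le> ell2_norm2 V f" if "f \<in> ell2 V" for f
  proof -
    interpret finite_measure "moment_measure f" by (rule moment_measure(1)[OF that])
    have "integral\<^sup>L (moment_measure f) (indicator B) = measure (moment_measure f) B"
      by (simp add: space_moment_measure[OF that])
    moreover have "measure (moment_measure f) B \<le> measure (moment_measure f) (space (moment_measure f))"
      by (rule bounded_measure)
    moreover have "measure (moment_measure f) (space (moment_measure f)) = ell2_norm2 V f"
      using moment_measure(4)[OF that, of 0] by (simp add: ell2_inner_self)
    ultimately show ?thesis by (simp add: q_def)
  qed
  have N: "ell2_norm2 V (perturb f a g) = ell2_norm2 V f + ell2_norm2 V g + 2 * Re (cnj a * ell2_inner V f g)"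
    if "cmod a = 1" for a
    using ell2_norm2_lincomb[OF f, of 1 a] that by (simp add: perturb_eq)
  have p: "perturb f a g \<in> ell2 V" for a by (rule ell2_perturb[OF f])
  have eq: "4 * spectral_form f g (indicator B) = q (perturb f 1 g) - q (perturb f (-1) g)
      + \<i> * q (perturb f \<i> g) - \<i> * q (perturb f (-\<i>) g)"
    unfolding spectral_form_def polarize_def q_def times_divide_eq_right
    by (rule nonzero_mult_div_cancel_left) simp
  have "cmod (4 * spectral_form f g (indicator B)) \<le> cmod (q (perturb f 1 g)) + cmod (q (perturb f (-1) g))
      + cmod (\<i> * q (perturb f \<i> g)) + cmod (\<i> * q (perturb f (-\<i>) g))"
    unfolding eq by (intro order_trans[OF norm_triangle_ineq4] add_mono order_trans[OF norm_triangle_ineq] order_refl)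
  also have "\<dots> \<le> ell2_norm2 V (perturb f 1 g) + ell2_norm2 V (perturb f (-1) g)
      + ell2_norm2 V (perturb f \<i> g) + ell2_norm2 V (perturb f (-\<i>) g)"
    unfolding norm_mult by (intro add_mono) (simp_all add: q p)
  also have "\<dots> = 4 * (ell2_norm2 V f + ell2_norm2 V g)"
    by (simp add: N)
  finally show ?thesis by (simp add: norm_mult)
qed

text \<open>The coordinates that \<open>ell2_riesz\<close> prescribes for the vector representing
  \<open>g \<mapsto> spectral_form f g (indicator B)\<close>.\<close>

definition spectral_projection :: "real set \<Rightarrow> ('v \<Rightarrow> complex) \<Rightarrow> 'v \<Rightarrow> complex" where
  "spectral_projection B f = (\<lambda>x. if x \<in> V then spectral_form f (dirac_function x) (indicator B) else 0)"

lemma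
  assumes B: "B \<in> sets borel" and f: "f \<in> ell2 V"
  shows spectral_projection_ell2: "spectral_projection B f \<in> ell2 V"
    and inner_spectral_projection: "g \<in> ell2 V \<Longrightarrow>
      ell2_inner V (spectral_projection B f) g = spectral_form f g (indicator B)"
proof -
  note ind = bounded_borel_indicator[OF B]
  \<comment> \<open>The form bound has the shape required by \<open>ell2_riesz\<close>, with
    \<open>K = ||f||^2\<close>.\<close>
  note riesz = ell2_riesz[of V "\<lambda>g. spectral_form f g (indicator B)" "ell2_norm2 V f",
    OF spectral_form_lincomb_right[OF _ _ f ind] spectral_form_bound[OF f _ B], folded spectral_projection_def]
  show "spectral_projection B f \<in> ell2 V" by (rule riesz(1)[OF _ _ _ ell2_zero])
  show "g \<in> ell2 V \<Longrightarrow> ell2_inner V (spectral_projection B f) g = spectral_form f g (indicator B)"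
    by (rule riesz(2)[symmetric])
qed

lemma spectral_projection_symmetric:
  assumes "B \<in> sets borel" "f \<in> ell2 V" "g \<in> ell2 V"
  shows "ell2_inner V (spectral_projection B f) g = ell2_inner V f (spectral_projection B g)"
  using assms spectral_form_commute[OF assms(2,3) bounded_borel_indicator[OF assms(1)]]
  by (simp add: inner_spectral_projection ell2_inner_commute[of V f])

text \<open>Write \<open>E(B)\<close> for the projection. The functional
  \<open>h \<mapsto> spectral_form f g (indicator B * h)\<close> has the moments
  \<open><T^n f, E(B) g>\<close>, because \<open>E(B)\<close> is symmetric. It is therefore the form
  of the pair \<open>f\<close>, \<open>E(B) g\<close>, and evaluation at \<open>indicator C\<close>
  gives the product rule.\<close>

lemma spectral_projection_mult:
  assumes B: "B \<in> sets borel" and C: "C \<in> sets borel" and f: "f \<in> ell2 V"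
  shows "spectral_projection (B \<inter> C) f = spectral_projection B (spectral_projection C f)"
proof (rule ell2_eqI[of _ V])
  show "spectral_projection (B \<inter> C) f \<in> ell2 V"
    "spectral_projection B (spectral_projection C f) \<in> ell2 V"
    using B C f by (auto intro: spectral_projection_ell2)
  fix g assume g: "g \<in> ell2 V"
  note Bind = bounded_borel_indicator[OF B] and Cind = bounded_borel_indicator[OF C]
  have Bg: "spectral_projection B g \<in> ell2 V" by (rule spectral_projection_ell2[OF B g])
  have "spectral_form f (spectral_projection B g) (indicator C) =
      spectral_form f g (\<lambda>t. indicator B t * indicator C t)"
  proof (rule spectral_form_eqI[OF f Bg _ _ Cind])
    show "borel_functional 1 (\<lambda>h. spectral_form f g (\<lambda>t. indicator B t * h t))"
      by (intro borel_functional_mult borel_functional_spectral_form f g Bind)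
    fix n
    have "spectral_form f g (\<lambda>t. indicator B t * clamp_to 1 t ^ n) = spectral_form ((T ^^ n) f) g (indicator B)"
      unfolding spectral_form_T[OF f g Bind] by (simp add: mult.commute)
    also have "\<dots> = ell2_inner V ((T ^^ n) f) (spectral_projection B g)"
      using inner_spectral_projection[OF B pow_maps[OF f] g]
        spectral_projection_symmetric[OF B pow_maps[OF f] g] by simp
    finally show "spectral_form f g (\<lambda>t. indicator B t * clamp_to 1 t ^ n)
        = ell2_inner V ((T ^^ n) f) (spectral_projection B g)" .
  qed
  moreover have "(\<lambda>t. indicator B t * indicator C t :: real) = indicator (B \<inter> C)"
    by (auto simp: indicator_def)
  ultimately have "ell2_inner V (spectral_projection C f) (spectral_projection B g)
      = ell2_inner V (spectral_projection (B \<inter> C) f) g"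
    using B C f g Bg by (simp add: inner_spectral_projection)
  then show "ell2_inner V (spectral_projection (B \<inter> C) f) g =
      ell2_inner V (spectral_projection B (spectral_projection C f)) g"
    by (simp add: spectral_projection_symmetric[OF B spectral_projection_ell2[OF C f] g])
qed

lemma spectral_form_one:
  assumes "f \<in> ell2 V" "g \<in> ell2 V" "B \<in> sets borel" "{-1..1} \<subseteq> B"
  shows "spectral_form f g (indicator B) = ell2_inner V f g"
proof -
  have "spectral_form f g (indicator B) = spectral_form f g (\<lambda>t. 1)"
    using assms(3,4)
    by (intro borel_functional_cong[OF borel_functional_spectral_form[OF assms(1,2)]]
        bounded_borel_indicator bounded_borel_const) (auto simp: indicator_def abs_le_iff)
  then show ?thesis using spectral_form_clamp[OF assms(1,2), of 0] by simp
qed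

lemma spectral_projection_id:
  assumes "f \<in> ell2 V" "B \<in> sets borel" "{-1..1} \<subseteq> B"
  shows "spectral_projection B f = f"
  using assms by (intro ell2_eqI[of _ V] spectral_projection_ell2) (simp_all add: inner_spectral_projection spectral_form_one)

lemma orthogonal_projection_spectral_projection:
  assumes B: "B \<in> sets borel"
  shows "orthogonal_projection_on V (spectral_projection B)"
  unfolding orthogonal_projection_on_def
proof (intro conjI ballI allI)
  fix f assume f: "f \<in> ell2 V"
  show "spectral_projection B f \<in> ell2 V" by (rule spectral_projection_ell2[OF B f])
  show "spectral_projection B (spectral_projection B f) = spectral_projection B f"
    using spectral_projection_mult[OF B B f] by simp
  fix g assume g: "g \<in> ell2 V"
  show "ell2_inner V (spectral_projection B f) g = ell2_inner V f (spectral_projection B g)"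
    by (rule spectral_projection_symmetric[OF B f g])
  fix a b
  show "spectral_projection B (\<lambda>x. a * f x + b * g x) =
      (\<lambda>x. a * spectral_projection B f x + b * spectral_projection B g x)"
    by (rule ext) (simp add: spectral_projection_def spectral_form_lincomb_left f g ell2_dirac
        bounded_borel_indicator[OF B])
qed

lemma projection_valued_measure_spectral_projection:
  "projection_valued_measure V spectral_projection"
  unfolding projection_valued_measure_def
proof (intro conjI ballI allI impI)
  show "orthogonal_projection_on V (spectral_projection B)" if "B \<in> sets borel" for B
    by (rule orthogonal_projection_spectral_projection[OF that])
  show "\<exists>r. \<forall>f\<in>ell2 V. spectral_projection {-r..r} f = f"
    by (intro exI[of _ 1] ballI spectral_projection_id) auto
  show "spectral_projection UNIV f = f" if "f \<in> ell2 V" for f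
    by (rule spectral_projection_id[OF that]) auto
  show "spectral_projection {} f = (\<lambda>_. 0)" if f: "f \<in> ell2 V" for f
  proof -
    have "spectral_form f g (indicator {}) = 0" if "g \<in> ell2 V" for g
      using borel_functional_zero[OF borel_functional_spectral_form[OF f that]] by (simp add: indicator_def[abs_def])
    then show ?thesis by (auto simp: spectral_projection_def ell2_dirac)
  qed
  show "spectral_projection (B \<inter> C) f = spectral_projection B (spectral_projection C f)"
    if "B \<in> sets borel" "C \<in> sets borel" "f \<in> ell2 V" for B C f
    by (rule spectral_projection_mult[OF that])
  fix B :: "nat \<Rightarrow> real set" and f g
  assume B: "range B \<subseteq> sets borel" "disjoint_family B" and f: "f \<in> ell2 V" and g: "g \<in> ell2 V"
  have "B n \<in> sets borel" "(\<Union>n. B n) \<in> sets borel" for n using B(1) by auto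
  then show "(\<lambda>n. ell2_inner V (spectral_projection (B n) f) g) sums
      ell2_inner V (spectral_projection (\<Union>n. B n) f) g"
    using borel_functional_sums[OF borel_functional_spectral_form[OF f g] B] f g
    by (simp add: inner_spectral_projection)
qed

lemma scalar_spectral_measure_spectral_projection:
  assumes f: "f \<in> ell2 V"
  shows "scalar_spectral_measure V spectral_projection f = moment_measure f"
proof -
  interpret finite_measure "moment_measure f" by (rule moment_measure(1)[OF f])
  have "scalar_spectral_measure V spectral_projection f
      = measure_of UNIV (sets borel) (emeasure (moment_measure f))"
    unfolding scalar_spectral_measure_def
  proof (rule measure_of_eq)
    fix B :: "real set" assume "B \<in> sigma_sets UNIV (sets borel)"
    then have B: "B \<in> sets borel" using sets.sigma_sets_eq[of "borel :: real measure"] by simp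
    show "ennreal (Re (ell2_inner V (spectral_projection B f) f)) = emeasure (moment_measure f) B"
      using B f by (simp add: inner_spectral_projection spectral_form_self bounded_borel_indicator
          space_moment_measure emeasure_eq_measure)
  qed simp
  also have "\<dots> = moment_measure f"
    using measure_of_of_measure[of "moment_measure f"] by (simp add: space_moment_measure[OF f] moment_measure(2)[OF f])
  finally show ?thesis .
qed

theorem is_spectral_measure_spectral_projection: "is_spectral_measure V T spectral_projection"
  unfolding is_spectral_measure_def
proof (intro conjI ballI projection_valued_measure_spectral_projection)
  fix f assume f: "f \<in> ell2 V"
  show "ell2_inner V (T f) f = complex_of_real (\<integral>t. t \<partial>scalar_spectral_measure V spectral_projection f)"
    using moment_measure(4)[OF f, of 1] pow_inner_real[OF f, of 1]
    by (simp add: scalar_spectral_measure_spectral_projection[OF f])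
qed

end

section \<open>Moments of spectral measures\<close>

text \<open>Here \<open>E\<close> is arbitrary; nothing refers to the projections constructed
  above.\<close>

locale ell2_spectral_measure =
  fixes V :: "'v set" and T :: "('v \<Rightarrow> complex) \<Rightarrow> ('v \<Rightarrow> complex)"
    and E :: "real set \<Rightarrow> ('v \<Rightarrow> complex) \<Rightarrow> ('v \<Rightarrow> complex)"
  assumes linear: "ell2_linear V T" and spectral: "is_spectral_measure V T E"
begin

lemma pvm: "projection_valued_measure V E"
  using spectral by (simp add: is_spectral_measure_def)

lemma proj: "B \<in> sets borel \<Longrightarrow> orthogonal_projection_on V (E B)"
  using pvm by (simp add: projection_valued_measure_def)

lemma proj_linear: "B \<in> sets borel \<Longrightarrow> ell2_linear V (E B)"
  using proj[of B] unfolding orthogonal_projection_on_def ell2_linear_def by blast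

lemma proj_maps: "B \<in> sets borel \<Longrightarrow> f \<in> ell2 V \<Longrightarrow> E B f \<in> ell2 V"
  by (rule ell2_linear_maps[OF proj_linear])

lemma proj_symmetric:
  "B \<in> sets borel \<Longrightarrow> f \<in> ell2 V \<Longrightarrow> g \<in> ell2 V \<Longrightarrow> ell2_inner V (E B f) g = ell2_inner V f (E B g)"
  using proj[of B] unfolding orthogonal_projection_on_def by blast

lemma proj_idem: "B \<in> sets borel \<Longrightarrow> f \<in> ell2 V \<Longrightarrow> E B (E B f) = E B f"
  using proj[of B] unfolding orthogonal_projection_on_def by blast

lemma proj_mult:
  "B \<in> sets borel \<Longrightarrow> C \<in> sets borel \<Longrightarrow> f \<in> ell2 V \<Longrightarrow> E (B \<inter> C) f = E B (E C f)"
  using pvm unfolding projection_valued_measure_def by blast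

lemma proj_inner_self:
  assumes "B \<in> sets borel" "f \<in> ell2 V"
  shows "ell2_inner V (E B f) f = of_real (ell2_norm2 V (E B f))"
  using proj_symmetric[OF assms(1) proj_maps[OF assms] assms(2)] assms
  by (simp add: proj_idem ell2_inner_self)

abbreviation scalar_measure :: "('v \<Rightarrow> complex) \<Rightarrow> real measure" where
  "scalar_measure \<equiv> scalar_spectral_measure V E"

lemma sets_scalar_measure: "sets (scalar_measure f) = sets borel"
  and space_scalar_measure: "space (scalar_measure f) = UNIV"
  by (simp_all add: scalar_spectral_measure_def sets_measure_of_conv space_measure_of_conv
      sets.sigma_sets_eq[of "borel :: real measure", simplified])

lemma emeasure_scalar_measure:
  assumes f: "f \<in> ell2 V" and B: "B \<in> sets borel"
  shows "emeasure (scalar_measure f) B = ennreal (ell2_norm2 V (E B f))"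
proof -
  have "emeasure (scalar_measure f) B = ennreal (Re (ell2_inner V (E B f) f))"
    unfolding scalar_spectral_measure_def
  proof (rule emeasure_measure_of_sigma)
    show "sigma_algebra UNIV (sets (borel :: real measure))"
      using sets.sigma_algebra_axioms[of "borel :: real measure"] by simp
    have "E {} f = (\<lambda>_. 0)" using pvm f by (simp add: projection_valued_measure_def)
    then show "positive (sets borel) (\<lambda>B. ennreal (Re (ell2_inner V (E B f) f)))"
      by (simp add: positive_def ell2_inner_def)
    show "countably_additive (sets borel) (\<lambda>B. ennreal (Re (ell2_inner V (E B f) f)))"
    proof (rule countably_additiveI)
      fix A :: "nat \<Rightarrow> real set"
      assume A: "range A \<subseteq> sets borel" "disjoint_family A" "(\<Union>i. A i) \<in> sets borel"
      have "(\<lambda>n. ell2_inner V (E (A n) f) f) sums ell2_inner V (E (\<Union>n. A n) f) f"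
        using pvm A(1,2) f unfolding projection_valued_measure_def by blast
      then have sums: "(\<lambda>n. ell2_norm2 V (E (A n) f)) sums ell2_norm2 V (E (\<Union>n. A n) f)"
        using sums_Re A f by (force simp: proj_inner_self range_subsetD)
      have "(\<Sum>i. ennreal (ell2_norm2 V (E (A i) f))) = ennreal (ell2_norm2 V (E (\<Union>i. A i) f))"
        using suminf_ennreal2[OF ell2_norm2_nonneg sums_summable[OF sums]] sums_unique[OF sums] by simp
      then show "(\<Sum>i. ennreal (Re (ell2_inner V (E (A i) f) f)))
          = ennreal (Re (ell2_inner V (E (\<Union> (range A)) f) f))"
        using A f by (simp add: proj_inner_self range_subsetD)
    qed
  qed (rule B)
  then show ?thesis by (simp add: proj_inner_self B f)
qed

lemma finite_scalar_measure: "f \<in> ell2 V \<Longrightarrow> finite_measure (scalar_measure f)"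
  by (rule finite_measureI) (simp add: space_scalar_measure emeasure_scalar_measure)

lemma measure_scalar_measure:
  "f \<in> ell2 V \<Longrightarrow> B \<in> sets borel \<Longrightarrow> measure (scalar_measure f) B = ell2_norm2 V (E B f)"
  using emeasure_scalar_measure[of f B] by (simp add: measure_def ell2_norm2_nonneg)

definition radius :: real where
  "radius = (SOME r. 0 \<le> r \<and> (\<forall>f\<in>ell2 V. E {-r..r} f = f))"

lemma radius: "0 \<le> radius" "f \<in> ell2 V \<Longrightarrow> E {-radius..radius} f = f"
proof -
  obtain r where r: "\<forall>f\<in>ell2 V. E {-r..r} f = f"
    using pvm by (auto simp: projection_valued_measure_def)
  \<comment> \<open>A negative \<open>r\<close> would make the interval empty; passing to
    \<open>\<bar>r\<bar>\<close> yields a nonnegative radius.\<close>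
  have "E {-\<bar>r\<bar>..\<bar>r\<bar>} f = f" if f: "f \<in> ell2 V" for f
  proof -
    have "E ({-\<bar>r\<bar>..\<bar>r\<bar>} \<inter> {-r..r}) f = E {-\<bar>r\<bar>..\<bar>r\<bar>} (E {-r..r} f)"
      by (rule proj_mult[OF _ _ f]) auto
    moreover have "{-\<bar>r\<bar>..\<bar>r\<bar>} \<inter> {-r..r} = {-r..r}" by auto
    ultimately show ?thesis using r f by simp
  qed
  then have "\<exists>r. 0 \<le> r \<and> (\<forall>f\<in>ell2 V. E {-r..r} f = f)" by (intro exI[of _ "\<bar>r\<bar>"]) auto
  from someI_ex[OF this] show "0 \<le> radius" "f \<in> ell2 V \<Longrightarrow> E {-radius..radius} f = f"
    unfolding radius_def[symmetric] by blast+
qed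

lemma AE_scalar_measure:
  assumes f: "f \<in> ell2 V"
  shows "AE t in scalar_measure f. \<bar>t\<bar> \<le> radius"
proof (rule AE_I')
  have "E (- {-radius..radius} \<inter> {-radius..radius}) f = E (- {-radius..radius}) (E {-radius..radius} f)"
    by (rule proj_mult[OF _ _ f]) auto
  moreover have "E {} f = (\<lambda>_. 0)" using pvm f by (simp add: projection_valued_measure_def)
  ultimately have "E (- {-radius..radius}) f = (\<lambda>_. 0)" using radius(2)[OF f] by simp
  then show "- {-radius..radius} \<in> null_sets (scalar_measure f)"
    by (intro null_setsI) (simp_all add: emeasure_scalar_measure f sets_scalar_measure ell2_norm2_def)
qed auto

definition form :: "('v \<Rightarrow> complex) \<Rightarrow> ('v \<Rightarrow> complex) \<Rightarrow> (real \<Rightarrow> real) \<Rightarrow> complex" where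
  "form f g h = polarize (\<lambda>f. complex_of_real (integral\<^sup>L (scalar_measure f) h)) f g"

lemma borel_functional_form:
  assumes "f \<in> ell2 V" "g \<in> ell2 V"
  shows "borel_functional radius (form f g)"
  unfolding form_def[abs_def]
  by (rule borel_functional_polarize[OF borel_functional_integral assms])
     (rule finite_scalar_measure sets_scalar_measure AE_scalar_measure, assumption?)+

lemma form_indicator:
  assumes fg: "f \<in> ell2 V" "g \<in> ell2 V" and B: "B \<in> sets borel"
  shows "form f g (indicator B) = ell2_inner V (E B f) g"
  unfolding form_def polarize_inner[OF proj_linear[OF B] fg, symmetric]
  by (rule polarize_cong[OF _ fg])
     (simp add: proj_inner_self B measure_scalar_measure space_scalar_measure)

lemma form_id:
  assumes fg: "f \<in> ell2 V" "g \<in> ell2 V"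
  shows "form f g (clamp_to radius) = ell2_inner V (T f) g"
  unfolding form_def polarize_inner[OF linear fg, symmetric]
proof (rule polarize_cong[OF _ fg])
  fix f assume f: "f \<in> ell2 V"
  note [measurable_cong] = sets_scalar_measure[of f]
  have "integral\<^sup>L (scalar_measure f) (clamp_to radius) = (LINT t|scalar_measure f. t)"
  proof (rule integral_cong_AE)
    show "AE t in scalar_measure f. clamp_to radius t = t"
      using AE_scalar_measure[OF f] by eventually_elim (simp add: clamp_to_id)
  qed measurable
  then show "complex_of_real (integral\<^sup>L (scalar_measure f) (clamp_to radius)) = ell2_inner V (T f) f"
    using spectral f by (simp add: is_spectral_measure_def)
qed

text \<open>Tested on \<open>indicator C\<close>: symmetry moves \<open>E C\<close> to
  \<open>g\<close>, the first-moment identity applies to the pair \<open>f\<close>,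
  \<open>E C g\<close>, and multiplicativity of \<open>E\<close> absorbs \<open>E C\<close> into the
  integrand. Commutation of \<open>T\<close> with \<open>E C\<close> is nowhere presupposed.\<close>

lemma form_mult_clamp:
  assumes f: "f \<in> ell2 V" and g: "g \<in> ell2 V" and h: "h \<in> bounded_borel"
  shows "form (T f) g h = form f g (\<lambda>t. clamp_to radius t * h t)"
proof (rule borel_functional_eq_indicators[OF _ _ _ h])
  note Tf = ell2_linear_maps[OF linear f] and clamp = bounded_borel_clamp[OF radius(1)]
  show "borel_functional radius (form (T f) g)" by (rule borel_functional_form[OF Tf g])
  show "borel_functional radius (\<lambda>h. form f g (\<lambda>t. clamp_to radius t * h t))"
    by (intro borel_functional_mult borel_functional_form f g clamp)
  fix C :: "real set" assume C: "C \<in> sets borel"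
  note Cg = proj_maps[OF C g]
  have "form f (E C g) (clamp_to radius) = form f g (\<lambda>t. indicator C t * clamp_to radius t)"
  proof (rule borel_functional_eq_indicators[OF borel_functional_form[OF f Cg] _ _ clamp])
    show "borel_functional radius (\<lambda>h. form f g (\<lambda>t. indicator C t * h t))"
      by (intro borel_functional_mult borel_functional_form f g bounded_borel_indicator C)
    fix B :: "real set" assume B: "B \<in> sets borel"
    have "(\<lambda>t. indicator C t * indicator B t :: real) = indicator (C \<inter> B)"
      by (auto simp: indicator_def)
    then have "form f g (\<lambda>t. indicator C t * indicator B t) = form f g (indicator (C \<inter> B))"
      by simp
    also have "\<dots> = ell2_inner V (E C (E B f)) g"
      using B C by (simp add: form_indicator f g proj_mult)
    also have "\<dots> = form f (E C g) (indicator B)"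
      using B C by (simp add: form_indicator f Cg proj_symmetric g proj_maps)
    finally show "form f (E C g) (indicator B) = form f g (\<lambda>t. indicator C t * indicator B t)" ..
  qed
  then show "form (T f) g (indicator C) = form f g (\<lambda>t. clamp_to radius t * indicator C t)"
    by (simp add: form_indicator form_id Tf f g C Cg proj_symmetric mult.commute)
qed

lemma form_moments:
  assumes f: "f \<in> ell2 V" and g: "g \<in> ell2 V"
  shows "form f g (\<lambda>t. clamp_to radius t ^ n) = ell2_inner V ((T ^^ n) f) g"
  using f
proof (induction n arbitrary: f)
  case 0
  have "E UNIV f = f" using pvm 0 by (simp add: projection_valued_measure_def)
  then show ?case using form_indicator[OF 0 g, of UNIV] by (simp add: indicator_def[abs_def])
next
  case (Suc n)
  show ?case
    using Suc.IH[OF ell2_linear_maps[OF linear Suc.prems]]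
      form_mult_clamp[OF Suc.prems g bounded_borel_clamp_power[OF radius(1), of n]]
    by (simp add: funpow_swap1)
qed

theorem scalar_measure_moments:
  assumes f: "f \<in> ell2 V"
  shows "(LINT t|scalar_measure f. t ^ n) = Re (ell2_inner V ((T ^^ n) f) f)"
proof -
  note [measurable_cong] = sets_scalar_measure[of f]
  let ?h = "\<lambda>t. clamp_to radius t ^ n"
  have J: "borel_functional radius (\<lambda>h. complex_of_real (integral\<^sup>L (scalar_measure f) h))"
    by (intro borel_functional_integral finite_scalar_measure sets_scalar_measure AE_scalar_measure f)
  have "complex_of_real (integral\<^sup>L (scalar_measure f) ?h) = form f f ?h"
  proof (rule borel_functional_eq_indicators[OF J borel_functional_form[OF f f]
        _ bounded_borel_clamp_power[OF radius(1)]])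
    fix B :: "real set" assume "B \<in> sets borel"
    then show "complex_of_real (integral\<^sup>L (scalar_measure f) (indicator B)) = form f f (indicator B)"
      by (simp add: form_indicator f proj_inner_self measure_scalar_measure space_scalar_measure)
  qed
  moreover have "(LINT t|scalar_measure f. t ^ n) = integral\<^sup>L (scalar_measure f) ?h"
  proof (rule integral_cong_AE)
    show "AE t in scalar_measure f. t ^ n = ?h t"
      using AE_scalar_measure[OF f] by eventually_elim (simp add: clamp_to_id)
  qed measurable
  ultimately show ?thesis using form_moments[OF f f, of n] by (metis Re_complex_of_real)
qed

end

section \<open>Eigenvalue counting for symmetric operators in finite dimension\<close>

interpretation fun_space: vector_space "fun_scale :: complex \<Rightarrow> ('v \<Rightarrow> complex) \<Rightarrow> _"
  by (rule vector_space_fun_scale)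

lemma sum_fun_apply: "(\<Sum>i\<in>I. F i) x = (\<Sum>i\<in>I. F i x :: complex)"
  by (induction I rule: infinite_finite_induct) auto

lemma sum_fun_scale: "(\<Sum>i\<in>I. fun_scale (c i) (F i)) = (\<lambda>x. \<Sum>i\<in>I. c i * F i x)"
  by (simp add: fun_eq_iff sum_fun_apply fun_scale_def)

lemma ell2_finite: "finite V \<Longrightarrow> f \<in> ell2 V \<longleftrightarrow> (\<forall>x. x \<notin> V \<longrightarrow> f x = 0)"
  by (auto simp: ell2_def)

lemma ell2_eq_sum_dirac:
  assumes "finite V" "f \<in> ell2 V"
  shows "f = (\<lambda>y. \<Sum>x\<in>V. f x * dirac_function x y)"
proof
  fix y
  show "f y = (\<Sum>x\<in>V. f x * dirac_function x y)"
    using assms by (auto simp: dirac_function_def ell2_finite if_distrib[of "(*) _"] cong: if_cong)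
qed

lemma ell2_sum:
  assumes "\<And>i. i \<in> I \<Longrightarrow> F i \<in> ell2 V"
  shows "(\<lambda>x. \<Sum>i\<in>I. c i * F i x) \<in> ell2 V"
  using assms
proof (induction I rule: infinite_finite_induct)
  case (insert i I)
  then show ?case using ell2_lincomb[of "F i" V "\<lambda>x. \<Sum>i\<in>I. c i * F i x" "c i" 1] by simp
qed (simp_all add: ell2_zero)

lemma ell2_inner_sum_left:
  assumes "\<And>i. i \<in> I \<Longrightarrow> F i \<in> ell2 V" "g \<in> ell2 V"
  shows "ell2_inner V (\<lambda>x. \<Sum>i\<in>I. c i * F i x) g = (\<Sum>i\<in>I. c i * ell2_inner V (F i) g)"
  using assms
proof (induction I rule: infinite_finite_induct)
  case (insert i I)
  then show ?case
    using ell2_inner_lincomb_left[of "F i" V "\<lambda>x. \<Sum>i\<in>I. c i * F i x" g "c i" 1] ell2_sum[of I F V c] by simp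
qed (simp_all add: ell2_inner_def)

lemma ell2_linear_sum:
  assumes A: "ell2_linear V A" and "\<And>i. i \<in> I \<Longrightarrow> F i \<in> ell2 V"
  shows "A (\<lambda>x. \<Sum>i\<in>I. c i * F i x) = (\<lambda>x. \<Sum>i\<in>I. c i * A (F i) x)"
proof -
  have zero: "A (\<lambda>x. 0) = (\<lambda>x. 0)"
    using ell2_linear_lincomb[OF A ell2_zero ell2_zero, of 0 0] by simp
  show ?thesis
    using assms(2)
  proof (induction I rule: infinite_finite_induct)
    case (insert i I)
    then show ?case
      using ell2_linear_lincomb[OF A, of "F i" "\<lambda>x. \<Sum>i\<in>I. c i * F i x" "c i" 1] ell2_sum[of I F V c] by simp
  qed (simp_all add: zero)
qed

text \<open>
  If the vectors \<open>e x\<close> are the images of the Dirac functions under a projection onto \<open>W\<close>, the left-hand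
  side is the trace of that projection.
\<close>

lemma trace_eq_dim:
  assumes V: "finite V" and W: "fun_space.subspace W" and e: "\<And>x. x \<in> V \<Longrightarrow> e x \<in> W"
    and repr: "\<And>f. f \<in> W \<Longrightarrow> f = (\<lambda>y. \<Sum>x\<in>V. f x * e x y)"
  shows "(\<Sum>x\<in>V. e x x) = of_nat (fun_space.dim W)"
proof -
  obtain B where B: "B \<subseteq> W" "fun_space.independent B" "W \<subseteq> fun_space.span B" "card B = fun_space.dim W"
    by (rule fun_space.basis_exists)
  have repr': "f = (\<Sum>x\<in>V. fun_scale (f x) (e x))" if "f \<in> W" for f
    unfolding sum_fun_scale by (rule repr[OF that])
  have "W \<subseteq> fun_space.span (e ` V)"
  proof
    fix f assume "f \<in> W"
    then have "f = (\<Sum>x\<in>V. fun_scale (f x) (e x))" by (rule repr')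
    also have "\<dots> \<in> fun_space.span (e ` V)"
      by (intro fun_space.span_sum fun_space.span_scale fun_space.span_base) auto
    finally show "f \<in> fun_space.span (e ` V)" .
  qed
  then have fin: "finite B"
    using fun_space.independent_span_bound[of "e ` V" B] V B(1,2) by blast
  have WB: "fun_space.span B = W"
    using B(1,3) fun_space.span_minimal[OF B(1) W] by blast
  let ?r = "fun_space.representation B"
  have "(\<Sum>x\<in>V. e x x) = (\<Sum>x\<in>V. \<Sum>b\<in>B. ?r (e x) b * b x)"
  proof (rule sum.cong[OF refl])
    fix x assume "x \<in> V"
    then have "(\<Sum>b\<in>B. fun_scale (?r (e x) b) b) = e x"
      using e WB by (intro fun_space.sum_representation_eq[OF B(2)] fin) auto
    from fun_cong[OF this, of x] show "e x x = (\<Sum>b\<in>B. ?r (e x) b * b x)"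
      by (simp add: sum_fun_scale)
  qed
  also have "\<dots> = (\<Sum>b\<in>B. \<Sum>x\<in>V. b x * ?r (e x) b)"
    by (subst sum.swap) (simp add: mult.commute)
  also have "\<dots> = (\<Sum>b\<in>B. 1)"
  proof (rule sum.cong[OF refl])
    \<comment> \<open>The coordinate of \<open>b\<close> at itself is 1. Expanding \<open>b\<close>
      through \<open>repr\<close> writes this 1 as the sum over \<open>x\<close>, so each basis
      vector contributes 1 to the trace.\<close>
    fix b assume b: "b \<in> B"
    have "?r b = ?r (\<Sum>x\<in>V. fun_scale (b x) (e x))"
      using b B(1) by (intro arg_cong[of _ _ ?r] repr') auto
    also have "\<dots> = (\<lambda>c. \<Sum>x\<in>V. ?r (fun_scale (b x) (e x)) c)"
      by (intro fun_space.representation_sum[OF B(2)] fun_space.span_scale) (use e WB in auto)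
    also have "\<dots> = (\<lambda>c. \<Sum>x\<in>V. b x * ?r (e x) c)"
      by (intro ext sum.cong refl) (use e WB in \<open>auto simp: fun_space.representation_scale[OF B(2)]\<close>)
    finally show "(\<Sum>x\<in>V. b x * ?r (e x) b) = 1"
      using fun_space.representation_basis[OF B(2) b] by (metis)
  qed
  finally show ?thesis using B(4) by simp
qed

locale finite_contraction = ell2_contraction V T for V :: "'v set" and T +
  assumes finite_V: "finite V"
begin

section \<open>Polynomials in the operator\<close>

lemma T_zero: "T (\<lambda>x. 0) = (\<lambda>x. 0)"
  using ell2_linear_lincomb[OF linear ell2_zero ell2_zero, of 0 0] by simp

text \<open>Horner evaluation of \<open>p\<close> at \<open>T\<close>, applied to \<open>g\<close>.
  The inert factor 1 gives every step the shape of \<open>ell2_lincomb\<close>.\<close>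

definition poly_op :: "complex poly \<Rightarrow> ('v \<Rightarrow> complex) \<Rightarrow> 'v \<Rightarrow> complex" where
  "poly_op p g = fold_coeffs (\<lambda>a h x. a * g x + 1 * T h x) p (\<lambda>x. 0)"

lemma poly_op_0: "poly_op 0 g = (\<lambda>x. 0)"
  by (simp add: poly_op_def)

lemma poly_op_pCons: "poly_op (pCons a p) g = (\<lambda>x. a * g x + 1 * T (poly_op p g) x)"
proof (cases "a = 0 \<and> p = 0")
  \<comment> \<open>\<open>pCons 0 0\<close> is the zero polynomial, on which the fold makes no
    step.\<close>
  case True then show ?thesis by (simp add: poly_op_0 T_zero)
next
  case False
  then have "fold_coeffs f (pCons a p) = f a \<circ> fold_coeffs f p" for f :: "complex \<Rightarrow> ('v \<Rightarrow> complex) \<Rightarrow> 'v \<Rightarrow> complex"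
    using fold_coeffs_pCons_coeff_not_0_eq fold_coeffs_pCons_not_0_0_eq by blast
  then show ?thesis by (simp only: poly_op_def o_apply)
qed

lemma poly_op_ell2: "g \<in> ell2 V \<Longrightarrow> poly_op p g \<in> ell2 V"
  by (induction p) (simp_all only: poly_op_0 poly_op_pCons ell2_zero ell2_lincomb maps)

lemma poly_op_lincomb:
  assumes g: "g \<in> ell2 V"
  shows "poly_op (smult c p + smult d q) g = (\<lambda>x. c * poly_op p g x + d * poly_op q g x)"
proof (induction p q rule: poly_induct2)
  case 0 then show ?case by (simp add: poly_op_0)
next
  case (pCons a p b q)
  have "smult c (pCons a p) + smult d (pCons b q) = pCons (c * a + d * b) (smult c p + smult d q)"
    by simp
  then show ?case
    by (simp only: poly_op_pCons pCons ell2_linear_lincomb[OF linear] poly_op_ell2 g) (simp add: algebra_simps)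
qed

lemma poly_op_linear:
  assumes g: "g \<in> ell2 V" "h \<in> ell2 V"
  shows "poly_op p (\<lambda>x. a * g x + b * h x) = (\<lambda>x. a * poly_op p g x + b * poly_op p h x)"
proof (induction p)
  case 0 then show ?case by (simp add: poly_op_0)
next
  case (pCons c p)
  show ?case
    by (simp only: poly_op_pCons pCons.IH ell2_linear_lincomb[OF linear] poly_op_ell2 g) (simp add: algebra_simps)
qed

lemma poly_op_eigenvector:
  assumes g: "g \<in> ell2 V" and eig: "T g = (\<lambda>x. z * g x)"
  shows "poly_op p g = (\<lambda>x. poly p z * g x)"
proof (induction p)
  case 0 then show ?case by (simp add: poly_op_0)
next
  case (pCons c p)
  have "T (\<lambda>x. poly p z * g x + 0 * g x) = (\<lambda>x. poly p z * T g x + 0 * T g x)"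
    by (rule ell2_linear_lincomb[OF linear g g])
  then show ?case by (simp add: poly_op_pCons pCons.IH eig algebra_simps)
qed

lemma poly_op_linear_factor:
  assumes g: "g \<in> ell2 V"
  shows "poly_op ([:- z, 1:] * q) g = (\<lambda>x. T (poly_op q g) x - z * poly_op q g x)"
proof -
  have "[:- z, 1:] * q = smult 1 (pCons 0 q) + smult (- z) q" by simp
  then have "poly_op ([:- z, 1:] * q) g = poly_op (smult 1 (pCons 0 q) + smult (- z) q) g"
    by (simp only:)
  also have "\<dots> = (\<lambda>x. T (poly_op q g) x - z * poly_op q g x)"
    unfolding poly_op_lincomb[OF g] by (simp add: poly_op_pCons)
  finally show ?thesis .
qed

lemma poly_op_monom: "g \<in> ell2 V \<Longrightarrow> poly_op (monom c i) g = (\<lambda>x. c * (T ^^ i) g x)"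
proof (induction i)
  case 0 then show ?case by (simp add: monom_0 poly_op_pCons poly_op_0 T_zero)
next
  case (Suc i)
  have "T (\<lambda>x. c * (T ^^ i) g x + 0 * g x) = (\<lambda>x. c * T ((T ^^ i) g) x + 0 * T g x)"
    by (rule ell2_linear_lincomb[OF linear pow_maps[OF Suc.prems] Suc.prems])
  with Suc show ?case by (simp add: monom_Suc poly_op_pCons)
qed

lemma poly_op_sum:
  assumes "g \<in> ell2 V" "finite I"
  shows "poly_op (\<Sum>i\<in>I. p i) g = (\<lambda>x. \<Sum>i\<in>I. poly_op (p i) g x)"
  using assms(2)
proof (induction I rule: finite_induct)
  case empty then show ?case by (simp add: poly_op_0)
next
  case (insert i I)
  then show ?case using poly_op_lincomb[OF assms(1), of 1 "p i" 1 "\<Sum>i\<in>I. p i"] by simp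
qed

text \<open>The vectors \<open>g\<close>, \<open>T g\<close>, ..., \<open>T^N g\<close> with
  \<open>N = card V\<close> are one more than the dimension allows.\<close>

lemma annihilating_poly:
  assumes g: "g \<in> ell2 V"
  obtains p where "p \<noteq> 0" "poly_op p g = (\<lambda>x. 0)"
proof -
  define F where "F i = (T ^^ i) g" for i
  have F: "F i \<in> ell2 V" for i unfolding F_def by (rule pow_maps[OF g])
  let ?N = "card V"
  have "\<exists>c. (\<exists>i\<le>?N. c i \<noteq> 0) \<and> (\<forall>x. (\<Sum>i\<le>?N. c i * F i x) = 0)"
  proof (cases "inj_on F {..?N}")
    case True
    have "F ` {..?N} \<subseteq> fun_space.span (dirac_function ` V)"
    proof
      fix f assume "f \<in> F ` {..?N}"
      then have "f \<in> ell2 V" using F by auto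
      then have "f = (\<Sum>x\<in>V. fun_scale (f x) (dirac_function x))"
        unfolding sum_fun_scale by (rule ell2_eq_sum_dirac[OF finite_V])
      also have "\<dots> \<in> fun_space.span (dirac_function ` V)"
        by (intro fun_space.span_sum fun_space.span_scale fun_space.span_base) auto
      finally show "f \<in> fun_space.span (dirac_function ` V)" .
    qed
    moreover have "card (dirac_function ` V) < card (F ` {..?N})"
      using card_image_le[OF finite_V, of dirac_function] card_image[OF True] by simp
    ultimately have "fun_space.dependent (F ` {..?N})"
      using fun_space.independent_span_bound[of "dirac_function ` V" "F ` {..?N}"] finite_V by force
    then obtain u where u: "\<exists>v\<in>F ` {..?N}. u v \<noteq> 0" "(\<Sum>v\<in>F ` {..?N}. fun_scale (u v) v) = 0"
      using fun_space.dependent_finite[of "F ` {..?N}"] by auto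
    have "(\<Sum>i\<le>?N. fun_scale (u (F i)) (F i)) = 0"
      using u(2) by (simp add: sum.reindex[OF True])
    then have "(\<Sum>i\<le>?N. u (F i) * F i x) = 0" for x
      by (metis (no_types, lifting) fun_scale_def sum.cong sum_fun_apply zero_fun_apply)
    then show ?thesis using u(1) by (intro exI[of _ "\<lambda>i. u (F i)"]) auto
  next
    \<comment> \<open>Dependence is a property of sets and does not see a repeated vector; two equal
      powers give the relation directly.\<close>
    case False
    then obtain i j where ij: "i \<le> ?N" "j \<le> ?N" "F i = F j" "i \<noteq> j" by (auto simp: inj_on_def)
    define c :: "nat \<Rightarrow> complex" where "c k = (if k = i then 1 else 0) - (if k = j then 1 else 0)" for k
    have "(\<Sum>k\<le>?N. c k * F k x) = 0" for x
    proof -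
      have "(\<Sum>k\<le>?N. c k * F k x) = (\<Sum>k\<le>?N. if k = i then F k x else 0) - (\<Sum>k\<le>?N. if k = j then F k x else 0)"
        unfolding sum_subtractf[symmetric] by (rule sum.cong) (auto simp: c_def)
      then show ?thesis using ij by simp
    qed
    moreover have "c i \<noteq> 0" using ij by (simp add: c_def)
    ultimately show ?thesis using ij by blast
  qed
  then obtain c i where c: "i \<le> ?N" "c i \<noteq> 0" "\<And>x. (\<Sum>i\<le>?N. c i * F i x) = 0" by blast
  let ?p = "\<Sum>i\<le>?N. monom (c i) i"
  have "coeff ?p i = c i" using c(1) by (simp add: coeff_sum)
  then have "?p \<noteq> 0" using c(2) by (metis coeff_0)
  moreover have "poly_op ?p g = (\<lambda>x. 0)"
    using c(3) by (simp add: poly_op_sum[OF g] poly_op_monom[OF g] F_def)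
  ultimately show ?thesis by (rule that)
qed

section \<open>Eigenspaces and the spectral decomposition\<close>

lemma eigenspace_iff: "f \<in> eigenspace V T l \<longleftrightarrow> f \<in> ell2 V \<and> T f = (\<lambda>x. of_real l * f x)"
  by (simp add: eigenspace_def)

lemma eigenspace_ell2: "f \<in> eigenspace V T l \<Longrightarrow> f \<in> ell2 V"
  by (simp add: eigenspace_iff)

lemma eigenspace_sum:
  assumes "\<And>i. i \<in> I \<Longrightarrow> F i \<in> eigenspace V T l"
  shows "(\<lambda>x. \<Sum>i\<in>I. c i * F i x) \<in> eigenspace V T l"
  unfolding eigenspace_iff
proof
  have F: "F i \<in> ell2 V" if "i \<in> I" for i using assms[OF that] by (rule eigenspace_ell2)
  then show "(\<lambda>x. \<Sum>i\<in>I. c i * F i x) \<in> ell2 V" by (rule ell2_sum)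
  have "T (\<lambda>x. \<Sum>i\<in>I. c i * F i x) = (\<lambda>x. \<Sum>i\<in>I. c i * T (F i) x)"
    by (rule ell2_linear_sum[OF linear F])
  also have "\<dots> = (\<lambda>x. of_real l * (\<Sum>i\<in>I. c i * F i x))"
    using assms by (auto simp: eigenspace_iff sum_distrib_left mult.left_commute intro!: sum.cong)
  finally show "T (\<lambda>x. \<Sum>i\<in>I. c i * F i x) = (\<lambda>x. of_real l * (\<Sum>i\<in>I. c i * F i x))" .
qed

lemma eigenspace_lincomb:
  assumes "f \<in> eigenspace V T l" "g \<in> eigenspace V T l"
  shows "(\<lambda>x. a * f x + b * g x) \<in> eigenspace V T l"
  using eigenspace_sum[of "{True, False}" "\<lambda>i. if i then f else g" l "\<lambda>i. if i then a else b"] assms by simp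

lemma eigenspace_zero: "(\<lambda>x. 0) \<in> eigenspace V T l"
  by (simp add: eigenspace_iff ell2_zero T_zero)

text \<open>\<open><T h, h>\<close> is real and equals \<open>z * ||h||^2\<close>. Roots of
  annihilating polynomials are found over the complex numbers, while \<open>eigenspace\<close> is
  indexed by reals.\<close>

lemma eigenvector_real:
  assumes h: "h \<in> ell2 V" and eig: "T h = (\<lambda>x. z * h x)" and "h \<noteq> (\<lambda>x. 0)"
  shows "z \<in> \<real>"
proof -
  have "z * of_real (ell2_norm2 V h) = ell2_inner V (T h) h"
    by (simp add: eig ell2_inner_scale_left h ell2_inner_self)
  also have "\<dots> = of_real (Re (ell2_inner V (T h) h))"
    using pow_inner_real[OF h, of 1] by simp
  finally have eq: "z * of_real (ell2_norm2 V h) = of_real (Re (ell2_inner V (T h) h))" .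
  moreover have "ell2_norm2 V h \<noteq> 0" using ell2_norm2_eq_0[OF h] assms(3) by auto
  ultimately have "z = of_real (Re (ell2_inner V (T h) h) / ell2_norm2 V h)"
    by (simp add: field_simps)
  then show ?thesis by (metis Reals_of_real)
qed

lemma eigenspaces_orthogonal:
  assumes f: "f \<in> eigenspace V T l" and g: "g \<in> eigenspace V T m" and "l \<noteq> m"
  shows "ell2_inner V f g = 0"
proof -
  have "ell2_inner V (T f) g = ell2_inner V f (T g)"
    using f g by (intro symmetric) (auto simp: eigenspace_iff)
  then have "of_real l * ell2_inner V f g = of_real m * ell2_inner V f g"
    using f g by (simp add: eigenspace_iff ell2_inner_scale_left ell2_inner_scale_right)
  with \<open>l \<noteq> m\<close> show ?thesis by simp
qed

text \<open>A factorisation \<open>p = (X - z) q\<close> puts \<open>h = q(T) g\<close> into the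
  kernel of \<open>T - z\<close>. If \<open>h = 0\<close>, the induction hypothesis applies to
  \<open>q\<close>; otherwise subtracting \<open>h / q(z)\<close> from \<open>g\<close> leaves a
  vector annihilated by \<open>q\<close>.\<close>

lemma eigen_decomposition_poly:
  assumes "p \<noteq> 0" "g \<in> ell2 V" "poly_op p g = (\<lambda>x. 0)"
  shows "\<exists>L e. finite L \<and> (\<forall>l. e l \<in> eigenspace V T l) \<and> g = (\<lambda>x. \<Sum>l\<in>L. e l x)"
  using assms
proof (induction "degree p" arbitrary: p g rule: less_induct)
  case less
  show ?case
  proof (cases "degree p = 0")
    case True
    then obtain c where "p = [:c:]" "c \<noteq> 0" using less.prems(1) by (metis degree_eq_zeroE pCons_0_0)
    then have "g = (\<lambda>x. 0)" using less.prems(3) by (auto simp: poly_op_pCons poly_op_0 T_zero fun_eq_iff)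
    then show ?thesis by (intro exI[of _ "{}"] exI[of _ "\<lambda>_ _. 0"]) (simp add: eigenspace_zero)
  next
    case False
    then have "\<exists>z. poly p z = 0"
      using fundamental_theorem_of_algebra[of p] by (simp add: constant_degree)
    then obtain z q where q: "p = [:- z, 1:] * q" by (metis dvdE poly_eq_0_iff_dvd)
    then have q0: "q \<noteq> 0" and deg: "degree q < degree p"
      using less.prems(1) by (auto simp: degree_mult_eq simp del: mult_pCons_left)
    note g = less.prems(2)
    define h where "h = poly_op q g"
    have h: "h \<in> ell2 V" unfolding h_def by (rule poly_op_ell2[OF g])
    have "(\<lambda>x. T h x - z * h x) = (\<lambda>x. 0)"
      using less.prems(3) unfolding q h_def poly_op_linear_factor[OF g] .
    then have Th: "T h = (\<lambda>x. z * h x)" by (auto simp: fun_eq_iff)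
    show ?thesis
    proof (cases "h = (\<lambda>x. 0)")
      case True
      then show ?thesis by (intro less.hyps[OF deg q0 g]) (simp add: h_def)
    next
      case False
      then obtain a where a: "z = of_real a" using eigenvector_real[OF h Th] by (auto elim: Reals_cases)
      \<comment> \<open>A double root would put \<open>h\<close> into the range of
        \<open>T - z\<close> as well as into its kernel; for symmetric \<open>T\<close> and real
        \<open>z\<close> these are orthogonal.\<close>
      have "poly q z \<noteq> 0"
      proof
        assume "poly q z = 0"
        then obtain s where s: "q = [:- z, 1:] * s" by (metis dvdE poly_eq_0_iff_dvd)
        define k where "k = poly_op s g"
        have k: "k \<in> ell2 V" unfolding k_def by (rule poly_op_ell2[OF g])
        have hk: "h = (\<lambda>x. 1 * T k x + (- z) * k x)"
          unfolding h_def s poly_op_linear_factor[OF g] k_def by simp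
        have "ell2_inner V h h = 1 * ell2_inner V h (T k) + cnj (- z) * ell2_inner V h k"
          by (subst (2) hk) (simp add: ell2_inner_lincomb_right[OF maps[OF k] k h, of 1 "- z", simplified])
        also have "ell2_inner V h (T k) = ell2_inner V (T h) k" by (rule symmetric[OF h k, symmetric])
        also have "\<dots> = z * ell2_inner V h k" unfolding Th by (rule ell2_inner_scale_left[OF h k])
        finally have "ell2_norm2 V h = 0" by (simp add: a ell2_inner_self)
        with False show False using ell2_norm2_eq_0[OF h] by auto
      qed
      define g' where "g' = (\<lambda>x. 1 * g x + (- 1 / poly q z) * h x)"
      have g': "g' \<in> ell2 V" unfolding g'_def by (rule ell2_lincomb[OF g h])
      have "poly_op q g' = (\<lambda>x. 0)"
        unfolding g'_def poly_op_linear[OF g h] poly_op_eigenvector[OF h Th]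
        using \<open>poly q z \<noteq> 0\<close> by (simp add: h_def)
      from less.hyps[OF deg q0 g' this] obtain L e where
        L: "finite L" "\<And>l. e l \<in> eigenspace V T l" "g' = (\<lambda>x. \<Sum>l\<in>L. e l x)" by blast
      \<comment> \<open>The eigenvalue \<open>a\<close> may already occur in \<open>L\<close>. Both
        summands are guarded so that one formula covers both cases, and \<open>h\<close> is zeroed
        off \<open>l = a\<close> so that the result lies in every eigenspace it is indexed
        by.\<close>
      define e' where "e' l = (\<lambda>x. (if l \<in> L then 1 else 0) * e l x + (if l = a then 1 / poly q z else 0) * (if l = a then h x else 0))" for l
      have "(\<lambda>x. if l = a then h x else 0) \<in> eigenspace V T l" for l
        using h Th by (cases "l = a") (simp_all add: eigenspace_zero eigenspace_iff a)
      then have "e' l \<in> eigenspace V T l" for l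
        unfolding e'_def by (intro eigenspace_lincomb L)
      moreover have "g x = (\<Sum>l\<in>insert a L. e' l x)" for x
      proof -
        have "(\<Sum>l\<in>insert a L. e' l x) = (\<Sum>l\<in>insert a L. if l \<in> L then e l x else 0)
            + (\<Sum>l\<in>insert a L. if l = a then h x / poly q z else 0)"
          unfolding sum.distrib[symmetric] by (rule sum.cong) (auto simp: e'_def)
        also have "(\<Sum>l\<in>insert a L. if l \<in> L then e l x else 0) = (\<Sum>l\<in>L. if l \<in> L then e l x else 0)"
          by (rule sum.mono_neutral_right) (use L in auto)
        also have "\<dots> = g' x" using L(3) by simp
        also have "(\<Sum>l\<in>insert a L. if l = a then h x / poly q z else 0) = h x / poly q z"
          using L(1) by simp
        finally show ?thesis by (simp add: g'_def)
      qed
      ultimately show ?thesis using L(1) by (intro exI[of _ "insert a L"] exI[of _ e']) auto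
    qed
  qed
qed

text \<open>An eigenvalue absent from the decompositions of all Dirac functions would have an
  eigenvector orthogonal to each of them, hence zero; so there are finitely many.\<close>

lemma eigen_decomposition:
  "finite (eigenvalues V T) \<and> (\<exists>e. \<forall>x\<in>V. (\<forall>l. e x l \<in> eigenspace V T l) \<and>
    dirac_function x = (\<lambda>y. \<Sum>l\<in>eigenvalues V T. e x l y))"
proof -
  have "\<exists>L e. finite L \<and> (\<forall>l. e l \<in> eigenspace V T l) \<and> dirac_function x = (\<lambda>y. \<Sum>l\<in>L. e l y)"
    if "x \<in> V" for x
    using annihilating_poly[OF ell2_dirac[OF that]] eigen_decomposition_poly ell2_dirac[OF that] by metis
  then obtain L e where L: "\<And>x. x \<in> V \<Longrightarrow> finite (L x)" "\<And>x l. x \<in> V \<Longrightarrow> e x l \<in> eigenspace V T l"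
    "\<And>x. x \<in> V \<Longrightarrow> dirac_function x = (\<lambda>y. \<Sum>l\<in>L x. e x l y)" by metis
  define K where "K = (\<Union>x\<in>V. L x)"
  have K: "finite K" unfolding K_def using finite_V L(1) by auto
  have sub: "eigenvalues V T \<subseteq> K"
  proof
    fix l assume "l \<in> eigenvalues V T"
    then obtain f where f: "f \<in> eigenspace V T l" "f \<noteq> (\<lambda>_. 0)" by (auto simp: eigenvalues_def)
    show "l \<in> K"
    proof (rule ccontr)
      assume l: "l \<notin> K"
      have "f x = 0" if x: "x \<in> V" for x
      proof -
        have "ell2_inner V (\<lambda>y. \<Sum>m\<in>L x. 1 * e x m y) f = (\<Sum>m\<in>L x. 1 * ell2_inner V (e x m) f)"
          using L(2) x f by (intro ell2_inner_sum_left eigenspace_ell2)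
        also have "\<dots> = 0"
          using l x L(2) f(1) by (intro sum.neutral) (auto simp: K_def intro!: eigenspaces_orthogonal)
        finally have "ell2_inner V (dirac_function x) f = 0" using L(3)[OF x] by simp
        then show ?thesis using ell2_inner_dirac[OF x, of f] ell2_inner_commute[of V f "dirac_function x"] by simp
      qed
      moreover have "f x = 0" if "x \<notin> V" for x
        using that f eigenspace_ell2 by (auto simp: ell2_def)
      ultimately show False using f(2) by blast
    qed
  qed
  \<comment> \<open>The sum over a single index and the factor 0 or 1 bring the cut-off into the
    form of \<open>eigenspace_sum\<close>.\<close>
  define e' where "e' x l = (\<lambda>y. \<Sum>i\<in>{()}. (if l \<in> L x then 1 else 0) * e x l y)" for x l
  have e': "e' x l \<in> eigenspace V T l" if "x \<in> V" for x l
    unfolding e'_def using L(2)[OF that] by (intro eigenspace_sum)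
  show ?thesis
  proof (intro conjI exI[of _ e'] ballI allI)
    show "finite (eigenvalues V T)" using sub K finite_subset by blast
    show "e' x l \<in> eigenspace V T l" if "x \<in> V" for x l by (rule e'[OF that])
    show "dirac_function x = (\<lambda>y. \<Sum>l\<in>eigenvalues V T. e' x l y)" if x: "x \<in> V" for x
    proof
      fix y
      have "(\<Sum>l\<in>eigenvalues V T. e' x l y) = (\<Sum>l\<in>K. e' x l y)"
      proof (rule sum.mono_neutral_left[OF K sub], rule ballI)
        fix l assume "l \<in> K - eigenvalues V T"
        then have "e' x l = (\<lambda>_. 0)" using e'[OF x, of l] by (auto simp: eigenvalues_def)
        then show "e' x l y = 0" by simp
      qed
      also have "\<dots> = (\<Sum>l\<in>L x. e' x l y)"
        by (rule sum.mono_neutral_right[OF K]) (use x in \<open>auto simp: K_def e'_def\<close>)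
      also have "\<dots> = dirac_function x y" using L(3)[OF x] by (simp add: e'_def)
      finally show "dirac_function x y = (\<Sum>l\<in>eigenvalues V T. e' x l y)" ..
    qed
  qed
qed

section \<open>Multiplicities, traces and the counting measure\<close>

lemma subspace_eigenspace: "fun_space.subspace (eigenspace V T l)"
proof (rule fun_space.subspaceI)
  show "0 \<in> eigenspace V T l" using eigenspace_zero by (simp add: zero_fun_def)
  show "f + g \<in> eigenspace V T l" if "f \<in> eigenspace V T l" "g \<in> eigenspace V T l" for f g
    using eigenspace_lincomb[OF that, of 1 1] by (simp add: plus_fun_def)
  show "fun_scale c f \<in> eigenspace V T l" if "f \<in> eigenspace V T l" for c f
    using eigenspace_lincomb[OF that that, of c 0] by (simp add: fun_scale_def)
qed

text \<open>The component \<open>e x l\<close> is the image of the Dirac function at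
  \<open>x\<close> under the projection onto the eigenspace of \<open>l\<close>, so
  \<open>trace_eq_dim\<close> identifies the diagonal sum of these components with the
  multiplicity.\<close>

theorem trace_formula:
  "(\<Sum>x\<in>V. (T ^^ n) (dirac_function x) x)
      = (\<Sum>l\<in>eigenvalues V T. of_nat (eigenvalue_multiplicity V T l) * of_real l ^ n)"
proof -
  obtain e where fin: "finite (eigenvalues V T)" and e: "\<And>x l. x \<in> V \<Longrightarrow> e x l \<in> eigenspace V T l"
    and dec: "\<And>x. x \<in> V \<Longrightarrow> dirac_function x = (\<lambda>y. \<Sum>l\<in>eigenvalues V T. e x l y)"
    using eigen_decomposition by blast
  let ?\<Lambda> = "eigenvalues V T"
  have mult: "(\<Sum>x\<in>V. e x l x) = of_nat (eigenvalue_multiplicity V T l)" if l: "l \<in> ?\<Lambda>" for l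
    unfolding eigenvalue_multiplicity_def
  proof (rule trace_eq_dim[where e = "\<lambda>x. e x l", OF finite_V subspace_eigenspace])
    show "e x l \<in> eigenspace V T l" if "x \<in> V" for x by (rule e[OF that])
    fix f assume f: "f \<in> eigenspace V T l"
    define P where "P m = (\<lambda>y. \<Sum>x\<in>V. f x * e x m y)" for m
    have P: "P m \<in> eigenspace V T m" for m unfolding P_def by (intro eigenspace_sum e)
    have f_eq: "f y = (\<Sum>m\<in>?\<Lambda>. P m y)" for y
    proof -
      have "f y = (\<Sum>x\<in>V. f x * dirac_function x y)"
        using ell2_eq_sum_dirac[OF finite_V eigenspace_ell2[OF f]] by (rule fun_cong)
      also have "\<dots> = (\<Sum>x\<in>V. \<Sum>m\<in>?\<Lambda>. f x * e x m y)"
        using dec by (intro sum.cong refl) (simp add: sum_distrib_left)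
      also have "\<dots> = (\<Sum>m\<in>?\<Lambda>. P m y)" unfolding P_def by (rule sum.swap)
      finally show ?thesis .
    qed
    \<comment> \<open>\<open>d\<close> lies in the eigenspace of \<open>l\<close> and is also the
      sum of the components for the other eigenvalues, so it is orthogonal to itself.\<close>
    define d where "d = (\<lambda>x. 1 * f x + (- 1) * P l x)"
    have d: "d \<in> eigenspace V T l" unfolding d_def by (intro eigenspace_lincomb f P)
    have "1 * f y + (- 1) * P l y = (\<Sum>m\<in>?\<Lambda> - {l}. 1 * P m y)" for y
      unfolding f_eq[of y] using sum.remove[OF fin l, of "\<lambda>m. P m y"] by simp
    then have d_eq: "d = (\<lambda>y. \<Sum>m\<in>?\<Lambda> - {l}. 1 * P m y)"
      by (simp only: d_def)
    have "ell2_inner V (\<lambda>y. \<Sum>m\<in>?\<Lambda> - {l}. 1 * P m y) d = (\<Sum>m\<in>?\<Lambda> - {l}. 1 * ell2_inner V (P m) d)"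
      by (intro ell2_inner_sum_left eigenspace_ell2[OF P] eigenspace_ell2[OF d])
    also have "\<dots> = 0" using eigenspaces_orthogonal[OF P d] by (intro sum.neutral) auto
    finally have "ell2_inner V d d = 0" unfolding d_eq[symmetric] .
    then have "d = (\<lambda>x. 0)"
      using ell2_norm2_eq_0[OF eigenspace_ell2[OF d]] by (simp add: ell2_inner_self)
    then have "f y = P l y" for y
      by (auto simp: d_def dest!: fun_cong[of _ _ y])
    then show "f = (\<lambda>y. \<Sum>x\<in>V. f x * e x l y)"
      unfolding P_def by (rule ext)
  qed
  have pow: "(T ^^ n) f = (\<lambda>x. of_real l ^ n * f x)" if f: "f \<in> eigenspace V T l" for f l
  proof (induction n)
    case (Suc n)
    have "T (\<lambda>x. of_real l ^ n * f x + 0 * f x) = (\<lambda>x. of_real l ^ n * T f x + 0 * T f x)"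
      using f by (intro ell2_linear_lincomb[OF linear] eigenspace_ell2)
    then show ?case using Suc f by (simp add: eigenspace_iff algebra_simps)
  qed simp
  have "(T ^^ n) (dirac_function x) = (\<lambda>y. \<Sum>l\<in>?\<Lambda>. of_real l ^ n * e x l y)" if x: "x \<in> V" for x
  proof -
    have "(T ^^ n) (\<lambda>y. \<Sum>l\<in>?\<Lambda>. 1 * e x l y) = (\<lambda>y. \<Sum>l\<in>?\<Lambda>. 1 * (T ^^ n) (e x l) y)"
      using x by (intro ell2_linear_sum[OF ell2_linear_funpow[OF linear]] eigenspace_ell2[OF e])
    then show ?thesis using dec[OF x] pow[OF e[OF x]] by simp
  qed
  then have "(\<Sum>x\<in>V. (T ^^ n) (dirac_function x) x) = (\<Sum>x\<in>V. \<Sum>l\<in>?\<Lambda>. of_real l ^ n * e x l x)"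
    by (intro sum.cong refl) simp
  also have "\<dots> = (\<Sum>l\<in>?\<Lambda>. of_real l ^ n * (\<Sum>x\<in>V. e x l x))"
    by (subst sum.swap) (simp add: sum_distrib_left)
  finally show "(\<Sum>x\<in>V. (T ^^ n) (dirac_function x) x)
      = (\<Sum>l\<in>?\<Lambda>. of_nat (eigenvalue_multiplicity V T l) * of_real l ^ n)"
    by (simp add: mult mult.commute)
qed

lemma eigenvalue_bound:
  assumes "l \<in> eigenvalues V T"
  shows "\<bar>l\<bar> \<le> 1"
proof -
  obtain f where f: "f \<in> ell2 V" "T f = (\<lambda>x. of_real l * f x)" "f \<noteq> (\<lambda>_. 0)"
    using assms by (auto simp: eigenvalues_def eigenspace_iff)
  have "l\<^sup>2 * ell2_norm2 V f \<le> 1 * ell2_norm2 V f"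
    using contraction[OF f(1)] unfolding f(2) ell2_norm2_scale[OF f(1)] by simp
  moreover have "0 < ell2_norm2 V f"
    using ell2_norm2_nonneg[of V f] ell2_norm2_eq_0[OF f(1)] f(3) by fastforce
  ultimately have "l\<^sup>2 \<le> 1" by (simp only: mult_le_cancel_right_pos)
  then show ?thesis by (simp add: abs_square_le_1)
qed

theorem counting_measure:
  assumes "V \<noteq> {}"
  defines "\<mu> \<equiv> measure_of UNIV (sets borel) (\<lambda>B. \<Sum>l\<in>eigenvalues V T.
    ennreal (real (eigenvalue_multiplicity V T l) / real (card V)) * emeasure (return borel l) B)"
  shows "real_distribution \<mu>" "AE t in \<mu>. \<bar>t\<bar> \<le> 1"
    "complex_of_real (LINT t|\<mu>. t ^ n) = (\<Sum>x\<in>V. (T ^^ n) (dirac_function x) x) / of_nat (card V)"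
proof -
  let ?\<Lambda> = "eigenvalues V T"
  let ?w = "\<lambda>l. real (eigenvalue_multiplicity V T l) / real (card V)"
  \<comment> \<open>\<open>measure_of\<close> gives the zero measure unless its argument is a
    measure; agreement with this push-forward supplies countable additivity.\<close>
  define N where "N = distr (point_measure ?\<Lambda> (\<lambda>l. ennreal (?w l))) borel (\<lambda>l. l)"
  have fin: "finite ?\<Lambda>" using eigen_decomposition by blast
  have card: "0 < card V" using assms finite_V by (simp add: card_gt_0_iff)
  have emeasure_N: "emeasure N B = (\<Sum>l\<in>?\<Lambda>. ennreal (?w l) * emeasure (return borel l) B)" if B: "B \<in> sets borel" for B
  proof -
    have "emeasure N B = emeasure (point_measure ?\<Lambda> (\<lambda>l. ennreal (?w l))) (B \<inter> ?\<Lambda>)"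
      unfolding N_def using B by (subst emeasure_distr) (auto simp: measurable_point_measure_eq1 space_point_measure)
    also have "\<dots> = (\<Sum>l\<in>B \<inter> ?\<Lambda>. ennreal (?w l))"
      using fin by (intro emeasure_point_measure_finite2) auto
    also have "\<dots> = (\<Sum>l\<in>?\<Lambda>. ennreal (?w l) * emeasure (return borel l) B)"
      using B fin by (intro sum.mono_neutral_cong_left) (auto simp: indicator_def)
    finally show ?thesis .
  qed
  have "\<mu> = measure_of UNIV (sets borel) (emeasure N)"
    unfolding \<mu>_def
  proof (rule measure_of_eq)
    fix B :: "real set" assume "B \<in> sigma_sets UNIV (sets borel)"
    then have "B \<in> sets borel" using sets.sigma_sets_eq[of "borel :: real measure"] by simp
    then show "(\<Sum>l\<in>?\<Lambda>. ennreal (?w l) * emeasure (return borel l) B) = emeasure N B"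
      by (simp add: emeasure_N)
  qed simp
  also have "\<dots> = N" using measure_of_of_measure[of N] by (simp add: N_def)
  finally have \<mu>N: "\<mu> = N" .
  have int: "(LINT t|N. t ^ k) = (\<Sum>l\<in>?\<Lambda>. ?w l * l ^ k)" for k
    unfolding N_def using fin
    by (subst integral_distr) (auto simp: measurable_point_measure_eq1 lebesgue_integral_point_measure_finite)
  have mom: "complex_of_real (LINT t|N. t ^ k) = (\<Sum>x\<in>V. (T ^^ k) (dirac_function x) x) / of_nat (card V)" for k
    unfolding int trace_formula by (simp add: sum_divide_distrib)
  show "complex_of_real (LINT t|\<mu>. t ^ n) = (\<Sum>x\<in>V. (T ^^ n) (dirac_function x) x) / of_nat (card V)"
    unfolding \<mu>N by (rule mom)
  \<comment> \<open>The moment of order 0 is the trace of the identity divided by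
    \<open>card V\<close>.\<close>
  have "complex_of_real (\<Sum>l\<in>?\<Lambda>. ?w l) = 1"
    using mom[of 0] card unfolding int by (simp add: dirac_function_def)
  then have "(\<Sum>l\<in>?\<Lambda>. ?w l) = 1" by (simp only: of_real_eq_1_iff)
  then have "emeasure N UNIV = 1" by (simp add: emeasure_N sum_ennreal)
  then have "prob_space N" by (intro prob_spaceI) (simp add: N_def)
  then show "real_distribution \<mu>"
    unfolding \<mu>N by (simp add: real_distribution_def real_distribution_axioms_def N_def)
  show "AE t in \<mu>. \<bar>t\<bar> \<le> 1"
    unfolding \<mu>N N_def using eigenvalue_bound
    by (subst AE_distr_iff) (auto simp: measurable_point_measure_eq1 AE_point_measure)
qed

end

section \<open>Markov operators of Schreier graphs\<close>

locale symmetric_subset = group G for G (structure) +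
  fixes S :: "'a set"
  assumes S_finite: "finite S" and S_subset: "S \<subseteq> carrier G"
    and S_symmetric: "s \<in> S \<Longrightarrow> inv s \<in> S"

text \<open>Instantiated with \<open>Q = {\<one>}\<close> for the Cayley graph and with level
  stabilizers for the finite graphs.\<close>

locale schreier_markov = symmetric_subset G S for G (structure) and S +
  fixes Q :: "'a set"
  assumes Q_subset: "Q \<subseteq> carrier G"
begin

abbreviation "V \<equiv> verts (schreier_graph G Q S)"
abbreviation "M \<equiv> markov_operator (schreier_graph G Q S)"

lemma verts_eq: "V = lcosets Q"
  by (simp add: schreier_graph_def)

lemma lcos_in_V: "g \<in> carrier G \<Longrightarrow> g <# Q \<in> V"
  by (auto simp: verts_eq LCOSETS_def)

lemma V_cases:
  assumes "v \<in> V" obtains h where "h \<in> carrier G" "v = h <# Q"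
  using assms by (auto simp: verts_eq LCOSETS_def)

lemma V_subset: "v \<in> V \<Longrightarrow> v \<subseteq> carrier G"
  by (auto elim!: V_cases dest: l_coset_subset_G[OF Q_subset])

lemma act_V: "g \<in> carrier G \<Longrightarrow> v \<in> V \<Longrightarrow> g <# v \<in> V"
  by (auto elim!: V_cases simp: lcos_m_assoc[OF Q_subset] lcos_in_V)

lemma act_mult: "g \<in> carrier G \<Longrightarrow> h \<in> carrier G \<Longrightarrow> v \<in> V \<Longrightarrow> g <# (h <# v) = (g \<otimes> h) <# v"
  by (intro lcos_m_assoc V_subset)

lemma act_one: "v \<in> V \<Longrightarrow> \<one> <# v = v"
  by (intro lcos_mult_one V_subset)

lemma bij_act: "g \<in> carrier G \<Longrightarrow> bij_betw (\<lambda>v. g <# v) V V"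
  by (rule bij_betwI[where g = "\<lambda>v. inv g <# v"]) (auto simp: act_V act_mult act_one)

text \<open>Left multiplication by a group element permutes the cosets, so
  \<open>translate g\<close> is unitary with adjoint \<open>translate (inv g)\<close>; the Markov
  operator averages such unitaries.\<close>

definition translate :: "'a \<Rightarrow> ('a set \<Rightarrow> complex) \<Rightarrow> 'a set \<Rightarrow> complex" where
  "translate g f = (\<lambda>v. if v \<in> V then f (g <# v) else 0)"

lemma markov_eq: "M f = (\<lambda>v. \<Sum>s\<in>S. 1 / of_nat (card S) * translate s f v)"
proof
  fix v
  show "M f v = (\<Sum>s\<in>S. 1 / of_nat (card S) * translate s f v)"
  proof (cases "v \<in> V")
    case True
    then obtain h where h: "h \<in> carrier G" "v = h <# Q" by (rule V_cases)
    have "M f v = 1 / of_nat (card S) * (\<Sum>s\<in>S. f ((s \<otimes> h) <# Q))"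
      unfolding h(2) by (rule markov_operator_schreier_graph[OF is_group Q_subset S_subset h(1)])
    also have "(\<Sum>s\<in>S. f ((s \<otimes> h) <# Q)) = (\<Sum>s\<in>S. translate s f v)"
      using True h S_subset by (intro sum.cong refl) (auto simp: translate_def lcos_m_assoc[OF Q_subset])
    finally show ?thesis by (simp add: sum_distrib_left)
  next
    case False then show ?thesis by (simp add: markov_operator_def translate_def)
  qed
qed

lemma translate_ell2: "g \<in> carrier G \<Longrightarrow> f \<in> ell2 V \<Longrightarrow> translate g f \<in> ell2 V"
  using summable_on_reindex_bij_betw[OF bij_act, of g "\<lambda>v. (cmod (f v))\<^sup>2"]
  by (auto simp: ell2_def translate_def cong: summable_on_cong)

lemma translate_norm2: "g \<in> carrier G \<Longrightarrow> ell2_norm2 V (translate g f) = ell2_norm2 V f"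
  using infsum_reindex_bij_betw[OF bij_act, of g "\<lambda>v. (cmod (f v))\<^sup>2"]
  by (simp add: ell2_norm2_def translate_def cong: infsum_cong)

lemma translate_inner:
  assumes "g \<in> carrier G"
  shows "ell2_inner V (translate g f) k = ell2_inner V f (translate (inv g) k)"
proof -
  have "ell2_inner V f (translate (inv g) k) = (\<Sum>\<^sub>\<infinity>v\<in>V. f v * cnj (translate (inv g) k v))"
    by (simp add: ell2_inner_def)
  also have "\<dots> = (\<Sum>\<^sub>\<infinity>v\<in>V. f (g <# v) * cnj (translate (inv g) k (g <# v)))"
    by (rule infsum_reindex_bij_betw[OF bij_act[OF assms], symmetric])
  also have "\<dots> = ell2_inner V (translate g f) k"
    unfolding ell2_inner_def
    by (rule infsum_cong) (use assms in \<open>simp add: translate_def act_V act_mult act_one\<close>)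
  finally show ?thesis ..
qed

lemma markov_ell2: "f \<in> ell2 V \<Longrightarrow> M f \<in> ell2 V"
  unfolding markov_eq using S_subset by (intro ell2_sum translate_ell2) auto

lemma markov_inner_left:
  "f \<in> ell2 V \<Longrightarrow> k \<in> ell2 V \<Longrightarrow>
    ell2_inner V (M f) k = (\<Sum>s\<in>S. 1 / of_nat (card S) * ell2_inner V (translate s f) k)"
  unfolding markov_eq using S_subset by (intro ell2_inner_sum_left translate_ell2) auto

lemma markov_symmetric:
  assumes "f \<in> ell2 V" "k \<in> ell2 V"
  shows "ell2_inner V (M f) k = ell2_inner V f (M k)"
proof -
  have "ell2_inner V (M f) k = (\<Sum>s\<in>S. 1 / of_nat (card S) * ell2_inner V f (translate (inv s) k))"
    unfolding markov_inner_left[OF assms] using S_subset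
    by (intro sum.cong refl) (auto simp: translate_inner)
  also have "\<dots> = (\<Sum>s\<in>S. 1 / of_nat (card S) * ell2_inner V f (translate s k))"
    by (rule sum.reindex_bij_witness[of _ "\<lambda>s. inv s" "\<lambda>s. inv s"])
       (use S_subset S_symmetric in auto)
  also have "\<dots> = cnj (ell2_inner V (M k) f)"
    unfolding markov_inner_left[OF assms(2,1)] by (simp add: ell2_inner_commute[of V f])
  finally show ?thesis by (simp add: ell2_inner_commute[of V f])
qed

text \<open>\<open>||M f||^2\<close> is the average of \<open>Re <translate s f, M f>\<close>. Each
  of these is at most \<open>(||f||^2 + ||M f||^2) / 2\<close>, as the expansion of
  \<open>||translate s f - M f||^2\<close> shows, and the half of \<open>||M f||^2\<close> is
  absorbed on the left.\<close>

lemma markov_contraction: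
  assumes f: "f \<in> ell2 V"
  shows "ell2_norm2 V (M f) \<le> ell2_norm2 V f"
proof -
  define c where "c = (ell2_norm2 V f + ell2_norm2 V (M f)) / 2"
  have c: "0 \<le> c" by (simp add: c_def ell2_norm2_nonneg)
  have "Re (ell2_inner V (translate s f) (M f)) \<le> c" if "s \<in> S" for s
  proof -
    have s: "s \<in> carrier G" using that S_subset by auto
    show ?thesis
      using ell2_norm2_lincomb[OF translate_ell2[OF s f] markov_ell2[OF f], of 1 "-1"]
        ell2_norm2_nonneg[of V "\<lambda>v. 1 * translate s f v + (- 1) * M f v"] translate_norm2[OF s, of f]
      by (simp add: c_def)
  qed
  then have "(\<Sum>s\<in>S. 1 / real (card S) * Re (ell2_inner V (translate s f) (M f))) \<le> (\<Sum>s\<in>S. 1 / real (card S) * c)"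
    by (intro sum_mono mult_left_mono) auto
  \<comment> \<open>For empty \<open>S\<close> the sum is 0; otherwise equality holds.\<close>
  also have "\<dots> \<le> c" using c by (cases "card S = 0") auto
  also have "(\<Sum>s\<in>S. 1 / real (card S) * Re (ell2_inner V (translate s f) (M f))) = Re (ell2_inner V (M f) (M f))"
    unfolding markov_inner_left[OF f markov_ell2[OF f]]
    by (simp add: Re_divide_of_nat)
  finally show ?thesis by (simp add: c_def ell2_inner_self)
qed

lemma markov_linear: "ell2_linear V M"
  unfolding ell2_linear_def
proof (intro conjI ballI allI markov_ell2)
  fix f g a b
  show "M (\<lambda>x. a * f x + b * g x) = (\<lambda>x. a * M f x + b * M g x)"
    unfolding markov_eq
    by (auto simp: fun_eq_iff translate_def sum_distrib_left sum.distrib[symmetric] algebra_simps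
        add_divide_distrib intro!: sum.cong)
qed

sublocale ell2_contraction V M
  by unfold_locales (fact markov_linear markov_symmetric markov_contraction)+

end

section \<open>Words in the generators\<close>

context symmetric_subset
begin

definition words :: "nat \<Rightarrow> 'a list set" where
  "words n = {ws. set ws \<subseteq> S \<and> length ws = n}"

definition eval_word :: "'a list \<Rightarrow> 'a" where
  "eval_word ws = foldr (\<otimes>) ws \<one>"

lemma finite_words: "finite (words n)"
  unfolding words_def by (rule finite_lists_length_eq[OF S_finite])

lemma eval_word_closed: "set ws \<subseteq> S \<Longrightarrow> eval_word ws \<in> carrier G"
  by (induction ws) (use S_subset in \<open>auto simp: eval_word_def\<close>)

lemma eval_word_Cons: "eval_word (s # ws) = s \<otimes> eval_word ws"
  by (simp add: eval_word_def)

lemma eval_word_append: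
  "set ws \<subseteq> S \<Longrightarrow> set vs \<subseteq> S \<Longrightarrow> eval_word (ws @ vs) = eval_word ws \<otimes> eval_word vs"
proof (induction ws)
  case Nil then show ?case using eval_word_closed[of vs] by (simp add: eval_word_def)
next
  case (Cons s ws)
  then show ?case
    using S_subset eval_word_closed[of ws] eval_word_closed[of vs] by (auto simp: eval_word_Cons m_assoc)
qed

lemma sum_words_Suc: "(\<Sum>ws\<in>words (Suc n). F ws) = (\<Sum>s\<in>S. \<Sum>ws\<in>words n. F (s # ws))"
proof -
  have "(\<Sum>ws\<in>words (Suc n). F ws) = (\<Sum>(s, ws)\<in>S \<times> words n. F (s # ws))"
    by (rule sum.reindex_bij_witness[of _ "\<lambda>(s, ws). s # ws" "\<lambda>ws. (hd ws, tl ws)"])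
       (auto simp: words_def length_Suc_conv)
  then show ?thesis by (simp add: sum.cartesian_product)
qed

text \<open>Closure of \<open>S\<close> under inverses turns the inverse of a generator into a
  one-letter word.\<close>

lemma generate_word:
  assumes "g \<in> generate G S"
  shows "\<exists>n. \<exists>ws\<in>words n. eval_word ws = g"
proof -
  have "\<exists>ws. set ws \<subseteq> S \<and> eval_word ws = g"
    using assms
  proof (induction rule: generate.induct)
    case one then show ?case by (intro exI[of _ "[]"]) (simp add: eval_word_def)
  next
    case (incl h) then show ?case using S_subset by (intro exI[of _ "[h]"]) (auto simp: eval_word_def)
  next
    case (inv h) then show ?case using S_subset S_symmetric by (intro exI[of _ "[inv h]"]) (auto simp: eval_word_def)
  next
    case (eng h1 h2) then show ?case by (metis eval_word_append set_append Un_least)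
  qed
  then show ?thesis by (auto simp: words_def)
qed

end

text \<open>Splitting off the \<open>M\<close> next to \<open>f\<close> puts the new letter at the
  front of the word, in agreement with \<open>foldr\<close>: the last letter acts first on
  \<open>v\<close>.\<close>

lemma (in schreier_markov) markov_pow:
  assumes "v \<in> V"
  shows "(M ^^ n) f v = (\<Sum>ws\<in>words n. f (eval_word ws <# v)) / of_nat (card S) ^ n"
proof (induction n arbitrary: f)
  case 0
  have "words 0 = {[]}" by (auto simp: words_def)
  then show ?case using assms by (simp add: eval_word_def act_one)
next
  case (Suc n)
  have "(M ^^ Suc n) f v = (\<Sum>ws\<in>words n. M f (eval_word ws <# v)) / of_nat (card S) ^ n"
    using Suc.IH[of "M f"] by (simp add: funpow_swap1)
  also have "(\<Sum>ws\<in>words n. M f (eval_word ws <# v))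
      = (\<Sum>ws\<in>words n. \<Sum>s\<in>S. f (eval_word (s # ws) <# v) / of_nat (card S))"
  proof (rule sum.cong[OF refl])
    fix ws assume "ws \<in> words n"
    then have ws: "eval_word ws \<in> carrier G" by (auto simp: words_def intro: eval_word_closed)
    show "M f (eval_word ws <# v) = (\<Sum>s\<in>S. f (eval_word (s # ws) <# v) / of_nat (card S))"
      unfolding markov_eq translate_def using S_subset assms ws
      by (intro sum.cong refl) (auto simp: act_V act_mult eval_word_Cons)
  qed
  also have "\<dots> = (\<Sum>ws\<in>words (Suc n). f (eval_word ws <# v)) / of_nat (card S)"
    unfolding sum_words_Suc by (subst sum.swap) (simp add: sum_divide_distrib)
  finally show ?case by simp
qed

section \<open>The Kesten spectral measure\<close>

text \<open>The moment is the diagonal entry of \<open>M ^^ n\<close> at the vertex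
  \<open>{\<one>}\<close>, which a word fixes only if its value is the identity. The radius is
  existential because it comes from the chosen \<open>E\<close>.\<close>

lemma (in symmetric_subset) kesten_spectral_measure:
  "finite_measure (kesten_spectral_measure G S)" (is ?finite)
  "sets (kesten_spectral_measure G S) = sets borel" (is ?sets)
  "\<exists>r\<ge>0. AE t in kesten_spectral_measure G S. \<bar>t\<bar> \<le> r" (is ?AE)
  "(LINT t|kesten_spectral_measure G S. t ^ n)
      = (\<Sum>ws\<in>words n. if eval_word ws = \<one> then 1 else 0) / real (card S) ^ n"
proof -
  interpret C: schreier_markov G S "{\<one>}" by unfold_locales simp
  let ?X = "schreier_graph G {\<one>} S"
  define E where "E = spectral_measure_of (verts ?X) (markov_operator ?X)"
  have "is_spectral_measure (verts ?X) (markov_operator ?X) E"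
    unfolding E_def spectral_measure_of_def
    by (rule someI[of "is_spectral_measure (verts ?X) (markov_operator ?X)"])
       (rule C.is_spectral_measure_spectral_projection)
  then interpret E: ell2_spectral_measure "verts ?X" "markov_operator ?X" E
    by unfold_locales (rule C.markov_linear)
  let ?\<delta> = "dirac_function {\<one>}"
  have kesten: "kesten_spectral_measure G S = scalar_spectral_measure (verts ?X) E ?\<delta>"
    by (simp add: kesten_spectral_measure_def cayley_graph_def Let_def E_def)
  have one: "{\<one>} \<in> verts ?X"
    using C.lcos_in_V[OF one_closed] by (simp add: l_coset_def)
  have \<delta>: "?\<delta> \<in> ell2 (verts ?X)" by (rule ell2_dirac[OF one])
  show "(LINT t|kesten_spectral_measure G S. t ^ n)
      = (\<Sum>ws\<in>words n. if eval_word ws = \<one> then 1 else 0) / real (card S) ^ n"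
  proof -
    have "(LINT t|kesten_spectral_measure G S. t ^ n) = Re ((markov_operator ?X ^^ n) ?\<delta> {\<one>})"
      unfolding kesten E.scalar_measure_moments[OF \<delta>] ell2_inner_dirac[OF one] ..
    also have "(markov_operator ?X ^^ n) ?\<delta> {\<one>}
        = (\<Sum>ws\<in>words n. ?\<delta> (eval_word ws <# {\<one>})) / of_nat (card S) ^ n"
      by (rule C.markov_pow[OF one])
    also have "(\<Sum>ws\<in>words n. ?\<delta> (eval_word ws <# {\<one>}))
        = complex_of_real (\<Sum>ws\<in>words n. if eval_word ws = \<one> then 1 else 0)"
      unfolding of_real_sum
      by (rule sum.cong) (auto simp: words_def dirac_function_def l_coset_def eval_word_closed)
    also have "complex_of_real (\<Sum>ws\<in>words n. if eval_word ws = \<one> then 1 else 0) / of_nat (card S) ^ n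
        = complex_of_real ((\<Sum>ws\<in>words n. if eval_word ws = \<one> then 1 else 0) / real (card S) ^ n)"
      by (simp only: of_real_divide of_real_power of_real_of_nat_eq)
    finally show ?thesis by (simp only: Re_complex_of_real)
  qed
  show ?finite unfolding kesten by (rule E.finite_scalar_measure[OF \<delta>])
  show ?sets unfolding kesten by (rule E.sets_scalar_measure)
  show ?AE unfolding kesten using E.radius(1) E.AE_scalar_measure[OF \<delta>] by blast
qed

section \<open>Fixed points on the levels of the tree and on the boundary\<close>

lemma word_prefix_eq_iff: "word_prefix k v = word_prefix k v' \<longleftrightarrow> (\<forall>i<k. v i = v' i)"
  by (auto simp: word_prefix_def)

lemma length_word_prefix [simp]: "length (word_prefix k v) = k"
  by (simp add: word_prefix_def)

lemma prob_space_bernoulli: "prob_space (bernoulli_measure :: (nat \<Rightarrow> 'a::finite) measure)"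
  unfolding bernoulli_measure_def
  by (intro prob_space_PiM prob_space_uniform_count_measure) auto

lemma measure_bernoulli_UNIV: "measure (bernoulli_measure :: (nat \<Rightarrow> 'a::finite) measure) UNIV = 1"
proof -
  have "space (bernoulli_measure :: (nat \<Rightarrow> 'a) measure) = UNIV"
    by (simp add: bernoulli_measure_def space_PiM space_uniform_count_measure)
  then show ?thesis using prob_space.prob_space[OF prob_space_bernoulli] by metis
qed

text \<open>Sets outside the sigma-algebra get \<open>emeasure\<close> 0, whereas the cylinder has
  positive measure; the cylinder formula thus already implies measurability.\<close>

lemma cylinder_sets: "{v. word_prefix (length u) v = u} \<in> sets (bernoulli_measure :: (nat \<Rightarrow> 'a::finite) measure)"
  using emeasure_notin_sets[of "{v. word_prefix (length u) v = u}" bernoulli_measure]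
    emeasure_bernoulli_cylinder[of u] by (cases "{v. word_prefix (length u) v = u} \<in> sets bernoulli_measure") auto

lemma level_set_measure:
  fixes U :: "'a::finite list set"
  assumes "\<And>u. u \<in> U \<Longrightarrow> length u = k"
  shows "{v. word_prefix k v \<in> U} \<in> sets bernoulli_measure"
    and "measure bernoulli_measure {v. word_prefix k v \<in> U} = real (card U) / real CARD('a) ^ k"
proof -
  interpret prob_space "bernoulli_measure :: (nat \<Rightarrow> 'a) measure" by (rule prob_space_bernoulli)
  have fin: "finite U"
    by (rule finite_subset[OF _ finite_lists_length_eq[of UNIV k]]) (use assms in auto)
  have eq: "{v. word_prefix k v \<in> U} = (\<Union>u\<in>U. {v. word_prefix (length u) v = u})"
    using assms by auto
  show "{v. word_prefix k v \<in> U} \<in> sets bernoulli_measure"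
    unfolding eq using fin cylinder_sets by (intro sets.finite_UN) auto
  have "measure bernoulli_measure {v. word_prefix k v \<in> U}
      = (\<Sum>u\<in>U. measure bernoulli_measure {v. word_prefix (length u) v = u})"
    unfolding eq
    by (rule finite_measure_finite_Union[OF fin])
       (use assms cylinder_sets in \<open>auto simp: disjoint_family_on_def\<close>)
  also have "\<dots> = (\<Sum>u\<in>U. 1 / real CARD('a) ^ k)"
  proof (rule sum.cong[OF refl])
    fix u assume "u \<in> U"
    then have "length u = k" by (rule assms)
    then show "measure bernoulli_measure {v. word_prefix (length u) v = u} = 1 / real CARD('a) ^ k"
      using emeasure_bernoulli_cylinder[of u] by (simp add: measure_def)
  qed
  finally show "measure bernoulli_measure {v. word_prefix k v \<in> U} = real (card U) / real CARD('a) ^ k"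
    by simp
qed

context rooted_action
begin

definition level_fixed :: "nat \<Rightarrow> 'b \<Rightarrow> 'a list set" where
  "level_fixed k g = {u. length u = k \<and> \<phi> g u = u}"

definition boundary_fixed :: "'b \<Rightarrow> (nat \<Rightarrow> 'a) set" where
  "boundary_fixed g = {v. boundary_action \<phi> g v = v}"

text \<open>A boundary point is fixed iff all its prefixes are. The fixed set is therefore a
  decreasing intersection of finite unions of cylinders, and continuity from above applies.\<close>

lemma fixed_ratio_tendsto:
  assumes g: "g \<in> carrier G"
  shows "boundary_fixed g \<in> sets bernoulli_measure"
    and "(\<lambda>k. real (card (level_fixed k g)) / real CARD('a) ^ k) \<longlonglongrightarrow> measure bernoulli_measure (boundary_fixed g)"
proof -
  interpret B: prob_space "bernoulli_measure :: (nat \<Rightarrow> 'a) measure" by (rule prob_space_bernoulli)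
  let ?F = "\<lambda>k. {v. word_prefix k v \<in> level_fixed k g}"
  have F: "?F k = {v. \<forall>i<k. boundary_action \<phi> g v i = v i}" for k
    by (auto simp: level_fixed_def word_prefix_boundary_action[OF g, symmetric] word_prefix_eq_iff)
  have fixed: "boundary_fixed g = (\<Inter>k. ?F k)"
    unfolding F boundary_fixed_def by (auto simp: fun_eq_iff)
  have sets: "?F k \<in> sets bernoulli_measure" for k
    by (rule level_set_measure(1)) (simp add: level_fixed_def)
  then show "boundary_fixed g \<in> sets bernoulli_measure"
    unfolding fixed by (intro sets.countable_INT) auto
  have "(\<lambda>k. measure bernoulli_measure (?F k)) \<longlonglongrightarrow> measure bernoulli_measure (\<Inter>k. ?F k)"
    using sets by (intro B.finite_Lim_measure_decseq) (auto simp: decseq_def F)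
  moreover have "measure bernoulli_measure (?F k) = real (card (level_fixed k g)) / real CARD('a) ^ k" for k
    by (rule level_set_measure(2)) (simp add: level_fixed_def)
  ultimately show "(\<lambda>k. real (card (level_fixed k g)) / real CARD('a) ^ k)
      \<longlonglongrightarrow> measure bernoulli_measure (boundary_fixed g)"
    unfolding fixed by simp
qed

lemma action_one: "\<phi> \<one> u = u"
  using id_eq_one by (metis UNIV_I restrict_apply')

lemma boundary_fixed_one: "boundary_fixed \<one> = UNIV"
  by (auto simp: boundary_fixed_def boundary_action_def action_one word_prefix_def simp del: upt_Suc)

lemma ergodically_free_iff:
  "ergodically_free G \<phi> \<longleftrightarrow> (\<forall>g\<in>carrier G. g \<noteq> \<one> \<longrightarrow> measure bernoulli_measure (boundary_fixed g) = 0)"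
proof -
  interpret B: prob_space "bernoulli_measure :: (nat \<Rightarrow> 'a) measure" by (rule prob_space_bernoulli)
  show ?thesis
    unfolding ergodically_free_def boundary_fixed_def[symmetric]
    using fixed_ratio_tendsto(1) by (auto simp: null_sets_def B.emeasure_eq_measure)
qed

section \<open>Schreier graphs of level stabilizers\<close>

text \<open>The coset \<open>g Q\<close> of the stabilizer \<open>Q\<close> of \<open>u0\<close>,
  for any \<open>g\<close> moving \<open>u0\<close> to \<open>u\<close>; it is empty if there is no
  such \<open>g\<close>.\<close>

definition movers :: "'a list \<Rightarrow> 'a list \<Rightarrow> 'b set" where
  "movers u0 u = {g \<in> carrier G. \<phi> g u0 = u}"

lemma group_G: "group G"
  using group_hom by (simp add: group_hom_def)

lemma lcos_movers:
  assumes h: "h \<in> carrier G"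
  shows "h <# movers u0 u = movers u0 (\<phi> h u)"
proof -
  interpret group G by (rule group_G)
  show ?thesis
  proof (intro equalityI subsetI)
    fix x assume "x \<in> h <# movers u0 u"
    then show "x \<in> movers u0 (\<phi> h u)"
      using h by (auto simp: l_coset_def movers_def composition_rule)
  next
    fix x assume x: "x \<in> movers u0 (\<phi> h u)"
    then have "\<phi> (inv h \<otimes> x) u0 = u"
      using h orbit_sym_aux[OF h UNIV_I refl, of u] by (simp add: movers_def composition_rule)
    then have "inv h \<otimes> x \<in> movers u0 u" using x h by (simp add: movers_def)
    moreover have "x = h \<otimes> (inv h \<otimes> x)" using x h by (simp add: movers_def m_assoc[symmetric])
    ultimately show "x \<in> h <# movers u0 u" unfolding l_coset_def by blast
  qed
qed

lemma stabilizer_eq_movers: "stabilizer G \<phi> u0 = movers u0 u0"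
  by (simp add: stabilizer_def movers_def)

text \<open>Orbit-stabilizer correspondence; spherical transitivity makes the orbit of
  \<open>u0\<close> its whole level.\<close>

lemma bij_movers:
  assumes "spherically_transitive G \<phi>"
  shows "bij_betw (movers u0) {u. length u = length u0} (lcosets (stabilizer G \<phi> u0))"
proof -
  have trans: "\<exists>g\<in>carrier G. \<phi> g u0 = u" if "length u = length u0" for u
    using assms that by (auto simp: spherically_transitive_def)
  have "inj_on (movers u0) {u. length u = length u0}"
  proof (rule inj_onI)
    fix u u' assume u: "u \<in> {u. length u = length u0}" "movers u0 u = movers u0 u'"
    then obtain g where "g \<in> movers u0 u" using trans[of u] by (auto simp: movers_def)
    then show "u = u'" using u(2) by (auto simp: movers_def)
  qed
  moreover have "movers u0 ` {u. length u = length u0} = lcosets (stabilizer G \<phi> u0)"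
  proof (intro equalityI subsetI)
    fix v assume "v \<in> movers u0 ` {u. length u = length u0}"
    then obtain u g where "v = movers u0 u" "g \<in> carrier G" "\<phi> g u0 = u" using trans by blast
    then show "v \<in> lcosets (stabilizer G \<phi> u0)"
      by (auto simp: LCOSETS_def stabilizer_eq_movers lcos_movers)
  next
    fix v assume "v \<in> lcosets (stabilizer G \<phi> u0)"
    then obtain g where "g \<in> carrier G" "v = movers u0 (\<phi> g u0)"
      by (auto simp: LCOSETS_def stabilizer_eq_movers lcos_movers)
    then show "v \<in> movers u0 ` {u. length u = length u0}"
      by (auto simp: length_preserving)
  qed
  ultimately show ?thesis by (simp add: bij_betw_def)
qed

text \<open>Up to normalisation the moment is the trace of \<open>M ^^ n\<close>, which by
  \<open>markov_pow\<close> counts pairs of a vertex and a word in the generators whose value fixes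
  it; \<open>movers\<close> translates vertices into tree words.\<close>

lemma level_counting_measure:
  fixes u0 :: "'a list" and S :: "'b set"
  assumes trans: "spherically_transitive G \<phi>" and S: "symmetric_subset G S"
  defines "\<mu> \<equiv> eigenvalue_counting_measure (schreier_graph G (stabilizer G \<phi> u0) S)"
  shows "real_distribution \<mu>" "AE t in \<mu>. \<bar>t\<bar> \<le> 1"
    and "(LINT t|\<mu>. t ^ n) = (\<Sum>ws\<in>symmetric_subset.words S n.
      real (card (level_fixed (length u0) (symmetric_subset.eval_word G ws))) / real CARD('a) ^ length u0)
      / real (card S) ^ n"
proof -
  interpret S: symmetric_subset G S by fact
  let ?Q = "stabilizer G \<phi> u0"
  let ?U = "{u :: 'a list. length u = length u0}"
  interpret X: schreier_markov G S ?Q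
    by unfold_locales (auto simp: stabilizer_def)
  have bij: "bij_betw (movers u0) ?U X.V"
    unfolding X.verts_eq by (rule bij_movers[OF trans])
  have U: "finite ?U" "card ?U = CARD('a) ^ length u0"
    using finite_lists_length_eq[of "UNIV :: 'a set" "length u0"]
      card_lists_length_eq[of "UNIV :: 'a set" "length u0"] by auto
  have card: "card X.V = CARD('a) ^ length u0" using bij_betw_same_card[OF bij] U(2) by simp
  interpret X: finite_contraction X.V X.M
    by unfold_locales (use bij_betw_finite[OF bij] U(1) in simp)
  have ne: "X.V \<noteq> {}" using card by force
  have \<mu>: "\<mu> = measure_of UNIV (sets borel) (\<lambda>B. \<Sum>l\<in>eigenvalues X.V X.M.
    ennreal (real (eigenvalue_multiplicity X.V X.M l) / real (card X.V)) * emeasure (return borel l) B)"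
    by (simp only: \<mu>_def eigenvalue_counting_measure_def Let_def)
  show "real_distribution \<mu>" "AE t in \<mu>. \<bar>t\<bar> \<le> 1"
    unfolding \<mu> by (rule X.counting_measure[OF ne])+
  let ?w = "\<lambda>ws. card (level_fixed (length u0) (S.eval_word ws))"
  have "(\<Sum>v\<in>X.V. (X.M ^^ n) (dirac_function v) v) =
      (\<Sum>v\<in>X.V. \<Sum>ws\<in>S.words n. dirac_function v (S.eval_word ws <# v)) / of_nat (card S) ^ n"
    by (simp add: X.markov_pow sum_divide_distrib)
  also have "(\<Sum>v\<in>X.V. \<Sum>ws\<in>S.words n. dirac_function v (S.eval_word ws <# v)) = (\<Sum>ws\<in>S.words n. of_nat (?w ws))"
  proof (subst sum.swap, rule sum.cong[OF refl])
    fix ws assume "ws \<in> S.words n"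
    then have h: "S.eval_word ws \<in> carrier G" by (auto simp: S.words_def intro: S.eval_word_closed)
    have "(\<Sum>v\<in>X.V. dirac_function v (S.eval_word ws <# v))
        = (\<Sum>u\<in>?U. dirac_function (movers u0 u) (S.eval_word ws <# movers u0 u))"
      by (rule sum.reindex_bij_betw[OF bij, symmetric])
    also have "\<dots> = (\<Sum>u\<in>?U. if \<phi> (S.eval_word ws) u = u then 1 else 0)"
    proof (rule sum.cong[OF refl])
      fix u assume u: "u \<in> ?U"
      then have "\<phi> (S.eval_word ws) u \<in> ?U" by (simp add: length_preserving[OF h])
      then have "movers u0 (\<phi> (S.eval_word ws) u) = movers u0 u \<longleftrightarrow> \<phi> (S.eval_word ws) u = u"
        using u by (intro inj_on_eq_iff[OF bij_betw_imp_inj_on[OF bij]])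
      then show "dirac_function (movers u0 u) (S.eval_word ws <# movers u0 u)
          = (if \<phi> (S.eval_word ws) u = u then 1 else 0)"
        by (simp add: lcos_movers[OF h] dirac_function_def)
    qed
    also have "\<dots> = of_nat (?w ws)"
      using U(1) by (simp add: sum.If_cases level_fixed_def Int_def)
    finally show "(\<Sum>v\<in>X.V. dirac_function v (S.eval_word ws <# v)) = of_nat (?w ws)" .
  qed
  finally have tr: "(\<Sum>v\<in>X.V. (X.M ^^ n) (dirac_function v) v)
      = (\<Sum>ws\<in>S.words n. of_nat (?w ws)) / of_nat (card S) ^ n" .
  have "complex_of_real (LINT t|\<mu>. t ^ n)
      = (\<Sum>ws\<in>S.words n. of_nat (?w ws)) / of_nat (card S) ^ n / of_nat (card X.V)"
    unfolding \<mu> X.counting_measure(3)[OF ne] tr ..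
  also have "\<dots> = complex_of_real ((\<Sum>ws\<in>S.words n. real (?w ws) / real CARD('a) ^ length u0) / real (card S) ^ n)"
    unfolding card sum_divide_distrib[symmetric] by (simp add: mult.commute)
  finally show "(LINT t|\<mu>. t ^ n) = (\<Sum>ws\<in>S.words n. real (?w ws) / real CARD('a) ^ length u0) / real (card S) ^ n"
    by (simp only: of_real_eq_iff)
qed

text \<open>\<open>THE\<close> requires uniqueness among all weak limits, including those not known
  in advance to have compact support. Weak convergence transfers the support in
  \<open>[-1, 1]\<close> to any limit, and then the moments decide.\<close>

lemma KNS_spectral_measure:
  assumes trans: "spherically_transitive G \<phi>" and S: "symmetric_subset G S"
    and Xk: "\<And>k. Xk k = schreier_graph G (stabilizer G \<phi> (word_prefix k w)) S"
  shows "real_distribution (KNS_spectral_measure X Xk)" "AE t in KNS_spectral_measure X Xk. \<bar>t\<bar> \<le> 1"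
    and "(LINT t|KNS_spectral_measure X Xk. t ^ n) = (\<Sum>ws\<in>symmetric_subset.words S n.
      measure bernoulli_measure (boundary_fixed (symmetric_subset.eval_word G ws))) / real (card S) ^ n"
proof -
  interpret S: symmetric_subset G S by fact
  let ?\<mu> = "\<lambda>k. eigenvalue_counting_measure (Xk k)"
  let ?c = "\<lambda>n. (\<Sum>ws\<in>S.words n. measure bernoulli_measure (boundary_fixed (S.eval_word ws))) / real (card S) ^ n"
  have \<mu>: "real_distribution (?\<mu> k)" "AE t in ?\<mu> k. \<bar>t\<bar> \<le> 1" for k
    unfolding Xk by (rule level_counting_measure[OF trans S])+
  have lim: "(\<lambda>k. LINT t|?\<mu> k. t ^ m) \<longlonglongrightarrow> ?c m" for m
    unfolding Xk level_counting_measure(3)[OF trans S] length_word_prefix divide_inverse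
    by (intro tendsto_mult tendsto_const tendsto_sum fixed_ratio_tendsto(2)[unfolded divide_inverse])
       (auto simp: S.words_def intro: S.eval_word_closed)
  obtain N where N: "real_distribution N" "AE t in N. \<bar>t\<bar> \<le> 1" "\<And>m. (LINT t|N. t ^ m) = ?c m" "weak_conv_m ?\<mu> N"
    using method_of_moments[of 1 ?\<mu> ?c, OF _ \<mu> lim] by auto
  have "KNS_spectral_measure X Xk = N"
    unfolding KNS_spectral_measure_def
  proof (rule the_equality)
    show "real_distribution N \<and> weak_conv_m ?\<mu> N" using N by simp
    fix L assume L: "real_distribution L \<and> weak_conv_m ?\<mu> L"
    interpret L: real_distribution L using L by simp
    interpret N: real_distribution N by (rule N(1))
    have "(LINT t|L. t ^ m) = (LINT t|N. t ^ m)" for m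
      using weak_conv_moments[of 1 ?\<mu> L m, OF _ \<mu>] weak_conv_moments[of 1 ?\<mu> N m, OF _ \<mu> N(1,4)] L
      by (auto intro: LIMSEQ_unique)
    moreover have "AE t in L. \<bar>t\<bar> \<le> 1"
      using weak_conv_compact_support[of ?\<mu> 1 L, OF \<mu>] L by simp
    ultimately show "L = N"
      using N(2) by (intro finite_measure_eqI_moments[of L 1 N])
        (auto intro: L.finite_measure_axioms N.finite_measure_axioms)
  qed
  note eq = this
  show "real_distribution (KNS_spectral_measure X Xk)" "AE t in KNS_spectral_measure X Xk. \<bar>t\<bar> \<le> 1"
    "(LINT t|KNS_spectral_measure X Xk. t ^ n) = ?c n"
    unfolding eq by (rule N)+
qed

end

section \<open>Comparison of the two spectral measures\<close>

theorem theorem4p4: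
  fixes G :: "('g, 'm) monoid_scheme"
    and \<phi> :: "'g \<Rightarrow> 'a::finite list \<Rightarrow> 'a list"
    and S P :: "'g set"
    and w :: "nat \<Rightarrow> 'a"
    and Pk :: "nat \<Rightarrow> 'g set"
    and X :: "('g set, 'g set \<times> 'g) pre_digraph"
    and Xk :: "nat \<Rightarrow> ('g set, 'g set \<times> 'g) pre_digraph"
  assumes action: "rooted_action G \<phi>"
    and transitive: "spherically_transitive G \<phi>"
    and S_finite: "finite S"
    and S_subset: "S \<subseteq> carrier G"
    and S_symmetric: "\<forall>s\<in>S. inv\<^bsub>G\<^esub> s \<in> S"
    and S_generates: "generate G S = carrier G"
    and P: "P = stabilizer G (boundary_action \<phi>) w"
    and Pk: "\<forall>k. Pk k = stabilizer G \<phi> (word_prefix k w)"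
    and X: "X = schreier_graph G P S"
    and Xk: "\<forall>k. Xk k = schreier_graph G (Pk k) S"
  shows "KNS_spectral_measure X Xk = kesten_spectral_measure G S \<longleftrightarrow> ergodically_free G \<phi>"
proof -
  interpret rooted_action G \<phi> by fact
  interpret group G by (rule group_G)
  interpret S: symmetric_subset G S
    using S_finite S_subset S_symmetric by unfold_locales auto
  interpret B: prob_space "bernoulli_measure :: (nat \<Rightarrow> 'a) measure" by (rule prob_space_bernoulli)
  let ?K = "KNS_spectral_measure X Xk" and ?L = "kesten_spectral_measure G S"
  let ?\<nu> = "\<lambda>g. measure bernoulli_measure (boundary_fixed g)"
  let ?d = "\<lambda>g. if g = \<one>\<^bsub>G\<^esub> then 1 else 0 :: real"
  have Xk': "Xk k = schreier_graph G (stabilizer G \<phi> (word_prefix k w)) S" for k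
    using Pk Xk by simp
  note K = KNS_spectral_measure[OF transitive S.symmetric_subset_axioms Xk', of X]
  interpret K: real_distribution ?K by (rule K(1))
  note L = S.kesten_spectral_measure
  obtain r where r: "AE t in ?L. \<bar>t\<bar> \<le> r" using L(3) by blast
  \<comment> \<open>Every boundary point is fixed by the identity, so equality holds there;
    elsewhere the left side is 0.\<close>
  have d_le: "?d g \<le> ?\<nu> g" for g
    by (simp add: boundary_fixed_one measure_bernoulli_UNIV)
  show ?thesis
  proof
    assume eq: "?K = ?L"
    show "ergodically_free G \<phi>"
      unfolding ergodically_free_iff
    proof (intro ballI impI)
      fix g assume g: "g \<in> carrier G" "g \<noteq> \<one>\<^bsub>G\<^esub>"
      then obtain n ws where ws: "ws \<in> S.words n" "S.eval_word ws = g"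
        using S.generate_word[of g] S_generates by auto
      \<comment> \<open>\<open>S\<close> may be empty if the group is trivial, but a word over the
        empty set has length 0 and the power is then 1.\<close>
      have "real (card S) ^ n \<noteq> 0"
        using ws(1) S_finite by (cases ws) (auto simp: S.words_def)
      moreover have "(\<Sum>ws\<in>S.words n. ?\<nu> (S.eval_word ws)) / real (card S) ^ n
          = (\<Sum>ws\<in>S.words n. ?d (S.eval_word ws)) / real (card S) ^ n"
        unfolding K(3)[symmetric] L(4)[symmetric] eq ..
      ultimately have "(\<Sum>ws\<in>S.words n. ?\<nu> (S.eval_word ws)) = (\<Sum>ws\<in>S.words n. ?d (S.eval_word ws))"
        by (simp only: divide_cancel_right) simp
      \<comment> \<open>The differences are nonnegative, so a vanishing sum makes each of them 0, in
        particular the one for the word with value \<open>g\<close>.\<close>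
      then have "(\<Sum>ws\<in>S.words n. ?\<nu> (S.eval_word ws) - ?d (S.eval_word ws)) = 0"
        by (simp add: sum_subtractf)
      then have "?\<nu> (S.eval_word ws) - ?d (S.eval_word ws) = 0"
        using ws(1) d_le S.finite_words[of n]
        by (subst (asm) sum_nonneg_eq_0_iff) auto
      then show "?\<nu> g = 0" using g ws(2) by simp
    qed
  next
    assume free: "ergodically_free G \<phi>"
    have \<nu>: "?\<nu> g = ?d g" if "g \<in> carrier G" for g
      using free that unfolding ergodically_free_iff
      by (auto simp: boundary_fixed_one measure_bernoulli_UNIV)
    show "?K = ?L"
    \<comment> \<open>One support is bounded by 1, the other by the unspecified \<open>r\<close>;
      the comparison takes a common radius.\<close>
    proof (rule finite_measure_eqI_moments[where r = "max 1 r"])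
      show "AE t in ?K. \<bar>t\<bar> \<le> max 1 r" using K(2) by eventually_elim simp
      show "AE t in ?L. \<bar>t\<bar> \<le> max 1 r" using r by eventually_elim simp
      fix n
      show "(LINT t|?K. t ^ n) = (LINT t|?L. t ^ n)"
        unfolding K(3) L(4) using \<nu>
        by (intro arg_cong2[of _ _ _ _ "(/)"] sum.cong refl) (auto simp: S.words_def S.eval_word_closed)
    qed (use L K.finite_measure_axioms in auto)
  qed
qed

end
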